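(* For every connected, non-acyclic finite simple graph $G$, we have $$\operatorname{mcd}(G)=\min_A\left\lceil\frac{|A|}{\operatorname{nul}(A)}\right\rceil,$$ where $A$ ranges over all nonempty flats of the graphic matroid $M=M(G)$ such that $M|_A$ is indecomposable as a direct sum. (Graph-theoretically, $A$ ranges over all nonempty edge sets of 2-connected induced subgraphs of $G$.)
   Context: Let $\mathbb{F}$ be an algebraically closed field and $\mathbb{P}^d$ the projective $d$-space over $\mathbb{F}$. Let $G$ be a finite simple graph with vertex set $V$ and edge set $E$. A picture $P$ of $G$ in $\mathbb{P}^d$ consists of a point $P(v)\in\mathbb{P}^d$ for each vertex $v$ and a line $P(e)\subseteq\mathbb{P}^d$ for each edge $e$, such that $P(v)\in P(e)$ whenever $v$ is an endpoint of $e$. The picture space $\mathcal{X}^d(G)$ is the set of all pictures of $G$, regarded as a Zariski-closed (reduced) algebraic subset of the product of $|V|$ copies of $\mathbb{P}^d$ and $|E|$ copies of the Grassmannian of lines in $\mathbb{P}^d$. For a connected non-acyclic graph $G$, the minimum constraint dimension $\operatorname{mcd}(G)$ is the smallest positive integer $d$ for which $\mathcal{X}^d(G)$ is not irreducible. For $A\subseteq E$, the rank $r(A)$ is the size of a maximum acyclic subset of $A$, and $\operatorname{nul}(A)=|A|-r(A)$. The ratio $|A|/\operatorname{nul}(A)$ is interpreted as $+\infty$ when $\operatorname{nul}(A)=0$. *)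

theory Defs
  imports
    Complex_Main
    "HOL-Library.Function_Algebras"
    "HOL-Library.FuncSet"
    "HOL-Library.Poly_Mapping"
    "HOL-Library.Extended_Nat"
    "HOL-Computational_Algebra.Polynomial"
begin

section \<open>Graphs\<close>

text \<open>An edge is the two-element set of its endpoints.\<close>

definition finite_simple_graph :: "'v set \<Rightarrow> 'v set set \<Rightarrow> bool" where
  "finite_simple_graph V E \<longleftrightarrow> finite V \<and> (\<forall>e\<in>E. e \<subseteq> V \<and> card e = 2)"

definition induced_edges :: "'v set set \<Rightarrow> 'v set \<Rightarrow> 'v set set" where
  "induced_edges E W = {e \<in> E. e \<subseteq> W}"

definition connected_graph :: "'v set \<Rightarrow> 'v set set \<Rightarrow> bool" where
  "connected_graph V E \<longleftrightarrow>
     V \<noteq> {} \<and> (\<forall>u\<in>V. \<forall>v\<in>V. (u, v) \<in> {(x, y). {x, y} \<in> E}\<^sup>*)"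

text \<open>Connected without a cut vertex. In particular a single edge, and a single vertex, count as
  2-connected.\<close>

definition two_connected_graph :: "'v set \<Rightarrow> 'v set set \<Rightarrow> bool" where
  "two_connected_graph V E \<longleftrightarrow> connected_graph V E \<and>
     (\<forall>x\<in>V. V \<noteq> {x} \<longrightarrow> connected_graph (V - {x}) (induced_edges E (V - {x})))"

definition is_cycle :: "'v set set \<Rightarrow> 'v list \<Rightarrow> bool" where
  "is_cycle A c \<longleftrightarrow> 3 \<le> length c \<and> distinct c \<and>
     (\<forall>i<length c. {c ! i, c ! (Suc i mod length c)} \<in> A)"

definition acyclic_edges :: "'v set set \<Rightarrow> bool" where
  "acyclic_edges A \<longleftrightarrow> (\<nexists>c. is_cycle A c)"


section \<open>Matroids\<close>

text \<open>A matroid is given by a ground set together with the predicate \<open>indep\<close> on its subsets. The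
  graphic matroid of a graph has its edge set as ground set and \<^const>\<open>acyclic_edges\<close> as predicate;
  the restriction to \<open>A\<close> keeps the predicate and has ground set \<open>A\<close>.\<close>

definition matroid_rank :: "('e set \<Rightarrow> bool) \<Rightarrow> 'e set \<Rightarrow> nat" where
  "matroid_rank indep A = Max (card ` {B. B \<subseteq> A \<and> indep B})"

definition nullity :: "('e set \<Rightarrow> bool) \<Rightarrow> 'e set \<Rightarrow> nat" where
  "nullity indep A = card A - matroid_rank indep A"

definition flat :: "('e set \<Rightarrow> bool) \<Rightarrow> 'e set \<Rightarrow> 'e set \<Rightarrow> bool" where
  "flat indep E A \<longleftrightarrow> A \<subseteq> E \<and> (\<forall>e\<in>E - A. matroid_rank indep A < matroid_rank indep (insert e A))"

text \<open>The restriction to \<open>A\<close> is the direct sum of its restrictions to \<open>B\<close> and \<open>C\<close>.\<close>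

definition direct_sum_decomposition ::
    "('e set \<Rightarrow> bool) \<Rightarrow> 'e set \<Rightarrow> 'e set \<Rightarrow> 'e set \<Rightarrow> bool" where
  "direct_sum_decomposition indep A B C \<longleftrightarrow> B \<union> C = A \<and> B \<inter> C = {} \<and>
     {I. I \<subseteq> A \<and> indep I} = {J \<union> K |J K. J \<subseteq> B \<and> indep J \<and> K \<subseteq> C \<and> indep K}"

definition indecomposable :: "('e set \<Rightarrow> bool) \<Rightarrow> 'e set \<Rightarrow> bool" where
  "indecomposable indep A \<longleftrightarrow>
     (\<nexists>B C. B \<noteq> {} \<and> C \<noteq> {} \<and> direct_sum_decomposition indep A B C)"


section \<open>Projective space and its lines\<close>

definition vscale :: "'a::field \<Rightarrow> (nat \<Rightarrow> 'a) \<Rightarrow> nat \<Rightarrow> 'a" where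
  "vscale c x = (\<lambda>i. c * x i)"

global_interpretation vec: vector_space vscale
  by unfold_locales (auto simp: vscale_def fun_eq_iff algebra_simps)

text \<open>The vector space with coordinates \<open>0, \<dots>, d\<close>.\<close>

definition coordinate_space :: "nat \<Rightarrow> (nat \<Rightarrow> 'a::field) set" where
  "coordinate_space d = {x. \<forall>i>d. x i = 0}"

text \<open>A linear subspace of projective \<open>d\<close>-space is represented by its cone, so that a point lies on
  a line iff one linear subspace contains the other.\<close>

definition proj_points :: "nat \<Rightarrow> (nat \<Rightarrow> 'a::field) set set" where
  "proj_points d = {L. vec.subspace L \<and> L \<subseteq> coordinate_space d \<and> vec.dim L = 1}"

definition proj_lines :: "nat \<Rightarrow> (nat \<Rightarrow> 'a::field) set set" where
  "proj_lines d = {L. vec.subspace L \<and> L \<subseteq> coordinate_space d \<and> vec.dim L = 2}"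


section \<open>Picture spaces\<close>

type_synonym ('v, 'a) picture =
  "('v \<Rightarrow> (nat \<Rightarrow> 'a) set) \<times> ('v set \<Rightarrow> (nat \<Rightarrow> 'a) set)"

definition ambient_space :: "nat \<Rightarrow> 'v set \<Rightarrow> 'v set set \<Rightarrow> ('v, 'a::field) picture set" where
  "ambient_space d V E = (V \<rightarrow>\<^sub>E proj_points d) \<times> (E \<rightarrow>\<^sub>E proj_lines d)"

definition picture_space :: "nat \<Rightarrow> 'v set \<Rightarrow> 'v set set \<Rightarrow> ('v, 'a::field) picture set" where
  "picture_space d V E = {(p, l) \<in> ambient_space d V E. \<forall>e\<in>E. \<forall>v\<in>e. p v \<subseteq> l e}"


section \<open>The Zariski topology on a product of projective spaces and Grassmannians of lines\<close>

text \<open>\<open>Point_Coord v i\<close> is the \<open>i\<close>-th homogeneous coordinate of the point at \<open>v\<close>, and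
  \<open>Line_Coord e i j\<close> the \<open>(i, j)\<close> Pluecker coordinate of the line at \<open>e\<close>.\<close>

datatype 'v coord = Point_Coord 'v nat | Line_Coord "'v set" nat nat

definition point_coords :: "nat \<Rightarrow> 'v \<Rightarrow> 'v coord set" where
  "point_coords d v = {Point_Coord v i |i. i \<le> d}"

definition line_coords :: "nat \<Rightarrow> 'v set \<Rightarrow> 'v coord set" where
  "line_coords d e = {Line_Coord e i j |i j. i < j \<and> j \<le> d}"

type_synonym ('x, 'a) mpoly = "('x \<Rightarrow>\<^sub>0 nat) \<Rightarrow>\<^sub>0 'a"

definition mpoly_eval :: "('x \<Rightarrow> 'a::comm_ring_1) \<Rightarrow> ('x, 'a) mpoly \<Rightarrow> 'a" where
  "mpoly_eval x f = (\<Sum>m\<in>Poly_Mapping.keys f.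
     Poly_Mapping.lookup f m * (\<Prod>c\<in>Poly_Mapping.keys m. x c ^ Poly_Mapping.lookup m c))"

definition homogeneous_in :: "'x set \<Rightarrow> ('x, 'a::zero) mpoly \<Rightarrow> bool" where
  "homogeneous_in X f \<longleftrightarrow>
     (\<exists>n. \<forall>m\<in>Poly_Mapping.keys f. (\<Sum>c\<in>X. Poly_Mapping.lookup m c) = n)"

definition multihomogeneous ::
    "nat \<Rightarrow> 'v set \<Rightarrow> 'v set set \<Rightarrow> ('v coord, 'a::zero) mpoly \<Rightarrow> bool" where
  "multihomogeneous d V E f \<longleftrightarrow>
     (\<forall>m\<in>Poly_Mapping.keys f.
        Poly_Mapping.keys m \<subseteq> (\<Union>v\<in>V. point_coords d v) \<union> (\<Union>e\<in>E. line_coords d e)) \<and>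
     (\<forall>v\<in>V. homogeneous_in (point_coords d v) f) \<and>
     (\<forall>e\<in>E. homogeneous_in (line_coords d e) f)"

text \<open>The Pluecker coordinates of a line are the \<open>2 \<times> 2\<close> minors of a matrix whose rows \<open>a\<close>, \<open>b\<close> form
  a basis of the corresponding two-dimensional subspace.\<close>

definition homogeneous_coordinates ::
    "'v set \<Rightarrow> 'v set set \<Rightarrow> ('v, 'a::field) picture \<Rightarrow> ('v coord \<Rightarrow> 'a) \<Rightarrow> bool" where
  "homogeneous_coordinates V E P x \<longleftrightarrow>
     (\<forall>v\<in>V. \<exists>a. fst P v = vec.span {a} \<and> (\<forall>i. x (Point_Coord v i) = a i)) \<and>
     (\<forall>e\<in>E. \<exists>a b. snd P e = vec.span {a, b} \<and>
        (\<forall>i j. x (Line_Coord e i j) = a i * b j - a j * b i))"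

definition vanishes_at ::
    "'v set \<Rightarrow> 'v set set \<Rightarrow> ('v coord, 'a::field) mpoly \<Rightarrow> ('v, 'a) picture \<Rightarrow> bool" where
  "vanishes_at V E f P \<longleftrightarrow> (\<forall>x. homogeneous_coordinates V E P x \<longrightarrow> mpoly_eval x f = 0)"

definition zariski_closed ::
    "nat \<Rightarrow> 'v set \<Rightarrow> 'v set set \<Rightarrow> ('v, 'a::field) picture set \<Rightarrow> bool" where
  "zariski_closed d V E Z \<longleftrightarrow> (\<exists>S. (\<forall>f\<in>S. multihomogeneous d V E f) \<and>
     Z = {P \<in> ambient_space d V E. \<forall>f\<in>S. vanishes_at V E f P})"

definition zariski_irreducible ::
    "nat \<Rightarrow> 'v set \<Rightarrow> 'v set set \<Rightarrow> ('v, 'a::field) picture set \<Rightarrow> bool" where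
  "zariski_irreducible d V E X \<longleftrightarrow> X \<noteq> {} \<and>
     (\<forall>Z\<^sub>1 Z\<^sub>2. zariski_closed d V E Z\<^sub>1 \<and> zariski_closed d V E Z\<^sub>2 \<and> X \<subseteq> Z\<^sub>1 \<union> Z\<^sub>2
        \<longrightarrow> X \<subseteq> Z\<^sub>1 \<or> X \<subseteq> Z\<^sub>2)"


section \<open>The minimum constraint dimension\<close>

text \<open>The value is \<open>\<infinity>\<close> if all picture spaces are irreducible. The first argument only carries the
  ground field.\<close>

definition mcd :: "'a::alg_closed_field itself \<Rightarrow> 'v set \<Rightarrow> 'v set set \<Rightarrow> enat" where
  "mcd _ V E = Inf {enat d |d. 0 < d \<and>
     \<not> zariski_irreducible d V E (picture_space d V E :: ('v, 'a) picture set)}"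

definition ceiling_ratio :: "'v set set \<Rightarrow> enat" where
  "ceiling_ratio A = (if nullity acyclic_edges A = 0 then \<infinity>
     else enat (nat \<lceil>real (card A) / real (nullity acyclic_edges A)\<rceil>))"

end

theory Submission
  imports Defs
begin

text \<open>
  The picture space is irreducible if and only if \<open>d * nul(A) < |A|\<close> for every nonempty edge set \<open>A\<close>.

  If the inequality always holds, take a picture and let \<open>A\<close> be its set of collapsed edges, those whose
  two endpoints are mapped to the same point. Moving the vertices infinitesimally while keeping the
  lines at \<open>A\<close> parallel is a linear system of \<open>(d - 1) |A|\<close> equations; the displacements along a
  spanning forest of \<open>A\<close> are \<open>d r(A)\<close> unknowns, and \<open>d r(A) > (d - 1) |A|\<close>. A nonzero solution \<open>x\<^sub>1\<close> gives
  a curve \<open>x\<^sub>0 + t x\<^sub>1\<close> of pictures with fewer collapsed edges, so by induction the pictures without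
  collapsed edges are dense; they are parametrized by an open set of vertex positions, hence
  irreducible. Only polynomials in the one variable \<open>t\<close> are needed.

  Conversely let \<open>(d - 1) |A| \<ge> d r(A)\<close>. On pictures without collapsed edges the directions of the
  lines at \<open>A\<close> are linear in the \<open>d r(A)\<close> coordinates of the displacements along a spanning forest.
  A dimension count yields a nonzero multihomogeneous polynomial in the directions that vanishes on
  all of them, but not on all pictures that map every vertex to one point, since there the directions
  are arbitrary.

  Finally, a nonempty \<open>A\<close> with \<open>d * nul(A) \<ge> |A|\<close> that has minimal rank, and maximal size among those,
  is an indecomposable flat.
\<close>

section \<open>Cycles and connectivity\<close>

text \<open>Since \<open>|A| = r(A) + nul(A)\<close>, the condition \<open>d * nul(A) < |A|\<close>
  is the same as \<open>d * r(A) > (d - 1) * |A|\<close>, so one inequality governs both directions.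
  For the linear system to have these sizes, motions must be counted in projective space: a vertex
  vector has d + 1 coordinates but is defined only up to a factor, so one coordinate that is nonzero
  at the start is frozen. This leaves d unknowns per forest edge, and being parallel to a given
  direction costs d - 1 equations per edge. In the converse only the weak inequality is available,
  and the case of equality must still produce a relation. Homogeneity provides it: the exponents of
  forms of fixed degree in \<open>d * r(A)\<close> variables have one degree of freedom less than
  there are variables, whereas the polynomials in the directions, dehomogenized at each edge, have
  \<open>(d - 1) * |A|\<close> free exponents. A relation between displacements says nothing about
  the direction of a line at a collapsed edge. Reducibility is therefore shown with a second
  polynomial that vanishes on the pictures for which the relation may fail; the two zero sets
  together cover the picture space.\<close>

abbreviation edge_rel :: "'v set set \<Rightarrow> ('v \<times> 'v) set" where
  "edge_rel A \<equiv> {(x, y). {x, y} \<in> A}"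

lemma edge_rel_rtrancl_sym: "(u, v) \<in> (edge_rel A)\<^sup>* \<Longrightarrow> (v, u) \<in> (edge_rel A)\<^sup>*"
proof -
  have "sym (edge_rel A)"
    by (auto simp: sym_def insert_commute)
  then show "(u, v) \<in> (edge_rel A)\<^sup>* \<Longrightarrow> (v, u) \<in> (edge_rel A)\<^sup>*"
    by (meson sym_rtrancl symD)
qed

lemma edge_rel_rtrancl_mono: "(u, v) \<in> (edge_rel A)\<^sup>* \<Longrightarrow> A \<subseteq> B \<Longrightarrow> (u, v) \<in> (edge_rel B)\<^sup>*"
  by (erule subsetD[OF rtrancl_mono, rotated]) auto

lemma edge_rel_rtrancl_invariant:
  assumes "(u, v) \<in> (edge_rel A)\<^sup>*" "P u" "\<And>x y. {x, y} \<in> A \<Longrightarrow> P x \<Longrightarrow> P y"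
  shows "P v"
  using assms(1)
proof induction
  case (step y z)
  then show ?case
    using assms(3)[of y z] by simp
qed (rule assms(2))

lemma simple_path_exists:
  assumes "(u, v) \<in> (edge_rel A)\<^sup>*"
  shows "\<exists>p. p \<noteq> [] \<and> distinct p \<and> hd p = u \<and> last p = v \<and> successively (\<lambda>x y. {x, y} \<in> A) p"
  using assms
proof (induction rule: converse_rtrancl_induct)
  case base
  show ?case by (rule exI[of _ "[v]"]) auto
next
  case (step u y)
  then obtain p where p: "p \<noteq> []" "distinct p" "hd p = y" "last p = v"
      "successively (\<lambda>x y. {x, y} \<in> A) p"
    by auto
  show ?case
  proof (cases "u \<in> set p")
    \<comment> \<open>The vertex \<open>u\<close> already lies on the path: dropping everything
      before it erases the loop.\<close>
    case True
    then obtain p1 p2 where "p = p1 @ u # p2"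
      by (meson split_list)
    then show ?thesis
      using p by (intro exI[of _ "u # p2"]) (auto simp: successively_append_iff)
  next
    case False
    then show ?thesis
      using p step.hyps by (intro exI[of _ "u # p"]) (auto simp: successively_Cons)
  qed
qed

lemma is_cycle_if_path:
  assumes "3 \<le> length p" "distinct p" "successively (\<lambda>x y. {x, y} \<in> A) p" "{last p, hd p} \<in> A"
  shows "is_cycle A p"
proof -
  have "{p ! i, p ! (Suc i mod length p)} \<in> A" if "i < length p" for i
  proof (cases "Suc i = length p")
    case True
    then have "p ! i = last p"
      using last_conv_nth[of p] assms(1) by (metis diff_Suc_1 list.size(3) not_numeral_le_zero)
    moreover have "p \<noteq> []"
      using assms(1) by auto
    ultimately show ?thesis
      using True assms(4) by (simp add: hd_conv_nth)
  next
    case False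
    then show ?thesis
      using that successively_conv_nth[THEN iffD1, OF assms(3)] by simp
  qed
  then show ?thesis
    using assms by (auto simp: is_cycle_def)
qed

lemma acyclic_edges_subset: "acyclic_edges B \<Longrightarrow> C \<subseteq> B \<Longrightarrow> acyclic_edges C"
  unfolding acyclic_edges_def is_cycle_def by (metis subsetD)

lemma acyclic_edges_empty: "acyclic_edges ({} :: 'v set set)"
  unfolding acyclic_edges_def is_cycle_def
proof clarify
  fix c :: "'v list"
  assume "3 \<le> length c" "\<forall>i<length c. {c ! i, c ! (Suc i mod length c)} \<in> {}"
  then show False
    by (auto dest!: spec[of _ 0])
qed

text \<open>The remaining edges of the cycle lead from one end of \<open>e\<close> back to the
  other. The cyclic reindexing \<open>a k\<close> puts \<open>e\<close> at \<open>{a 0, a 1}\<close>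
  and the walk at \<open>a 1, ..., a n = a 0\<close>, so the wrap-around needs no case of its
  own.\<close>

lemma cycle_path_avoiding_edge:
  assumes cyc: "is_cycle (insert e B) c" and i: "i < length c" "{c ! i, c ! (Suc i mod length c)} = e"
  shows "(c ! (Suc i mod length c), c ! i) \<in> (edge_rel B)\<^sup>*"
proof -
  define n where "n = length c"
  have n: "3 \<le> n" "distinct c"
    using cyc by (auto simp: is_cycle_def n_def)
  define a where "a k = c ! ((i + k) mod n)" for k
  have a_eq_iff: "a k = a l \<longleftrightarrow> k = l" if "k < n" "l < n" for k l
  proof
    assume "a k = a l"
    moreover have "(i + k) mod n < length c" "(i + l) mod n < length c"
      using n by (auto simp: n_def intro!: mod_less_divisor)
    ultimately have "(i + k) mod n = (i + l) mod n"
      using n nth_eq_iff_index_eq[of c] by (simp add: a_def)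
    then show "k = l"
      using that i(1) unfolding n_def[symmetric] by (auto simp: mod_if split: if_splits)
  qed simp
  have step: "{a k, a (Suc k)} \<in> insert e B" for k
  proof -
    have "(i + k) mod n < n"
      using n by simp
    moreover have "Suc ((i + k) mod n) mod n = (i + Suc k) mod n"
      by (simp add: mod_Suc_eq)
    ultimately show ?thesis
      using cyc unfolding is_cycle_def a_def n_def by metis
  qed
  have e: "e = {a 0, a 1}"
    using i by (simp add: a_def n_def)
  have an: "a n = a 0"
    by (simp add: a_def)
  \<comment> \<open>Length at least 3 enters here: a second occurrence of \<open>e\<close> could
    only be its reversal, at \<open>k = 1\<close>, and then \<open>a 2 = a 0\<close>.\<close>
  have ne: "{a k, a (Suc k)} \<noteq> e" if k: "0 < k" "k < n" for k
  proof
    assume eq: "{a k, a (Suc k)} = e"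
    have "a k \<noteq> a 0"
      using a_eq_iff[of k 0] k by simp
    then have *: "a k = a 1" "a (Suc k) = a 0"
      using eq e by (auto simp: doubleton_eq_iff)
    then have "k = 1"
      using a_eq_iff[of k 1] k n by simp
    then show False
      using * a_eq_iff[of 2 0] n by (simp add: numeral_2_eq_2)
  qed
  have "(a 1, a (Suc k)) \<in> (edge_rel B)\<^sup>*" if "Suc k \<le> n" for k
    using that
  proof (induction k)
    case (Suc k)
    have "{a (Suc k), a (Suc (Suc k))} \<in> B"
      using step[of "Suc k"] ne[of "Suc k"] Suc.prems by auto
    then show ?case
      using Suc by (auto intro: rtrancl_into_rtrancl)
  qed simp
  from this[of "n - 1"] have "(a 1, a 0) \<in> (edge_rel B)\<^sup>*"
    using n an by simp
  then show ?thesis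
    using i by (simp add: a_def n_def)
qed

text \<open>Translates cycles, given as vertex lists, into connectivity by \<open>edge_rel\<close>.
  Later arguments about forests use this equivalence instead of lists.\<close>

lemma acyclic_edges_insert_iff:
  assumes "acyclic_edges B" "{u, v} \<notin> B" "u \<noteq> v"
  shows "acyclic_edges (insert {u, v} B) \<longleftrightarrow> (u, v) \<notin> (edge_rel B)\<^sup>*"
proof
  assume ac: "acyclic_edges (insert {u, v} B)"
  show "(u, v) \<notin> (edge_rel B)\<^sup>*"
  proof
    assume "(u, v) \<in> (edge_rel B)\<^sup>*"
    then obtain p where p: "p \<noteq> []" "distinct p" "hd p = u" "last p = v"
        "successively (\<lambda>x y. {x, y} \<in> B) p"
      using simple_path_exists[of u v B] by auto
    \<comment> \<open>A path with one vertex would give \<open>u = v\<close>, one with two vertices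
      would put \<open>{u, v}\<close> into \<open>B\<close>.\<close>
    have "3 \<le> length p"
    proof (rule ccontr)
      assume "\<not> 3 \<le> length p"
      moreover have "length p \<noteq> 0"
        using p(1) by simp
      ultimately have "length p = Suc 0 \<or> length p = Suc (Suc 0)"
        by linarith
      then show False
        using p assms(2,3) by (auto simp: length_Suc_conv)
    qed
    then have "is_cycle (insert {u, v} B) p"
      using p by (intro is_cycle_if_path) (auto simp: insert_commute elim: successively_mono)
    then show False
      using ac by (auto simp: acyclic_edges_def)
  qed
next
  assume nc: "(u, v) \<notin> (edge_rel B)\<^sup>*"
  show "acyclic_edges (insert {u, v} B)"
    unfolding acyclic_edges_def
  proof
    assume "\<exists>c. is_cycle (insert {u, v} B) c"
    then obtain c where c: "is_cycle (insert {u, v} B) c" by auto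
    have "\<not> is_cycle B c"
      using assms(1) by (auto simp: acyclic_edges_def)
    then obtain i where i: "i < length c" "{c ! i, c ! (Suc i mod length c)} = {u, v}"
      using c by (auto simp: is_cycle_def)
    have "(c ! (Suc i mod length c), c ! i) \<in> (edge_rel B)\<^sup>*"
      using cycle_path_avoiding_edge[OF c i] .
    then show False
      using i(2) nc edge_rel_rtrancl_sym[of _ _ B] by (auto simp: doubleton_eq_iff)
  qed
qed

lemma acyclic_edges_insert_pendant:
  assumes "acyclic_edges B" "u \<notin> \<Union>B" "u \<noteq> v"
  shows "acyclic_edges (insert {u, v} B)"
proof -
  have "y = u" if "(u, y) \<in> (edge_rel B)\<^sup>*" for y
    using that by (rule edge_rel_rtrancl_invariant) (use assms(2) in auto)
  then have "(u, v) \<notin> (edge_rel B)\<^sup>*"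
    using assms(3) by auto
  then show ?thesis
    using acyclic_edges_insert_iff[of B u v] assms by auto
qed

lemma card_2_doubleton:
  assumes "card e = 2" "u \<in> e"
  obtains v where "e = {u, v}" "u \<noteq> v"
  using assms unfolding card_2_iff by blast

lemma acyclic_edges_singleton: "card e = 2 \<Longrightarrow> acyclic_edges {e}"
proof -
  assume "card e = 2"
  then obtain u v where "e = {u, v}" "u \<noteq> v"
    unfolding card_2_iff by blast
  then show "acyclic_edges {e}"
    using acyclic_edges_insert_pendant[OF acyclic_edges_empty, of u v] by simp
qed

text \<open>Gluing forests at no more than one vertex creates no cycle. This is what turns a cut
  vertex, or a disconnection, into a direct sum of graphic matroids.\<close>

lemma acyclic_edges_Un:
  assumes "finite K" "acyclic_edges J" "acyclic_edges K" "\<And>e. e \<in> K \<Longrightarrow> card e = 2"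
    and "J \<inter> K = {}" "\<Union>J \<inter> \<Union>K \<subseteq> {x}"
  shows "acyclic_edges (J \<union> K)"
  using assms
proof (induction K rule: finite_induct)
  case (insert e K)
  have ac: "acyclic_edges K" "acyclic_edges (J \<union> K)"
    using insert acyclic_edges_subset[of "insert e K" K] by auto
  obtain u v where e: "e = {u, v}" "u \<noteq> v"
    using insert.prems(3)[of e] by (auto simp: card_2_iff)
  have uv: "(u, v) \<notin> (edge_rel K)\<^sup>*"
    using acyclic_edges_insert_iff[of K u v] ac insert e by auto
  \<comment> \<open>Contracting the vertices of \<open>J\<close> to \<open>x\<close> maps walks in \<open>J \<union> K\<close> to walks in \<open>K\<close>.\<close>
  define c where "c y = (if y \<in> \<Union>J then x else y)" for y
  have c_fix: "c y = y" if "y \<in> \<Union>(insert e K)" for y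
    using that insert.prems(5) unfolding c_def by auto
  have "(c a, c b) \<in> (edge_rel K)\<^sup>*" if "(a, b) \<in> (edge_rel (J \<union> K))\<^sup>*" for a b
    using that
  proof induction
    case (step b d)
    then consider "{b, d} \<in> J" | "{b, d} \<in> K" by auto
    then show ?case
    proof cases
      case 1
      then have "c b = c d" by (auto simp: c_def)
      then show ?thesis using step by simp
    next
      case 2
      then have "c b = b" "c d = d" by (auto intro!: c_fix)
      then show ?thesis
        using step.IH 2 by (auto intro: rtrancl_into_rtrancl)
    qed
  qed simp
  moreover have "c u = u" "c v = v"
    using e by (auto intro!: c_fix)
  ultimately have "(u, v) \<notin> (edge_rel (J \<union> K))\<^sup>*"
    using uv by metis
  then show ?case
    using acyclic_edges_insert_iff[of "J \<union> K" u v] ac insert.prems(4) insert.hyps e by auto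
qed simp


section \<open>The graphic matroid\<close>

lemma matroid_rank_attained:
  assumes "finite A" "indep {}"
  obtains B where "B \<subseteq> A" "indep B" "card B = matroid_rank indep A"
proof -
  have "matroid_rank indep A \<in> card ` {B. B \<subseteq> A \<and> indep B}"
    unfolding matroid_rank_def using assms by (intro Max_in) auto
  then show ?thesis
    using that by auto
qed

lemma card_le_matroid_rank:
  assumes "finite A" "B \<subseteq> A" "indep B"
  shows "card B \<le> matroid_rank indep A"
  unfolding matroid_rank_def using assms by (intro Max_ge) auto

lemma matroid_rank_le:
  assumes "finite A" "indep {}" "\<And>B. B \<subseteq> A \<Longrightarrow> indep B \<Longrightarrow> card B \<le> n"
  shows "matroid_rank indep A \<le> n"
  by (metis matroid_rank_attained assms)

lemma matroid_rank_le_card: "finite A \<Longrightarrow> indep {} \<Longrightarrow> matroid_rank indep A \<le> card A"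
  by (rule matroid_rank_le) (auto intro: card_mono)

lemma card_eq_matroid_rank_plus_nullity:
  "finite A \<Longrightarrow> indep {} \<Longrightarrow> card A = matroid_rank indep A + nullity indep A"
  by (simp add: nullity_def matroid_rank_le_card)

lemma matroid_rank_direct_sum:
  assumes "finite A" "indep {}" "direct_sum_decomposition indep A B C"
  shows "matroid_rank indep A = matroid_rank indep B + matroid_rank indep C"
proof (rule antisym)
  have BC: "B \<union> C = A" "B \<inter> C = {}"
    and I: "{I. I \<subseteq> A \<and> indep I} = {J \<union> K |J K. J \<subseteq> B \<and> indep J \<and> K \<subseteq> C \<and> indep K}"
    using assms by (auto simp: direct_sum_decomposition_def)
  have fin: "finite B" "finite C"
    using BC assms(1) by auto
  show "matroid_rank indep A \<le> matroid_rank indep B + matroid_rank indep C"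
  proof (rule matroid_rank_le)
    fix D assume "D \<subseteq> A" "indep D"
    then have "D \<in> {J \<union> K |J K. J \<subseteq> B \<and> indep J \<and> K \<subseteq> C \<and> indep K}"
      using I by blast
    then obtain J K where JK: "D = J \<union> K" "J \<subseteq> B" "indep J" "K \<subseteq> C" "indep K"
      by auto
    then have "card D \<le> card J + card K"
      by (simp add: card_Un_le)
    also have "\<dots> \<le> matroid_rank indep B + matroid_rank indep C"
      using JK fin by (intro add_mono card_le_matroid_rank) auto
    finally show "card D \<le> matroid_rank indep B + matroid_rank indep C" .
  qed (use assms in auto)
  obtain J where J: "J \<subseteq> B" "indep J" "card J = matroid_rank indep B"
    using matroid_rank_attained fin assms(2) by metis
  obtain K where K: "K \<subseteq> C" "indep K" "card K = matroid_rank indep C"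
    using matroid_rank_attained fin assms(2) by metis
  have "J \<union> K \<in> {I. I \<subseteq> A \<and> indep I}"
    unfolding I using J K by blast
  then have "card (J \<union> K) \<le> matroid_rank indep A"
    using assms(1) by (intro card_le_matroid_rank) auto
  moreover have "card (J \<union> K) = card J + card K"
    using J K BC fin by (intro card_Un_disjoint) (auto intro: finite_subset)
  ultimately show "matroid_rank indep B + matroid_rank indep C \<le> matroid_rank indep A"
    using J K by simp
qed

text \<open>A maximum forest spans, because an edge of \<open>A\<close> between two of its
  components could be added to it.\<close>

lemma spanning_forest_exists:
  assumes "finite A" "\<And>e. e \<in> A \<Longrightarrow> card e = 2"
  obtains B where "B \<subseteq> A" "acyclic_edges B" "card B = matroid_rank acyclic_edges A"
    "\<And>u v. (u, v) \<in> (edge_rel A)\<^sup>* \<Longrightarrow> (u, v) \<in> (edge_rel B)\<^sup>*"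
proof -
  obtain B where B: "B \<subseteq> A" "acyclic_edges B" "card B = matroid_rank acyclic_edges A"
    using matroid_rank_attained[of A acyclic_edges, OF assms(1) acyclic_edges_empty] by metis
  have edge: "(u, v) \<in> (edge_rel B)\<^sup>*" if "{u, v} \<in> A" for u v
  proof (rule ccontr)
    assume nc: "(u, v) \<notin> (edge_rel B)\<^sup>*"
    then have "{u, v} \<notin> B" by auto
    moreover have "u \<noteq> v"
      using assms(2)[OF that] by auto
    ultimately have "acyclic_edges (insert {u, v} B)"
      using B(2) nc acyclic_edges_insert_iff by metis
    then have "card (insert {u, v} B) \<le> card B"
      using B that assms(1) by (metis card_le_matroid_rank insert_subset)
    moreover have "finite B"
      using B assms(1) finite_subset by auto
    ultimately show False
      using \<open>{u, v} \<notin> B\<close> by simp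
  qed
  have "(u, v) \<in> (edge_rel B)\<^sup>*" if "(u, v) \<in> (edge_rel A)\<^sup>*" for u v
    using that by (induction) (use edge in \<open>auto intro: rtrancl_trans\<close>)
  then show ?thesis
    using that B by auto
qed

text \<open>Exchange argument: if a forest uses \<open>{u, v}\<close>, remove this edge. The walk
  from \<open>u\<close> to \<open>v\<close> in \<open>F\<close> must leave the component of
  \<open>u\<close> along some edge \<open>{a, b}\<close> of \<open>F\<close>, which replaces
  \<open>{u, v}\<close> in the forest.\<close>

lemma graphic_rank_insert:
  assumes "finite F" "\<And>e. e \<in> F \<Longrightarrow> card e = 2" "(u, v) \<in> (edge_rel F)\<^sup>*" "u \<noteq> v"
  shows "matroid_rank acyclic_edges (insert {u, v} F) \<le> matroid_rank acyclic_edges F"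
proof (rule matroid_rank_le)
  fix D assume D: "D \<subseteq> insert {u, v} F" "acyclic_edges D"
  show "card D \<le> matroid_rank acyclic_edges F"
  proof (cases "{u, v} \<in> D - F")
    case False
    then show ?thesis
      using D assms(1) by (intro card_le_matroid_rank) auto
  next
    case True
    define D' where "D' = D - {{u, v}}"
    have D': "D = insert {u, v} D'" "{u, v} \<notin> D'" "D' \<subseteq> F" "acyclic_edges D'" "finite D'"
      using D True assms(1) acyclic_edges_subset[of D D'] finite_subset[of D' F]
      by (auto simp: D'_def)
    have "(u, v) \<notin> (edge_rel D')\<^sup>*"
      using acyclic_edges_insert_iff[of D' u v] D' D assms(4) by auto
    then obtain a b where ab: "{a, b} \<in> F" "(u, a) \<in> (edge_rel D')\<^sup>*" "(u, b) \<notin> (edge_rel D')\<^sup>*"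
      using edge_rel_rtrancl_invariant[of u v F "\<lambda>y. (u, y) \<in> (edge_rel D')\<^sup>*"] assms(3) by auto
    then have nc: "(a, b) \<notin> (edge_rel D')\<^sup>*"
      by (meson rtrancl_trans)
    have "a \<noteq> b"
      using assms(2)[OF ab(1)] by auto
    moreover have "{a, b} \<notin> D'"
      using nc by auto
    ultimately have "acyclic_edges (insert {a, b} D')"
      using acyclic_edges_insert_iff[of D' a b] D' nc by auto
    then have "card (insert {a, b} D') \<le> matroid_rank acyclic_edges F"
      using ab(1) D' assms(1) by (intro card_le_matroid_rank) auto
    then show ?thesis
      using D' \<open>{a, b} \<notin> D'\<close> by simp
  qed
qed (use assms acyclic_edges_empty in auto)

section \<open>Direct sums, cut vertices and 2-connected induced subgraphs\<close>

lemma direct_sum_decomposition_if_overlap: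
  assumes "finite A" "\<And>e. e \<in> A \<Longrightarrow> card e = 2"
    and "B \<union> C = A" "B \<inter> C = {}" "\<Union>B \<inter> \<Union>C \<subseteq> {x}"
  shows "direct_sum_decomposition acyclic_edges A B C"
proof -
  have "{I. I \<subseteq> A \<and> acyclic_edges I}
      = {J \<union> K |J K. J \<subseteq> B \<and> acyclic_edges J \<and> K \<subseteq> C \<and> acyclic_edges K}" (is "?L = ?R")
  proof (intro subset_antisym subsetI)
    fix I assume "I \<in> ?L"
    then have I: "I \<subseteq> A" "acyclic_edges I" by auto
    have "I = (I \<inter> B) \<union> (I \<inter> C)"
      using I assms(3) by auto
    moreover have "acyclic_edges (I \<inter> B)" "acyclic_edges (I \<inter> C)"
      using I acyclic_edges_subset[of I "I \<inter> B"] acyclic_edges_subset[of I "I \<inter> C"] by auto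
    ultimately show "I \<in> ?R"
      by blast
  next
    fix I assume "I \<in> ?R"
    then obtain J K where JK: "I = J \<union> K" "J \<subseteq> B" "acyclic_edges J" "K \<subseteq> C" "acyclic_edges K"
      by auto
    have "acyclic_edges (J \<union> K)"
    proof (rule acyclic_edges_Un)
      show "\<Union>J \<inter> \<Union>K \<subseteq> {x}"
        using JK assms(5) by blast
      show "J \<inter> K = {}"
        using JK assms(4) by blast
      show "finite K"
        using JK assms(1,3) by (metis finite_Un finite_subset)
      show "card e = 2" if "e \<in> K" for e
        using that JK assms(2,3) by auto
    qed (use JK in auto)
    then show "I \<in> ?L"
      using JK assms(3) by auto
  qed
  then show ?thesis
    using assms by (simp add: direct_sum_decomposition_def)
qed

text \<open>\<open>S\<close> is a union of components left after deleting \<open>T\<close>. The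
  edges inside \<open>S \<union> T\<close> and the other edges share at most the vertex
  \<open>x\<close>, so a vertex \<open>v\<close> outside would yield a decomposition.
  \<open>T = {}\<close> gives connectedness, \<open>T = {x}\<close> the absence of a cut
  vertex.\<close>

lemma indecomposable_no_separation:
  assumes "finite F" "\<And>e. e \<in> F \<Longrightarrow> card e = 2" "indecomposable acyclic_edges F"
    and "T \<subseteq> {x}" "S \<inter> T = {}" "\<And>e. e \<in> F \<Longrightarrow> e \<inter> S \<noteq> {} \<Longrightarrow> e \<subseteq> S \<union> T"
    and "u \<in> \<Union>F \<inter> S" "v \<in> \<Union>F"
  shows "v \<in> S \<union> T"
proof (rule ccontr)
  assume v: "v \<notin> S \<union> T"
  define B where "B = {e \<in> F. e \<subseteq> S \<union> T}"
  have "\<Union>B \<inter> \<Union>(F - B) \<subseteq> {x}"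
    using assms(4-6) unfolding B_def by blast
  then have "direct_sum_decomposition acyclic_edges F B (F - B)"
    using assms(1,2) by (intro direct_sum_decomposition_if_overlap) (auto simp: B_def)
  moreover have "B \<noteq> {}"
    using assms(6,7) unfolding B_def by blast
  moreover have "F - B \<noteq> {}"
    using assms(8) v unfolding B_def by blast
  moreover have "B = {} \<or> C = {} \<or> \<not> direct_sum_decomposition acyclic_edges F B C" for B C
    using assms(3) by (metis indecomposable_def)
  ultimately show False
    by iprover
qed

text \<open>Indecomposability gives connectedness and excludes cut vertices. Flatness then makes
  \<open>F\<close> induced: a further edge between vertices of \<open>F\<close> joins vertices that
  are already connected, so it would not raise the rank.\<close>

lemma indecomposable_flat_two_connected:
  assumes E: "finite_simple_graph V E" and F: "F \<noteq> {}" "flat acyclic_edges E F"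
      "indecomposable acyclic_edges F"
  shows "F = induced_edges E (\<Union>F)" "two_connected_graph (\<Union>F) (induced_edges E (\<Union>F))" "\<Union>F \<subseteq> V"
proof -
  have FE: "F \<subseteq> E"
    using F by (auto simp: flat_def)
  have cardE: "card e = 2" "e \<subseteq> V" if "e \<in> E" for e
    using that E by (auto simp: finite_simple_graph_def)
  have "E \<subseteq> Pow V" "finite V"
    using E by (auto simp: finite_simple_graph_def)
  then have finE: "finite E"
    using finite_subset by auto
  have finF: "finite F" and cardF: "\<And>e. e \<in> F \<Longrightarrow> card e = 2"
    using FE finE finite_subset cardE by auto
  show "\<Union>F \<subseteq> V"
    using FE cardE by auto
  have conn: "(u, v) \<in> (edge_rel F)\<^sup>*" if "u \<in> \<Union>F" "v \<in> \<Union>F" for u v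
  proof -
    have "v \<in> {y. (u, y) \<in> (edge_rel F)\<^sup>*} \<union> {}"
    proof (rule indecomposable_no_separation[OF finF cardF F(3)])
      fix e assume e: "e \<in> F" "e \<inter> {y. (u, y) \<in> (edge_rel F)\<^sup>*} \<noteq> {}"
      then obtain y where y: "y \<in> e" "(u, y) \<in> (edge_rel F)\<^sup>*" by auto
      obtain z where "e = {y, z}"
        using card_2_doubleton[of e y] cardF[OF e(1)] y(1) by metis
      then show "e \<subseteq> {y. (u, y) \<in> (edge_rel F)\<^sup>*} \<union> {}"
        using y e(1) by (auto intro: rtrancl_into_rtrancl)
    qed (use that in auto)
    then show ?thesis by simp
  qed
  show ind: "F = induced_edges E (\<Union>F)"
  proof
    show "F \<subseteq> induced_edges E (\<Union>F)"
      using FE by (auto simp: induced_edges_def)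
    show "induced_edges E (\<Union>F) \<subseteq> F"
    proof
      fix e assume e: "e \<in> induced_edges E (\<Union>F)"
      then obtain u v where uv: "e = {u, v}" "u \<noteq> v"
        using cardE(1)[of e] unfolding card_2_iff induced_edges_def by blast
      have "matroid_rank acyclic_edges (insert e F) \<le> matroid_rank acyclic_edges F"
        using graphic_rank_insert[OF finF cardF conn[of u v] uv(2)] uv e
        by (auto simp: induced_edges_def)
      then show "e \<in> F"
        using F(2) e by (force simp: flat_def induced_edges_def)
    qed
  qed
  have "connected_graph (\<Union>F) F"
  proof -
    obtain e where "e \<in> F"
      using F(1) by auto
    moreover then have "e \<noteq> {}"
      using cardF[of e] by auto
    ultimately show ?thesis
      using conn unfolding connected_graph_def by auto
  qed
  moreover have "connected_graph (\<Union>F - {x}) (induced_edges E (\<Union>F - {x}))"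
    if x: "x \<in> \<Union>F" "\<Union>F \<noteq> {x}" for x
    unfolding connected_graph_def
  proof (intro conjI ballI)
    show "\<Union>F - {x} \<noteq> {}"
      using x by auto
    fix u v assume uv: "u \<in> \<Union>F - {x}" "v \<in> \<Union>F - {x}"
    define R where "R = (edge_rel (induced_edges E (\<Union>F - {x})))\<^sup>*"
    define S where "S = {y. (u, y) \<in> R}"
    have "y \<noteq> x" if "(u, y) \<in> R" for y
      using that unfolding R_def
      by (rule edge_rel_rtrancl_invariant) (use uv in \<open>auto simp: induced_edges_def\<close>)
    then have xS: "x \<notin> S"
      by (auto simp: S_def)
    have "v \<in> S \<union> {x}"
    proof (rule indecomposable_no_separation[OF finF cardF F(3)])
      fix e assume e: "e \<in> F" "e \<inter> S \<noteq> {}"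
      then obtain y where y: "y \<in> e" "(u, y) \<in> R" by (auto simp: S_def)
      obtain z where z: "e = {y, z}"
        using card_2_doubleton[of e y] cardF[OF e(1)] y(1) by metis
      have "z \<in> S" if "z \<noteq> x"
      proof -
        have "{y, z} \<in> induced_edges E (\<Union>F - {x})"
          using z e y xS FE that by (auto simp: induced_edges_def S_def)
        then show ?thesis
          using y by (auto simp: S_def R_def intro: rtrancl_into_rtrancl)
      qed
      then show "e \<subseteq> S \<union> {x}"
        using z y by (auto simp: S_def)
    qed (use xS uv in \<open>auto simp: S_def R_def\<close>)
    then show "(u, v) \<in> (edge_rel (induced_edges E (\<Union>F - {x})))\<^sup>*"
      using uv by (auto simp: S_def R_def)
  qed
  ultimately show "two_connected_graph (\<Union>F) (induced_edges E (\<Union>F))"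
    unfolding two_connected_graph_def
    using ind by (smt (verit, ccfv_SIG) Diff_subset induced_edges_def mem_Collect_eq subset_trans
        Collect_cong)
qed

text \<open>Flatness: an edge outside has an end outside \<open>W\<close>, so it extends a maximum
  forest as a pendant edge. Indecomposability: a decomposition into \<open>B\<close> and
  \<open>C\<close> is contradicted by a cycle through edges of both, whose two parts are independent
  although their union is not.\<close>

lemma two_connected_indecomposable_flat:
  assumes E: "finite_simple_graph V E" and W: "two_connected_graph W (induced_edges E W)"
      "W \<subseteq> V"
  shows "flat acyclic_edges E (induced_edges E W)"
    "indecomposable acyclic_edges (induced_edges E W)"
proof -
  have cardE: "card e = 2" "e \<subseteq> V" if "e \<in> E" for e
    using that E by (auto simp: finite_simple_graph_def)
  have "E \<subseteq> Pow V" "finite V"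
    using E by (auto simp: finite_simple_graph_def)
  then have finE: "finite E"
    using finite_subset by auto
  define F where "F = induced_edges E W"
  have FE: "F \<subseteq> E" and FW: "\<Union>F \<subseteq> W"
    by (auto simp: F_def induced_edges_def)
  have finF: "finite F" and cardF: "\<And>e. e \<in> F \<Longrightarrow> card e = 2"
    using FE finE finite_subset cardE by auto
  have "matroid_rank acyclic_edges F < matroid_rank acyclic_edges (insert e F)" if e: "e \<in> E - F" for e
  proof -
    obtain u where u: "u \<in> e" "u \<notin> W"
      using e by (auto simp: F_def induced_edges_def)
    obtain v where v: "e = {u, v}" "u \<noteq> v"
      using card_2_doubleton[of e u] cardE[of e] e u by auto
    obtain B where B: "B \<subseteq> F" "acyclic_edges B" "card B = matroid_rank acyclic_edges F"
      using matroid_rank_attained[of F acyclic_edges, OF finF acyclic_edges_empty] by metis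
    have "acyclic_edges (insert e B)"
      unfolding v(1) using B u FW v(2) by (intro acyclic_edges_insert_pendant) auto
    then have "card (insert e B) \<le> matroid_rank acyclic_edges (insert e F)"
      using B finF by (intro card_le_matroid_rank) auto
    moreover have "e \<notin> B" "finite B"
      using B e finF finite_subset by auto
    ultimately show ?thesis
      using B by simp
  qed
  then show "flat acyclic_edges E (induced_edges E W)"
    using FE unfolding F_def flat_def by auto
  show "indecomposable acyclic_edges (induced_edges E W)"
    unfolding indecomposable_def
  proof
    assume "\<exists>B C. B \<noteq> {} \<and> C \<noteq> {} \<and> direct_sum_decomposition acyclic_edges (induced_edges E W) B C"
    then obtain B C where ne: "B \<noteq> {}" "C \<noteq> {}" and BC: "B \<union> C = F" "B \<inter> C = {}"
      and I: "{I. I \<subseteq> F \<and> acyclic_edges I}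
          = {J \<union> K |J K. J \<subseteq> B \<and> acyclic_edges J \<and> K \<subseteq> C \<and> acyclic_edges K}"
      unfolding direct_sum_decomposition_def F_def by auto
    obtain b c where bc: "b \<in> \<Union>B" "c \<in> \<Union>C"
      using ne BC cardF by (metis Sup_bot_conv(1) Un_iff card.empty ex_in_conv zero_neq_numeral)
    then have "(b, c) \<in> (edge_rel F)\<^sup>*"
      using W FW BC unfolding two_connected_graph_def connected_graph_def F_def by blast
    \<comment> \<open>If no vertex were shared, the vertices of \<open>B\<close> would be closed
      under walking along \<open>F\<close>, and \<open>c\<close> would be among them.\<close>
    then have "c \<in> \<Union>B" if "\<Union>B \<inter> \<Union>C = {}"
      by (rule edge_rel_rtrancl_invariant) (use bc BC that in blast)+
    then obtain x where x: "x \<in> \<Union>B" "x \<in> \<Union>C"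
      using bc by auto
    obtain u where u: "{x, u} \<in> B" "x \<noteq> u"
      using x(1) cardF BC by (metis UnCI Union_iff card_2_doubleton)
    obtain w where w: "{x, w} \<in> C" "x \<noteq> w"
      using x(2) cardF BC by (metis UnCI Union_iff card_2_doubleton)
    define F' where "F' = induced_edges E (W - {x})"
    have uw: "u \<in> W - {x}" "w \<in> W - {x}" "x \<in> W"
      using u w FW BC by auto
    then have F'eq: "induced_edges F (W - {x}) = F'"
      by (auto simp: F'_def F_def induced_edges_def)
    have "connected_graph (W - {x}) F'"
      using W(1) uw F'eq unfolding two_connected_graph_def F_def by auto
    then have "(u, w) \<in> (edge_rel F')\<^sup>*"
      using uw unfolding connected_graph_def by blast
    moreover have F'F: "F' \<subseteq> F" and xF': "x \<notin> \<Union>F'"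
      by (auto simp: F'_def F_def induced_edges_def)
    moreover have finF': "finite F'" and cardF': "\<And>e. e \<in> F' \<Longrightarrow> card e = 2"
      using F'F finF cardF finite_subset by auto
    obtain T where T: "T \<subseteq> F'" "acyclic_edges T" "card T = matroid_rank acyclic_edges F'"
        "\<And>u v. (u, v) \<in> (edge_rel F')\<^sup>* \<Longrightarrow> (u, v) \<in> (edge_rel T)\<^sup>*"
      using spanning_forest_exists[of F', OF finF' cardF'] by blast
    ultimately have uwT: "(u, w) \<in> (edge_rel T)\<^sup>*" by auto
    have xT: "x \<notin> \<Union>T"
      using T(1) xF' by auto
    have ac: "acyclic_edges (insert {x, u} T)" "acyclic_edges (insert {x, w} T)"
      using acyclic_edges_insert_pendant[OF T(2) xT] u w by auto
    \<comment> \<open>\<open>J\<close> and \<open>K\<close> are forests because \<open>x\<close>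
      meets no edge of \<open>T\<close>. Their union contains \<open>{x, u}\<close>,
      \<open>{x, w}\<close> and the path from \<open>u\<close> to \<open>w\<close> in
      \<open>T\<close>, hence a cycle.\<close>
    define J where "J = insert {x, u} (T \<inter> B)"
    define K where "K = insert {x, w} (T \<inter> C)"
    have "acyclic_edges J" "acyclic_edges K"
      using ac acyclic_edges_subset[of "insert {x, u} T" J]
        acyclic_edges_subset[of "insert {x, w} T" K] by (auto simp: J_def K_def)
    then have "J \<union> K \<in> {I. I \<subseteq> F \<and> acyclic_edges I}"
      unfolding I using u w unfolding J_def K_def by blast
    moreover have "J \<union> K = insert {x, w} (insert {x, u} T)"
      using T(1) F'F BC by (auto simp: J_def K_def)
    ultimately have "acyclic_edges (insert {x, w} (insert {x, u} T))"
      by auto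
    moreover have "{x, w} \<notin> insert {x, u} T"
      using u w BC xT by (auto simp: doubleton_eq_iff)
    ultimately have "(x, w) \<notin> (edge_rel (insert {x, u} T))\<^sup>*"
      using acyclic_edges_insert_iff[OF ac(1)] w(2) by auto
    moreover have "(x, u) \<in> (edge_rel (insert {x, u} T))\<^sup>*"
      by auto
    moreover have "(u, w) \<in> (edge_rel (insert {x, u} T))\<^sup>*"
      by (rule edge_rel_rtrancl_mono[OF uwT]) auto
    ultimately show False
      by (meson rtrancl_trans)
  qed
qed

lemma indecomposable_flats_eq_two_connected:
  assumes "finite_simple_graph V E"
  shows "{A. A \<noteq> {} \<and> flat acyclic_edges E A \<and> indecomposable acyclic_edges A} =
      {induced_edges E W |W. W \<subseteq> V \<and> two_connected_graph W (induced_edges E W)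
        \<and> induced_edges E W \<noteq> {}}"
proof (intro subset_antisym subsetI)
  fix A assume A: "A \<in> {A. A \<noteq> {} \<and> flat acyclic_edges E A \<and> indecomposable acyclic_edges A}"
  then have "A = induced_edges E (\<Union>A)" "two_connected_graph (\<Union>A) (induced_edges E (\<Union>A))" "\<Union>A \<subseteq> V"
    using indecomposable_flat_two_connected[OF assms, of A] by auto
  moreover have "A \<noteq> {}"
    using A by auto
  ultimately show "A \<in> {induced_edges E W |W. W \<subseteq> V \<and> two_connected_graph W (induced_edges E W)
        \<and> induced_edges E W \<noteq> {}}"
    by (metis (mono_tags, lifting) mem_Collect_eq)
qed (use two_connected_indecomposable_flat[OF assms] in auto)

text \<open>Maximal size makes \<open>F\<close> flat: an edge that leaves the rank unchanged raises
  both the size and the nullity by one, which preserves the inequality because d is at least 1.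
  Minimal rank makes \<open>F\<close> indecomposable: size and nullity are additive over direct
  sums, so one summand satisfies the inequality, and its rank is smaller since the other summand has
  positive rank.\<close>

lemma overconstrained_indecomposable_flat:
  assumes E: "finite E" "\<And>e. e \<in> E \<Longrightarrow> card e = 2"
    and A: "A \<subseteq> E" "A \<noteq> {}" "card A \<le> d * nullity acyclic_edges A"
  obtains F where "F \<noteq> {}" "flat acyclic_edges E F" "indecomposable acyclic_edges F"
    "card F \<le> d * nullity acyclic_edges F"
proof -
  let ?r = "matroid_rank acyclic_edges"
  let ?n = "nullity acyclic_edges"
  define bad where "bad A \<longleftrightarrow> A \<subseteq> E \<and> A \<noteq> {} \<and> card A \<le> d * ?n A" for A
  have fin: "finite A" if "A \<subseteq> E" for A
    using that E(1) finite_subset by auto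
  have rn: "card A = ?r A + ?n A" if "A \<subseteq> E" for A
    using card_eq_matroid_rank_plus_nullity[of _ acyclic_edges, OF fin[OF that] acyclic_edges_empty] .
  obtain A1 where A1: "bad A1" "\<And>B. bad B \<Longrightarrow> ?r A1 \<le> ?r B"
    using ex_has_least_nat[of bad A ?r] A unfolding bad_def by blast
  define bad' where "bad' B \<longleftrightarrow> bad B \<and> ?r B = ?r A1" for B
  have "\<exists>F. bad' F \<and> (\<forall>B. bad' B \<longrightarrow> card B \<le> card F)"
  proof (rule ex_has_greatest_nat)
    show "bad' A1"
      using A1 by (simp add: bad'_def)
    show "\<forall>B. bad' B \<longrightarrow> card B < Suc (card E)"
      using card_mono[OF E(1)] by (simp add: bad'_def bad_def less_Suc_eq_le)
  qed
  then obtain F where F: "bad' F" "\<And>B. bad' B \<Longrightarrow> card B \<le> card F"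
    by auto
  have FE: "F \<subseteq> E" "F \<noteq> {}" "card F \<le> d * ?n F"
    using F by (auto simp: bad'_def bad_def)
  have d: "d \<ge> 1"
  proof (rule ccontr)
    assume "\<not> d \<ge> 1"
    then have "d = 0" by simp
    then show False
      using FE fin[OF FE(1)] by simp
  qed
  have "?r F < ?r (insert e F)" if e: "e \<in> E - F" for e
  proof (rule ccontr)
    assume "\<not> ?r F < ?r (insert e F)"
    obtain B where B: "B \<subseteq> F" "acyclic_edges B" "card B = ?r F"
      by (rule matroid_rank_attained[of F acyclic_edges, OF fin[OF FE(1)] acyclic_edges_empty])
    have "card B \<le> ?r (insert e F)"
      using B fin[OF FE(1)] by (intro card_le_matroid_rank) auto
    then have r: "?r (insert e F) = ?r F"
      using B(3) \<open>\<not> ?r F < ?r (insert e F)\<close> by linarith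
    have c: "card (insert e F) = Suc (card F)"
      using e fin[OF FE(1)] by simp
    have eE: "insert e F \<subseteq> E"
      using e FE by simp
    have "?n (insert e F) = Suc (?n F)"
      using rn[OF FE(1)] rn[OF eE] r c by linarith
    then have "card (insert e F) \<le> d * ?n (insert e F)"
      using c d FE(3) by simp
    then have "bad' (insert e F)"
      using F(1) r eE by (simp add: bad'_def bad_def)
    then show False
      using F(2)[of "insert e F"] c by simp
  qed
  then have "flat acyclic_edges E F"
    using FE by (auto simp: flat_def)
  moreover have "indecomposable acyclic_edges F"
    unfolding indecomposable_def
  proof
    assume "\<exists>B C. B \<noteq> {} \<and> C \<noteq> {} \<and> direct_sum_decomposition acyclic_edges F B C"
    then obtain B C where ne: "B \<noteq> {}" "C \<noteq> {}" and
      dsd: "direct_sum_decomposition acyclic_edges F B C" by auto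
    then have BC: "B \<union> C = F" "B \<inter> C = {}"
      by (auto simp: direct_sum_decomposition_def)
    have r: "?r F = ?r B + ?r C"
      using matroid_rank_direct_sum[of F acyclic_edges, OF fin[OF FE(1)] acyclic_edges_empty dsd] .
    have sub: "B \<subseteq> E" "C \<subseteq> E"
      using BC FE by auto
    have pos: "0 < ?r D" if D: "D \<subseteq> E" "D \<noteq> {}" for D
    proof -
      obtain e where "e \<in> D" using D by auto
      then have "card {e} \<le> ?r D"
        using D E fin by (intro card_le_matroid_rank acyclic_edges_singleton) auto
      then show ?thesis by simp
    qed
    have c: "card F = card B + card C"
      using BC(2) card_Un_disjoint[OF fin[OF sub(1)] fin[OF sub(2)]] unfolding BC(1)[symmetric] by simp
    then have "?n F = ?n B + ?n C"
      using r rn[OF FE(1)] rn[OF sub(1)] rn[OF sub(2)] by linarith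
    then have "card B + card C \<le> d * ?n B + d * ?n C"
      using FE c by (simp add: distrib_left)
    then have "bad B \<or> bad C"
      using sub ne unfolding bad_def by linarith
    then have "?r A1 \<le> ?r B \<or> ?r A1 \<le> ?r C"
      using A1 by auto
    moreover have "?r F = ?r A1"
      using F by (simp add: bad'_def)
    ultimately show False
      using r pos[OF sub(1) ne(1)] pos[OF sub(2) ne(2)] by auto
  qed
  ultimately show ?thesis
    using that FE by auto
qed

section \<open>Linear systems and polynomials\<close>

text \<open>Euclid's argument: over a finite field, 1 plus the product of all \<open>X - a\<close>
  would be a nonconstant polynomial without a root.\<close>

lemma infinite_UNIV_alg_closed: "infinite (UNIV :: 'a::alg_closed_field set)"
proof
  assume fin: "finite (UNIV :: 'a set)"
  define q :: "'a poly" where "q = (\<Prod>a\<in>UNIV. [:- a, 1:])"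
  have "degree q = (\<Sum>a\<in>(UNIV :: 'a set). degree [:- a, 1:])"
    unfolding q_def by (rule degree_prod_eq_sum_degree) auto
  then have "degree (q + 1) > 0"
    using fin by (simp add: degree_add_eq_left finite_UNIV_card_ge_0)
  then obtain x where "poly (q + 1) x = 0"
    using alg_closed_imp_poly_has_root by blast
  moreover have "poly q x = 0"
    using fin by (auto simp: q_def poly_prod prod_zero_iff)
  ultimately show False
    by simp
qed

text \<open>Gaussian elimination by induction on the equations: equation \<open>k\<close> is solved
  for an unknown \<open>i0\<close> with nonzero coefficient, with value \<open>s\<close>, and
  \<open>M'\<close> is the system left after the substitution.\<close>

lemma underdetermined_system_nontrivial_solution:
  fixes M :: "'i \<Rightarrow> 'k \<Rightarrow> 'a::field"
  assumes "finite K" "finite I" "card K < card I"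
  shows "\<exists>z. (\<exists>i\<in>I. z i \<noteq> 0) \<and> (\<forall>k\<in>K. (\<Sum>i\<in>I. z i * M i k) = 0)"
  using assms
proof (induction K arbitrary: I M rule: finite_induct)
  case empty
  then have "I \<noteq> {}" by auto
  then show ?case
    by (intro exI[of _ "\<lambda>_. 1"]) auto
next
  case (insert k K)
  show ?case
  proof (cases "\<exists>i\<in>I. M i k \<noteq> 0")
    case False
    obtain z where "\<exists>i\<in>I. z i \<noteq> 0" "\<forall>k\<in>K. (\<Sum>i\<in>I. z i * M i k) = 0"
      using insert.IH[of I M] insert.prems insert.hyps by auto
    then show ?thesis
      using False by (intro exI[of _ z]) auto
  next
    case True
    then obtain i0 where i0: "i0 \<in> I" "M i0 k \<noteq> 0" by auto
    define I' where "I' = I - {i0}"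
    define M' where "M' i l = M i l - M i k / M i0 k * M i0 l" for i l
    have "card K < card I'"
      using insert i0 by (simp add: I'_def)
    then obtain z where z: "\<exists>i\<in>I'. z i \<noteq> 0" "\<forall>l\<in>K. (\<Sum>i\<in>I'. z i * M' i l) = 0"
      using insert.IH[of I' M'] insert.prems by (auto simp: I'_def)
    define s where "s = - (\<Sum>i\<in>I'. z i * M i k) / M i0 k"
    define z' where "z' = z(i0 := s)"
    have sum: "(\<Sum>i\<in>I. z' i * M i l) = s * M i0 l + (\<Sum>i\<in>I'. z i * M i l)" for l
    proof -
      have "(\<Sum>i\<in>I. z' i * M i l) = z' i0 * M i0 l + (\<Sum>i\<in>I'. z' i * M i l)"
        unfolding I'_def using insert.prems i0 by (intro sum.remove) auto
      also have "(\<Sum>i\<in>I'. z' i * M i l) = (\<Sum>i\<in>I'. z i * M i l)"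
        by (rule sum.cong) (auto simp: z'_def I'_def)
      finally show ?thesis
        by (simp add: z'_def)
    qed
    have "(\<Sum>i\<in>I'. z i * M' i l) = s * M i0 l + (\<Sum>i\<in>I'. z i * M i l)" for l
    proof -
      have "(\<Sum>i\<in>I'. z i * M' i l)
          = (\<Sum>i\<in>I'. z i * M i l - z i * M i k * (M i0 l / M i0 k))"
        by (rule sum.cong) (auto simp: M'_def algebra_simps)
      also have "\<dots> = (\<Sum>i\<in>I'. z i * M i l) - (\<Sum>i\<in>I'. z i * M i k) * (M i0 l / M i0 k)"
        by (simp add: sum_subtractf sum_distrib_right sum_divide_distrib)
      finally show ?thesis
        by (simp add: s_def)
    qed
    then have "\<forall>l\<in>insert k K. (\<Sum>i\<in>I. z' i * M i l) = 0"
      using z(2) i0 by (auto simp: sum s_def)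
    moreover have "\<exists>i\<in>I. z' i \<noteq> 0"
      using z(1) by (auto simp: z'_def I'_def)
    ultimately show ?thesis
      by blast
  qed
qed

text \<open>Induction on the variables. With the other values fixed, the sum is a polynomial in one
  variable with infinitely many roots, so its coefficients vanish, and these are sums of the same
  shape in fewer variables.\<close>

lemma coefficients_zero_if_polynomial_function_zero:
  fixes c :: "('j \<Rightarrow> nat) \<Rightarrow> 'a::field"
  assumes inf: "infinite (UNIV :: 'a set)" and "finite J"
    and "\<And>s. (\<Sum>\<kappa>\<in>J \<rightarrow>\<^sub>E {..n}. c \<kappa> * (\<Prod>j\<in>J. s j ^ \<kappa> j)) = 0" "\<kappa> \<in> J \<rightarrow>\<^sub>E {..n}"
  shows "c \<kappa> = 0"
  using assms(2-)
proof (induction J arbitrary: c \<kappa> rule: finite_induct)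
  case empty
  then show ?case by simp
next
  case (insert j J)
  have inner: "(\<Sum>\<mu>\<in>J \<rightarrow>\<^sub>E {..n}. c (\<mu>(j := k)) * (\<Prod>i\<in>J. s i ^ \<mu> i)) = 0"
    if k: "k \<le> n" for s k
  proof -
    define q where "q k = (\<Sum>\<mu>\<in>J \<rightarrow>\<^sub>E {..n}. c (\<mu>(j := k)) * (\<Prod>i\<in>J. s i ^ \<mu> i))" for k
    define p where "p = (\<Sum>k\<le>n. monom (q k) k)"
    have "poly p t = 0" for t
    proof -
      have "0 = (\<Sum>\<kappa>\<in>insert j J \<rightarrow>\<^sub>E {..n}. c \<kappa> * (\<Prod>i\<in>insert j J. (s(j := t)) i ^ \<kappa> i))"
        using insert.prems(1) by metis
      also have "\<dots> = (\<Sum>(k, \<mu>)\<in>{..n} \<times> (J \<rightarrow>\<^sub>E {..n}).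
          c (\<mu>(j := k)) * (\<Prod>i\<in>insert j J. (s(j := t)) i ^ (\<mu>(j := k)) i))"
        unfolding PiE_insert_eq
        by (subst sum.reindex[OF inj_combinator[OF insert.hyps(2)]]) (auto simp: case_prod_unfold)
      also have "\<dots> = (\<Sum>k\<le>n. \<Sum>\<mu>\<in>J \<rightarrow>\<^sub>E {..n}.
          c (\<mu>(j := k)) * (\<Prod>i\<in>insert j J. (s(j := t)) i ^ (\<mu>(j := k)) i))"
        by (simp add: sum.cartesian_product)
      also have "\<dots> = (\<Sum>k\<le>n. \<Sum>\<mu>\<in>J \<rightarrow>\<^sub>E {..n}.
          c (\<mu>(j := k)) * (\<Prod>i\<in>J. s i ^ \<mu> i) * t ^ k)"
      proof (intro sum.cong refl)
        fix k \<mu>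
        have "(\<Prod>i\<in>insert j J. (s(j := t)) i ^ (\<mu>(j := k)) i)
            = t ^ k * (\<Prod>i\<in>J. (s(j := t)) i ^ (\<mu>(j := k)) i)"
          using insert.hyps by simp
        also have "(\<Prod>i\<in>J. (s(j := t)) i ^ (\<mu>(j := k)) i) = (\<Prod>i\<in>J. s i ^ \<mu> i)"
          using insert.hyps by (intro prod.cong) auto
        finally show "c (\<mu>(j := k)) * (\<Prod>i\<in>insert j J. (s(j := t)) i ^ (\<mu>(j := k)) i)
            = c (\<mu>(j := k)) * (\<Prod>i\<in>J. s i ^ \<mu> i) * t ^ k"
          by simp
      qed
      also have "\<dots> = poly p t"
        by (simp add: p_def q_def poly_sum poly_monom sum_distrib_right)
      finally show ?thesis by simp
    qed
    then have "p = 0"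
      using poly_roots_finite[of p] inf by auto
    then have "coeff p k = 0" by simp
    then show ?thesis
      using k by (simp add: p_def q_def[symmetric] coeff_sum)
  qed
  obtain k \<mu> where \<mu>: "k \<le> n" "\<mu> \<in> J \<rightarrow>\<^sub>E {..n}" "\<kappa> = \<mu>(j := k)"
    using insert.prems(2) unfolding PiE_insert_eq by auto
  show ?case
    unfolding \<mu>(3)
    by (rule insert.IH[of "\<lambda>\<mu>. c (\<mu>(j := k))"]) (use inner \<mu> in auto)
qed

section \<open>Evaluation of multivariate polynomials\<close>

definition monomial_eval :: "('x \<Rightarrow> 'a::comm_ring_1) \<Rightarrow> ('x \<Rightarrow>\<^sub>0 nat) \<Rightarrow> 'a" where
  "monomial_eval x m = (\<Prod>c\<in>Poly_Mapping.keys m. x c ^ Poly_Mapping.lookup m c)"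

lemma monomial_eval_superset:
  assumes "finite U" "Poly_Mapping.keys m \<subseteq> U"
  shows "monomial_eval x m = (\<Prod>c\<in>U. x c ^ Poly_Mapping.lookup m c)"
  unfolding monomial_eval_def
  by (rule prod.mono_neutral_left) (use assms in \<open>auto simp: in_keys_iff\<close>)

lemma monomial_eval_add: "monomial_eval x (m + m') = monomial_eval x m * monomial_eval x m'"
proof -
  let ?U = "Poly_Mapping.keys m \<union> Poly_Mapping.keys m'"
  have "Poly_Mapping.keys (m + m') \<subseteq> ?U"
    by (rule keys_add)
  then show ?thesis
    by (simp add: monomial_eval_superset[of ?U] lookup_add power_add prod.distrib)
qed

lemma mpoly_eval_superset:
  assumes "finite S" "Poly_Mapping.keys f \<subseteq> S"
  shows "mpoly_eval x f = (\<Sum>m\<in>S. Poly_Mapping.lookup f m * monomial_eval x m)"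
  unfolding mpoly_eval_def monomial_eval_def[symmetric]
  by (rule sum.mono_neutral_left) (use assms in \<open>auto simp: in_keys_iff\<close>)

lemma mpoly_eval_zero [simp]: "mpoly_eval x 0 = 0"
  by (simp add: mpoly_eval_def)

lemma mpoly_eval_add: "mpoly_eval x (f + g) = mpoly_eval x f + mpoly_eval x g"
proof -
  let ?S = "Poly_Mapping.keys f \<union> Poly_Mapping.keys g"
  have "Poly_Mapping.keys (f + g) \<subseteq> ?S"
    by (rule keys_add)
  then show ?thesis
    by (simp add: mpoly_eval_superset[of ?S] lookup_add distrib_right sum.distrib)
qed

lemma mpoly_eval_single: "mpoly_eval x (Poly_Mapping.single m c) = c * monomial_eval x m"
  by (simp add: mpoly_eval_superset[of "{m}"] lookup_single)

lemma mpoly_eval_sum: "mpoly_eval x (\<Sum>i\<in>I. f i) = (\<Sum>i\<in>I. mpoly_eval x (f i))"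
  by (induction I rule: infinite_finite_induct) (auto simp: mpoly_eval_add)

lemma mpoly_sum_monomials:
  "(\<Sum>m\<in>Poly_Mapping.keys f. Poly_Mapping.single m (Poly_Mapping.lookup f m)) = f"
  by (rule poly_mapping_eqI) (auto simp: lookup_sum lookup_single when_def in_keys_iff)

lemma mpoly_eval_mult: "mpoly_eval x (f * g) = mpoly_eval x f * mpoly_eval x g"
proof -
  have "f * g = (\<Sum>m\<in>Poly_Mapping.keys f. \<Sum>m'\<in>Poly_Mapping.keys g.
      Poly_Mapping.single (m + m') (Poly_Mapping.lookup f m * Poly_Mapping.lookup g m'))"
    by (subst (1) mpoly_sum_monomials[of f, symmetric], subst (1) mpoly_sum_monomials[of g, symmetric])
      (simp add: sum_product mult_single)
  then have "mpoly_eval x (f * g) = (\<Sum>m\<in>Poly_Mapping.keys f. \<Sum>m'\<in>Poly_Mapping.keys g.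
      (Poly_Mapping.lookup f m * monomial_eval x m) * (Poly_Mapping.lookup g m' * monomial_eval x m'))"
    by (simp add: mpoly_eval_sum mpoly_eval_single monomial_eval_add mult_ac)
  also have "\<dots> = mpoly_eval x f * mpoly_eval x g"
    by (simp add: sum_product mpoly_eval_def monomial_eval_def)
  finally show ?thesis .
qed

lemma mpoly_eval_prod:
  "mpoly_eval x (\<Prod>i\<in>I. f i) = (\<Prod>i\<in>I. mpoly_eval x (f i))" if "finite I"
proof -
  have one: "mpoly_eval x 1 = 1"
    using mpoly_eval_single[of x 0 1] by (simp add: monomial_eval_def)
  show ?thesis
    using that by induction (auto simp: mpoly_eval_mult one)
qed

text \<open>This reduces every genericity argument to a polynomial in the curve parameter, which is
  zero or has finitely many roots.\<close>

lemma mpoly_eval_polynomial_curve: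
  "\<exists>q. \<forall>t. mpoly_eval (\<lambda>c. poly (X c) t) f = poly q t"
proof
  show "\<forall>t. mpoly_eval (\<lambda>c. poly (X c) t) f = poly (\<Sum>m\<in>Poly_Mapping.keys f.
      smult (Poly_Mapping.lookup f m) (\<Prod>c\<in>Poly_Mapping.keys m. X c ^ Poly_Mapping.lookup m c)) t"
    by (simp add: mpoly_eval_def poly_sum poly_prod poly_power)
qed


section \<open>Points and lines\<close>

text \<open>Stated over rings so that it applies to vectors of polynomials in a curve parameter as
  well as to vectors over the field.\<close>

definition wedge :: "(nat \<Rightarrow> 'a::comm_ring) \<Rightarrow> (nat \<Rightarrow> 'a) \<Rightarrow> nat \<Rightarrow> nat \<Rightarrow> 'a" where
  "wedge a b i j = a i * b j - a j * b i"

lemma wedge_combination: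
  fixes a b :: "nat \<Rightarrow> 'a::field"
  shows "wedge (vscale r a + vscale s b) (vscale r' a + vscale s' b) i j
    = (r * s' - s * r') * wedge a b i j"
  by (simp add: wedge_def vscale_def algebra_simps)

lemma span_single_iff: "x \<in> vec.span {a} \<longleftrightarrow> (\<exists>k. x = vscale k a)"
  by (auto simp: vec.span_singleton)

lemma span_pair_iff: "x \<in> vec.span {a, b} \<longleftrightarrow> (\<exists>r s. x = vscale r a + vscale s b)"
  unfolding vec.span_insert[of a "{b}"] span_single_iff mem_Collect_eq
  by (metis add.commute diff_eq_eq)

lemma wedge_zero_if_mem_span:
  assumes "b \<in> vec.span {a}"
  shows "wedge a b i j = 0"
  using assms by (auto simp: span_single_iff wedge_def vscale_def)

lemma mem_span_if_wedge_zero: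
  fixes a b :: "nat \<Rightarrow> 'a::field"
  assumes "a \<noteq> 0" "\<And>i j. wedge a b i j = 0"
  shows "b \<in> vec.span {a}"
proof -
  obtain i where i: "a i \<noteq> 0"
    using assms(1) by (auto simp: fun_eq_iff)
  have "b j = b i / a i * a j" for j
    using assms(2)[of i j] i by (simp add: wedge_def field_simps)
  then have "b = vscale (b i / a i) a"
    unfolding vscale_def by (rule ext)
  then show ?thesis
    unfolding span_single_iff by (rule exI)
qed

lemma independent_pair_iff_wedge:
  fixes a b :: "nat \<Rightarrow> 'a::field"
  shows "a \<noteq> b \<and> vec.independent {a, b} \<longleftrightarrow> (\<exists>i j. wedge a b i j \<noteq> 0)"
proof
  assume ind: "a \<noteq> b \<and> vec.independent {a, b}"
  then have "b \<noteq> 0"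
    using vec.dependent_zero by blast
  moreover have "a \<notin> vec.span {b}"
    using ind vec.independent_insert[of a "{b}"] by auto
  ultimately obtain i j where "wedge b a i j \<noteq> 0"
    using mem_span_if_wedge_zero by blast
  then show "\<exists>i j. wedge a b i j \<noteq> 0"
    by (intro exI[of _ j] exI[of _ i]) (auto simp: wedge_def mult_ac)
next
  assume "\<exists>i j. wedge a b i j \<noteq> 0"
  then obtain i j where w: "wedge a b i j \<noteq> 0" by auto
  then have "b \<noteq> 0" "a \<noteq> b"
    by (auto simp: wedge_def mult_ac)
  moreover have "a \<notin> vec.span {b}"
    using w wedge_zero_if_mem_span[of a b j i] by (auto simp: wedge_def mult_ac)
  ultimately show "a \<noteq> b \<and> vec.independent {a, b}"
    using vec.independent_insert[of a "{b}"] vec.independent_insert[of b "{}"] by auto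
qed

lemma dim_span_pair_iff:
  fixes a b :: "nat \<Rightarrow> 'a::field"
  shows "vec.dim (vec.span {a, b}) = 2 \<longleftrightarrow> (\<exists>i j. wedge a b i j \<noteq> 0)"
proof
  assume dim: "vec.dim (vec.span {a, b}) = 2"
  show "\<exists>i j. wedge a b i j \<noteq> 0"
  proof (rule ccontr)
    assume "\<nexists>i j. wedge a b i j \<noteq> 0"
    then have "{a, b} \<subseteq> vec.span {a} \<or> {a, b} \<subseteq> vec.span {b}"
      using mem_span_if_wedge_zero[of a b] vec.span_base[of a "{a}"] vec.span_base[of b "{b}"]
        vec.span_zero[of "{b}"] by (cases "a = 0") auto
    then have "vec.dim {a, b} \<le> 1"
      using vec.dim_le_card[of "{a, b}" "{a}"] vec.dim_le_card[of "{a, b}" "{b}"] by auto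
    then show False
      using dim by simp
  qed
next
  assume "\<exists>i j. wedge a b i j \<noteq> 0"
  then have "a \<noteq> b" "vec.independent {a, b}"
    using independent_pair_iff_wedge by auto
  then show "vec.dim (vec.span {a, b}) = 2"
    using vec.dim_span_eq_card_independent[of "{a, b}"] by auto
qed

lemma span_pair_eqI:
  fixes a b p u :: "nat \<Rightarrow> 'a::field"
  assumes "p \<in> vec.span {a, b}" "u \<in> vec.span {a, b}" "wedge p u i j \<noteq> 0"
  shows "vec.span {a, b} = vec.span {p, u}"
proof -
  obtain r s r' s' where p: "p = vscale r a + vscale s b" and u: "u = vscale r' a + vscale s' b"
    using assms(1,2) by (auto simp: span_pair_iff)
  define D where "D = r * s' - s * r'"
  have D: "D \<noteq> 0"
    using assms(3) unfolding p u wedge_combination D_def by auto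
  \<comment> \<open>Cramer's rule for the base change with determinant \<open>D\<close>.\<close>
  have "a = vscale (s' / D) p + vscale (- s / D) u"
    using D unfolding p u
    by (auto simp: vscale_def fun_eq_iff field_simps) (auto simp: D_def algebra_simps)
  then have "a \<in> vec.span {p, u}"
    unfolding span_pair_iff by (intro exI)
  moreover have "b = vscale (- r' / D) p + vscale (r / D) u"
    using D unfolding p u
    by (auto simp: vscale_def fun_eq_iff field_simps) (auto simp: D_def algebra_simps)
  then have "b \<in> vec.span {p, u}"
    unfolding span_pair_iff by (intro exI)
  ultimately show ?thesis
    using assms(1,2) by (intro subset_antisym vec.span_minimal) auto
qed

lemma subspace_coordinate_space: "vec.subspace (coordinate_space d :: (nat \<Rightarrow> 'a::field) set)"
  by (rule vec.subspaceI) (auto simp: coordinate_space_def vscale_def)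

lemma coordinate_space_support: "a \<in> coordinate_space d \<Longrightarrow> a i \<noteq> 0 \<Longrightarrow> i \<le> d"
  by (rule ccontr) (simp add: coordinate_space_def)

lemma span_single_in_proj_points:
  "a \<in> coordinate_space d \<Longrightarrow> a \<noteq> 0 \<Longrightarrow> vec.span {a} \<in> proj_points d"
  using vec.span_minimal[OF _ subspace_coordinate_space, of "{a}" d]
    vec.dim_span_eq_card_independent[of "{a}"] vec.independent_insert[of a "{}"]
  by (auto simp: proj_points_def)

lemma span_pair_in_proj_lines:
  "a \<in> coordinate_space d \<Longrightarrow> b \<in> coordinate_space d \<Longrightarrow> wedge a b i j \<noteq> 0
    \<Longrightarrow> vec.span {a, b} \<in> proj_lines d"
  using vec.span_minimal[OF _ subspace_coordinate_space, of "{a, b}" d] dim_span_pair_iff[of a b]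
  by (auto simp: proj_lines_def)

lemma proj_point_representative:
  assumes "L \<in> proj_points d"
  obtains a i where "L = vec.span {a}" "a \<in> coordinate_space d" "a i \<noteq> 0" "i \<le> d"
proof -
  have L: "vec.subspace L" "L \<subseteq> coordinate_space d" "vec.dim L = 1"
    using assms by (auto simp: proj_points_def)
  obtain B where B: "B \<subseteq> L" "vec.independent B" "vec.span B = L" "card B = 1"
    using vec.basis_exists[of L] vec.span_subspace[OF _ _ L(1)] L(3) by metis
  then obtain a where a: "B = {a}"
    by (auto simp: card_1_singleton_iff)
  then have "a \<noteq> 0"
    using B(2) vec.dependent_zero by blast
  then obtain i where "a i \<noteq> 0"
    by (auto simp: fun_eq_iff)
  moreover have "a \<in> coordinate_space d"
    using B a L by auto
  moreover then have "i \<le> d"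
    by (rule coordinate_space_support) fact
  ultimately show ?thesis
    using that[of a i] B a by simp
qed

lemma proj_line_representative:
  assumes "L \<in> proj_lines d"
  obtains a b i j where "L = vec.span {a, b}" "a \<in> coordinate_space d" "b \<in> coordinate_space d"
    "wedge a b i j \<noteq> 0"
proof -
  have L: "vec.subspace L" "L \<subseteq> coordinate_space d" "vec.dim L = 2"
    using assms by (auto simp: proj_lines_def)
  obtain B where B: "B \<subseteq> L" "vec.independent B" "vec.span B = L" "card B = 2"
    using vec.basis_exists[of L] vec.span_subspace[OF _ _ L(1)] L(3) by metis
  then obtain a b where ab: "B = {a, b}"
    by (auto simp: card_2_iff)
  then have "L = vec.span {a, b}"
    using B by simp
  moreover then obtain i j where "wedge a b i j \<noteq> 0"
    using dim_span_pair_iff[of a b] L by auto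
  ultimately show ?thesis
    using that[of a b i j] B(1) ab L(2) by auto
qed

text \<open>The normalization \<open>u i = 0\<close> makes \<open>u\<close> a direction in the
  affine chart of coordinate \<open>i\<close>: a motion along \<open>u\<close> leaves the nonzero
  coordinate \<open>a i\<close> alone.\<close>

lemma proj_line_through_point:
  assumes "L \<in> proj_lines d" "a \<in> L" "a i \<noteq> 0"
  obtains u j where "L = vec.span {a, u}" "u \<in> coordinate_space d" "u i = 0" "u j \<noteq> 0" "j \<le> d"
    "j \<noteq> i"
proof -
  obtain p q k l where L: "L = vec.span {p, q}" and pq: "p \<in> coordinate_space d"
      "q \<in> coordinate_space d" "wedge p q k l \<noteq> 0"
    using proj_line_representative[OF assms(1)] by metis
  have "p \<in> L" "q \<in> L"
    unfolding L by (auto intro: vec.span_base)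
  have "a \<noteq> 0"
    using assms(3) by auto
  have "\<exists>w\<in>{p, q}. \<exists>k l. wedge a w k l \<noteq> 0"
  proof (rule ccontr)
    assume "\<not> ?thesis"
    then have "p \<in> vec.span {a}" "q \<in> vec.span {a}"
      using mem_span_if_wedge_zero[OF \<open>a \<noteq> 0\<close>] by auto
    then have "wedge p q k l = 0"
      by (auto simp: span_single_iff wedge_def vscale_def)
    then show False
      using pq by simp
  qed
  then obtain w k l where w: "w \<in> {p, q}" "wedge a w k l \<noteq> 0" by auto
  \<comment> \<open>Subtracting a multiple of \<open>a\<close> clears coordinate \<open>i\<close>
    without changing the wedge with \<open>a\<close>, so the span with \<open>a\<close> is still
    \<open>L\<close>.\<close>
  define u where "u = w - vscale (w i / a i) a"
  have wedge: "wedge a u k l = wedge a w k l"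
    by (simp add: u_def wedge_def vscale_def algebra_simps)
  have "u \<in> L"
    using w \<open>p \<in> L\<close> \<open>q \<in> L\<close> assms(2) unfolding u_def L
    by (auto intro!: vec.span_diff vec.span_scale)
  then have "L = vec.span {a, u}"
    using assms(2) w(2) wedge span_pair_eqI[of a p q u k l] unfolding L by metis
  moreover have "u \<in> coordinate_space d"
    using \<open>u \<in> L\<close> assms(1) by (auto simp: proj_lines_def)
  moreover have ui: "u i = 0"
    using assms(3) by (simp add: u_def vscale_def)
  moreover have "u \<noteq> 0"
    using w(2) wedge by (auto simp: wedge_def)
  then obtain j where j: "u j \<noteq> 0"
    by (auto simp: fun_eq_iff)
  moreover have "j \<le> d"
    using coordinate_space_support[OF \<open>u \<in> coordinate_space d\<close> j] .
  ultimately show ?thesis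
    using that by metis
qed

lemma span_single_eq_iff_wedge:
  fixes a b :: "nat \<Rightarrow> 'a::field"
  assumes "a \<noteq> 0" "b \<noteq> 0"
  shows "vec.span {a} = vec.span {b} \<longleftrightarrow> (\<forall>i j. wedge a b i j = 0)"
proof
  assume "vec.span {a} = vec.span {b}"
  then have "b \<in> vec.span {a}"
    by (simp add: vec.span_base)
  then show "\<forall>i j. wedge a b i j = 0"
    by (simp add: wedge_zero_if_mem_span)
next
  assume w: "\<forall>i j. wedge a b i j = 0"
  then have "\<forall>i j. wedge b a i j = 0"
    by (auto simp: wedge_def mult_ac)
  then have "a \<in> vec.span {b}" "b \<in> vec.span {a}"
    using w assms by (auto intro: mem_span_if_wedge_zero)
  then show "vec.span {a} = vec.span {b}"
    by (intro subset_antisym vec.span_minimal) auto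
qed


section \<open>Homogeneous coordinates\<close>

text \<open>The sets \<open>C i\<close> stand for the coordinate blocks of the vertices or of the
  edges, and \<open>N i\<close> for the degree of a monomial in block \<open>i\<close>.\<close>

lemma prod_rescale:
  fixes x y :: "'x \<Rightarrow> 'a::comm_ring_1"
  assumes "finite I" "\<And>i. i \<in> I \<Longrightarrow> finite (C i)"
    and "\<And>i j. i \<in> I \<Longrightarrow> j \<in> I \<Longrightarrow> i \<noteq> j \<Longrightarrow> C i \<inter> C j = {}"
    and "\<And>i c. i \<in> I \<Longrightarrow> c \<in> C i \<Longrightarrow> y c = s i * x c"
    and "\<And>i. i \<in> I \<Longrightarrow> (\<Sum>c\<in>C i. m c) = N i"
  shows "(\<Prod>c\<in>(\<Union>i\<in>I. C i). y c ^ m c) = (\<Prod>i\<in>I. s i ^ N i) * (\<Prod>c\<in>(\<Union>i\<in>I. C i). x c ^ m c)"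
proof -
  have "(\<Prod>c\<in>(\<Union>i\<in>I. C i). y c ^ m c) = (\<Prod>i\<in>I. \<Prod>c\<in>C i. y c ^ m c)"
    using assms(1-3) by (intro prod.UNION_disjoint) auto
  also have "\<dots> = (\<Prod>i\<in>I. s i ^ N i * (\<Prod>c\<in>C i. x c ^ m c))"
  proof (rule prod.cong)
    fix i assume i: "i \<in> I"
    have "(\<Prod>c\<in>C i. y c ^ m c) = (\<Prod>c\<in>C i. s i ^ m c * x c ^ m c)"
      using assms(4)[OF i] by (intro prod.cong) (auto simp: power_mult_distrib)
    also have "\<dots> = s i ^ N i * (\<Prod>c\<in>C i. x c ^ m c)"
      using assms(5)[OF i] by (simp add: prod.distrib power_sum[symmetric])
    finally show "(\<Prod>c\<in>C i. y c ^ m c) = s i ^ N i * (\<Prod>c\<in>C i. x c ^ m c)" .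
  qed simp
  also have "\<dots> = (\<Prod>i\<in>I. s i ^ N i) * (\<Prod>i\<in>I. \<Prod>c\<in>C i. x c ^ m c)"
    by (rule prod.distrib)
  also have "(\<Prod>i\<in>I. \<Prod>c\<in>C i. x c ^ m c) = (\<Prod>c\<in>(\<Union>i\<in>I. C i). x c ^ m c)"
    using assms(1-3) by (intro prod.UNION_disjoint[symmetric]) auto
  finally show ?thesis .
qed

lemma finite_point_coords: "finite (point_coords d v)"
  by (simp add: point_coords_def)

lemma finite_line_coords: "finite (line_coords d e)"
proof -
  have "line_coords d e \<subseteq> (\<lambda>(i, j). Line_Coord e i j) ` ({..d} \<times> {..d})"
    by (auto simp: line_coords_def)
  then show ?thesis
    by (rule finite_subset) auto
qed

text \<open>The factor \<open>k\<close> depends only on the degrees in the blocks, which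
  multihomogeneity makes common to all monomials of \<open>f\<close>.\<close>

lemma mpoly_eval_rescale:
  fixes x y :: "'v coord \<Rightarrow> 'a::field"
  assumes fin: "finite V" "finite E" and f: "multihomogeneous d V E f"
    and \<alpha>: "\<And>v i. v \<in> V \<Longrightarrow> y (Point_Coord v i) = \<alpha> v * x (Point_Coord v i)" "\<And>v. v \<in> V \<Longrightarrow> \<alpha> v \<noteq> 0"
    and \<beta>: "\<And>e i j. e \<in> E \<Longrightarrow> y (Line_Coord e i j) = \<beta> e * x (Line_Coord e i j)"
      "\<And>e. e \<in> E \<Longrightarrow> \<beta> e \<noteq> 0"
  shows "\<exists>k. k \<noteq> 0 \<and> mpoly_eval y f = k * mpoly_eval x f"
proof -
  define U where "U = (\<Union>v\<in>V. point_coords d v)"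
  define W where "W = (\<Union>e\<in>E. line_coords d e)"
  have UW: "finite U" "finite W"
    using fin by (auto simp: U_def W_def finite_point_coords finite_line_coords)
  have disj: "U \<inter> W = {}"
    by (auto simp: U_def W_def point_coords_def line_coords_def)
  have keys: "Poly_Mapping.keys m \<subseteq> U \<union> W" if "m \<in> Poly_Mapping.keys f" for m
    using f that by (auto simp: multihomogeneous_def U_def W_def)
  have "\<forall>v\<in>V. \<exists>n. \<forall>m\<in>Poly_Mapping.keys f. (\<Sum>c\<in>point_coords d v. Poly_Mapping.lookup m c) = n"
    using f by (auto simp: multihomogeneous_def homogeneous_in_def)
  then obtain N where N: "\<And>v m. v \<in> V \<Longrightarrow> m \<in> Poly_Mapping.keys f
      \<Longrightarrow> (\<Sum>c\<in>point_coords d v. Poly_Mapping.lookup m c) = N v"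
    by metis
  have "\<forall>e\<in>E. \<exists>n. \<forall>m\<in>Poly_Mapping.keys f. (\<Sum>c\<in>line_coords d e. Poly_Mapping.lookup m c) = n"
    using f by (auto simp: multihomogeneous_def homogeneous_in_def)
  then obtain M where M: "\<And>e m. e \<in> E \<Longrightarrow> m \<in> Poly_Mapping.keys f
      \<Longrightarrow> (\<Sum>c\<in>line_coords d e. Poly_Mapping.lookup m c) = M e"
    by metis
  define k where "k = (\<Prod>v\<in>V. \<alpha> v ^ N v) * (\<Prod>e\<in>E. \<beta> e ^ M e)"
  have "monomial_eval y m = k * monomial_eval x m" if m: "m \<in> Poly_Mapping.keys f" for m
  proof -
    have split: "monomial_eval z m = (\<Prod>c\<in>U. z c ^ Poly_Mapping.lookup m c)
        * (\<Prod>c\<in>W. z c ^ Poly_Mapping.lookup m c)" for z :: "'v coord \<Rightarrow> 'a"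
      using UW disj keys[OF m] by (simp add: monomial_eval_superset[of "U \<union> W"] prod.union_disjoint)
    have "(\<Prod>c\<in>U. y c ^ Poly_Mapping.lookup m c)
        = (\<Prod>v\<in>V. \<alpha> v ^ N v) * (\<Prod>c\<in>U. x c ^ Poly_Mapping.lookup m c)"
      unfolding U_def
      using fin finite_point_coords \<alpha>(1) N[OF _ m]
      by (intro prod_rescale) (auto simp: point_coords_def)
    moreover have "(\<Prod>c\<in>W. y c ^ Poly_Mapping.lookup m c)
        = (\<Prod>e\<in>E. \<beta> e ^ M e) * (\<Prod>c\<in>W. x c ^ Poly_Mapping.lookup m c)"
      unfolding W_def
      using fin finite_line_coords \<beta>(1) M[OF _ m]
      by (intro prod_rescale) (auto simp: line_coords_def)
    ultimately show ?thesis
      by (simp add: split k_def)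
  qed
  then have "mpoly_eval y f = k * mpoly_eval x f"
    by (simp add: mpoly_eval_def monomial_eval_def[symmetric] sum_distrib_left mult.left_commute)
  moreover have "k \<noteq> 0"
    using \<alpha>(2) \<beta>(2) fin by (simp add: k_def)
  ultimately show ?thesis
    by blast
qed

text \<open>Vanishing can be tested on one choice of coordinates: two choices differ by a nonzero
  factor at each vertex and, at each edge, by the determinant of the change of basis.\<close>

lemma vanishes_at_iff:
  assumes fin: "finite V" "finite E" and f: "multihomogeneous d V E f"
    and P: "P \<in> ambient_space d V E" and x: "homogeneous_coordinates V E P x"
  shows "vanishes_at V E f P \<longleftrightarrow> mpoly_eval x f = 0"
proof -
  have "mpoly_eval y f = 0" if y: "homogeneous_coordinates V E P y" and zero: "mpoly_eval x f = 0" for y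
  proof -
    have "\<exists>k. k \<noteq> 0 \<and> (\<forall>i. y (Point_Coord v i) = k * x (Point_Coord v i))" if v: "v \<in> V" for v
    proof -
      obtain a where a: "fst P v = vec.span {a}" "\<And>i. x (Point_Coord v i) = a i"
        using x v by (auto simp: homogeneous_coordinates_def)
      obtain b where b: "fst P v = vec.span {b}" "\<And>i. y (Point_Coord v i) = b i"
        using y v by (auto simp: homogeneous_coordinates_def)
      have "fst P v \<in> proj_points d"
        using P v by (auto simp: ambient_space_def)
      then have "vec.dim (vec.span {b}) = 1"
        unfolding b(1) by (simp add: proj_points_def)
      then have "b \<noteq> 0"
        using vec.dim_le_card[of "{b}" "{}"] by auto
      have "b \<in> vec.span {a}"
        unfolding a(1)[symmetric] b(1) by (simp add: vec.span_base)
      then obtain k where k: "b = vscale k a"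
        by (auto simp: span_single_iff)
      then have "k \<noteq> 0"
        using \<open>b \<noteq> 0\<close> by (auto simp: vscale_def)
      then show ?thesis
        by (intro exI[of _ k]) (simp add: a(2) b(2) k vscale_def)
    qed
    then obtain \<alpha> where \<alpha>: "\<And>v. v \<in> V \<Longrightarrow> \<alpha> v \<noteq> 0"
        "\<And>v i. v \<in> V \<Longrightarrow> y (Point_Coord v i) = \<alpha> v * x (Point_Coord v i)"
      by metis
    have "\<exists>k. k \<noteq> 0 \<and> (\<forall>i j. y (Line_Coord e i j) = k * x (Line_Coord e i j))" if e: "e \<in> E" for e
    proof -
      obtain a b where ab: "snd P e = vec.span {a, b}" "\<And>i j. x (Line_Coord e i j) = wedge a b i j"
        using x e by (auto simp: homogeneous_coordinates_def wedge_def)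
      obtain a' b' where ab': "snd P e = vec.span {a', b'}" "\<And>i j. y (Line_Coord e i j) = wedge a' b' i j"
        using y e by (auto simp: homogeneous_coordinates_def wedge_def)
      have "snd P e \<in> proj_lines d"
        using P e by (auto simp: ambient_space_def)
      then have "vec.dim (vec.span {a', b'}) = 2"
        unfolding ab'(1) by (simp add: proj_lines_def)
      then obtain i j where w: "wedge a' b' i j \<noteq> 0"
        unfolding dim_span_pair_iff by auto
      have "a' \<in> vec.span {a, b}" "b' \<in> vec.span {a, b}"
        unfolding ab(1)[symmetric] ab'(1) by (auto intro: vec.span_base)
      then obtain r s r' s' where rs: "a' = vscale r a + vscale s b" "b' = vscale r' a + vscale s' b"
        by (auto simp: span_pair_iff)
      have "r * s' - s * r' \<noteq> 0"
        using w unfolding rs wedge_combination by auto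
      then show ?thesis
        by (intro exI[of _ "r * s' - s * r'"]) (simp add: ab(2) ab'(2) rs wedge_combination)
    qed
    then obtain \<beta> where \<beta>: "\<And>e. e \<in> E \<Longrightarrow> \<beta> e \<noteq> 0"
        "\<And>e i j. e \<in> E \<Longrightarrow> y (Line_Coord e i j) = \<beta> e * x (Line_Coord e i j)"
      by metis
    show ?thesis
      using mpoly_eval_rescale[OF fin f \<alpha>(2,1) \<beta>(2,1)] zero by auto
  qed
  then show ?thesis
    using x by (auto simp: vanishes_at_def)
qed

text \<open>Over a ring, so that a curve of pictures is one \<open>vec_coords\<close> of polynomial
  vectors, evaluated by \<open>poly_vec_coords\<close>.\<close>

definition vec_coords ::
  "('v \<Rightarrow> nat \<Rightarrow> 'a::comm_ring_1) \<Rightarrow> ('v set \<Rightarrow> nat \<Rightarrow> 'a) \<Rightarrow> ('v set \<Rightarrow> nat \<Rightarrow> 'a) \<Rightarrow> 'v coord \<Rightarrow> 'a"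
where
  "vec_coords a b c x
    = (case x of Point_Coord v i \<Rightarrow> a v i | Line_Coord e i j \<Rightarrow> wedge (b e) (c e) i j)"

lemma vec_coords_simps [simp]:
  "vec_coords a b c (Point_Coord v i) = a v i"
  "vec_coords a b c (Line_Coord e i j) = wedge (b e) (c e) i j"
  by (simp_all add: vec_coords_def)

lemma poly_vec_coords:
  "(\<lambda>x. poly (vec_coords a b c x) t)
    = vec_coords (\<lambda>v i. poly (a v i) t) (\<lambda>e i. poly (b e i) t) (\<lambda>e i. poly (c e i) t)"
proof
  fix x
  show "poly (vec_coords a b c x) t
    = vec_coords (\<lambda>v i. poly (a v i) t) (\<lambda>e i. poly (b e i) t) (\<lambda>e i. poly (c e i) t) x"
    by (cases x) (auto simp: wedge_def)
qed

definition vec_picture ::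
  "'v set \<Rightarrow> 'v set set \<Rightarrow> ('v \<Rightarrow> nat \<Rightarrow> 'a::field) \<Rightarrow> ('v set \<Rightarrow> nat \<Rightarrow> 'a) \<Rightarrow> ('v set \<Rightarrow> nat \<Rightarrow> 'a)
    \<Rightarrow> ('v, 'a) picture"
where
  "vec_picture V E a b c = (\<lambda>v\<in>V. vec.span {a v}, \<lambda>e\<in>E. vec.span {b e, c e})"

lemma homogeneous_coordinates_vec_coords:
  assumes "\<And>v. v \<in> V \<Longrightarrow> fst P v = vec.span {a v}" "\<And>e. e \<in> E \<Longrightarrow> snd P e = vec.span {b e, c e}"
  shows "homogeneous_coordinates V E P (vec_coords a b c)"
  unfolding homogeneous_coordinates_def
proof (intro conjI ballI)
  fix v assume "v \<in> V"
  then show "\<exists>p. fst P v = vec.span {p} \<and> (\<forall>i. vec_coords a b c (Point_Coord v i) = p i)"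
    using assms by (intro exI[of _ "a v"]) simp
next
  fix e assume "e \<in> E"
  then show "\<exists>p q. snd P e = vec.span {p, q}
      \<and> (\<forall>i j. vec_coords a b c (Line_Coord e i j) = p i * q j - p j * q i)"
    using assms by (intro exI[of _ "b e"] exI[of _ "c e"]) (simp add: wedge_def)
qed

lemma homogeneous_coordinates_vec_picture:
  "homogeneous_coordinates V E (vec_picture V E a b c) (vec_coords a b c)"
  by (rule homogeneous_coordinates_vec_coords) (auto simp: vec_picture_def)

lemma picture_space_subset_ambient: "picture_space d V E \<subseteq> ambient_space d V E"
  by (auto simp: picture_space_def)

lemma vec_picture_in_picture_space:
  assumes "\<And>v. v \<in> V \<Longrightarrow> a v \<in> coordinate_space d" "\<And>v. v \<in> V \<Longrightarrow> a v \<noteq> 0"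
    and "\<And>e. e \<in> E \<Longrightarrow> b e \<in> coordinate_space d" "\<And>e. e \<in> E \<Longrightarrow> c e \<in> coordinate_space d"
    and "\<And>e. e \<in> E \<Longrightarrow> \<exists>i j. wedge (b e) (c e) i j \<noteq> 0"
    and "\<And>e v. e \<in> E \<Longrightarrow> v \<in> e \<Longrightarrow> v \<in> V \<and> a v \<in> vec.span {b e, c e}"
  shows "vec_picture V E a b c \<in> picture_space d V E"
proof -
  have "vec.span {a v} \<in> proj_points d" if "v \<in> V" for v
    using that assms by (intro span_single_in_proj_points) auto
  moreover have "vec.span {b e, c e} \<in> proj_lines d" if "e \<in> E" for e
    using assms(3-5)[OF that] span_pair_in_proj_lines by metis
  moreover have "vec.span {a v} \<subseteq> vec.span {b e, c e}" if "e \<in> E" "v \<in> e" for e v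
    using assms(6)[OF that] by (intro vec.span_minimal) auto
  ultimately show ?thesis
    using assms(6) by (auto simp: picture_space_def ambient_space_def vec_picture_def)
qed


section \<open>Curves of pictures\<close>

lemma zariski_closed_separation:
  assumes "zariski_closed d V E Z" "P \<in> ambient_space d V E" "P \<notin> Z"
  obtains f where "multihomogeneous d V E f" "\<not> vanishes_at V E f P"
    "\<And>Q. Q \<in> Z \<Longrightarrow> vanishes_at V E f Q"
  using assms unfolding zariski_closed_def by auto

lemma finite_zeros_on_curve:
  fixes X :: "'v coord \<Rightarrow> 'a::field poly"
  assumes "finite V" "finite E" "multihomogeneous d V E f"
    and "P \<in> ambient_space d V E" "homogeneous_coordinates V E P (\<lambda>c. poly (X c) t)"
    and "\<not> vanishes_at V E f P"
  shows "finite {s. mpoly_eval (\<lambda>c. poly (X c) s) f = 0}"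
proof -
  obtain q where q: "\<And>t. mpoly_eval (\<lambda>c. poly (X c) t) f = poly q t"
    using mpoly_eval_polynomial_curve by metis
  have "poly q t \<noteq> 0"
    using vanishes_at_iff[OF assms(1-5)] assms(6) q by auto
  then have "q \<noteq> 0" by auto
  then show ?thesis
    using poly_roots_finite by (simp add: q)
qed

lemma finite_degenerate_on_curve:
  fixes a b :: "nat \<Rightarrow> 'a::field poly"
  assumes "wedge (\<lambda>i. poly (a i) t) (\<lambda>i. poly (b i) t) i j \<noteq> 0"
  shows "finite {s. \<forall>i j. wedge (\<lambda>i. poly (a i) s) (\<lambda>i. poly (b i) s) i j = 0}"
proof -
  define q where "q = wedge a b i j"
  have q: "poly q s = wedge (\<lambda>i. poly (a i) s) (\<lambda>i. poly (b i) s) i j" for s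
    by (simp add: q_def wedge_def)
  have "q \<noteq> 0"
    using assms q[of t] by auto
  then have "finite {s. poly q s = 0}"
    by (rule poly_roots_finite)
  then show ?thesis
    by (rule finite_subset[rotated]) (auto simp: q)
qed

lemma finite_zero_on_curve:
  fixes a :: "nat \<Rightarrow> 'a::field poly"
  assumes "(\<lambda>i. poly (a i) t) \<noteq> 0"
  shows "finite {s. (\<lambda>i. poly (a i) s) = 0}"
proof -
  obtain i where "poly (a i) t \<noteq> 0"
    using assms by (auto simp: fun_eq_iff)
  then have "a i \<noteq> 0" by auto
  then have "finite {s. poly (a i) s = 0}"
    by (rule poly_roots_finite)
  then show ?thesis
    by (rule finite_subset[rotated]) (auto simp: fun_eq_iff)
qed

text \<open>The form in which density is used. A polynomial separating \<open>P\<close> from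
  \<open>Z\<close> is nonzero at parameter 0 and so has finitely many zeros along the curve, whereas
  \<open>Z\<close> forces a zero at every parameter outside \<open>T\<close>.\<close>

lemma zariski_closed_curve_limit:
  fixes X :: "'v coord \<Rightarrow> 'a::field poly"
  assumes inf: "infinite (UNIV :: 'a set)" and fin: "finite V" "finite E"
    and Z: "zariski_closed d V E Z"
    and P: "P \<in> ambient_space d V E" "homogeneous_coordinates V E P (\<lambda>c. poly (X c) 0)"
    and T: "finite T" "\<And>t. t \<notin> T \<Longrightarrow> \<exists>Q\<in>Z. homogeneous_coordinates V E Q (\<lambda>c. poly (X c) t)"
  shows "P \<in> Z"
proof (rule ccontr)
  assume "P \<notin> Z"
  then obtain f where f: "multihomogeneous d V E f" "\<not> vanishes_at V E f P"
    "\<And>Q. Q \<in> Z \<Longrightarrow> vanishes_at V E f Q"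
    using zariski_closed_separation[OF Z P(1)] by blast
  have "finite (T \<union> {s. mpoly_eval (\<lambda>c. poly (X c) s) f = 0})"
    using finite_zeros_on_curve[OF fin f(1) P f(2)] T(1) by simp
  then obtain t where t: "t \<notin> T" "mpoly_eval (\<lambda>c. poly (X c) t) f \<noteq> 0"
    using ex_new_if_finite[OF inf] by blast
  obtain Q where Q: "Q \<in> Z" "homogeneous_coordinates V E Q (\<lambda>c. poly (X c) t)"
    using T(2)[OF t(1)] by auto
  show False
    using f(3)[OF Q(1)] Q(2) t(2) by (auto simp: vanishes_at_def)
qed


section \<open>Oriented graphs and generic pictures\<close>

text \<open>Edges are unordered; the orientation, an arbitrary choice, only fixes the sign of the
  displacement along an edge.\<close>

locale oriented_graph =
  fixes V :: "'v set" and E :: "'v set set" and tail head :: "'v set \<Rightarrow> 'v"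
  assumes finite_V: "finite V"
    and edge_subset: "e \<in> E \<Longrightarrow> e \<subseteq> V"
    and edge_ends: "e \<in> E \<Longrightarrow> e = {tail e, head e}"
    and ends_distinct: "e \<in> E \<Longrightarrow> tail e \<noteq> head e"
begin

lemma finite_E: "finite E"
  using finite_V edge_subset by (meson PowI finite_Pow_iff finite_subset subsetI)

lemma card_edge: "e \<in> E \<Longrightarrow> card e = 2"
  using edge_ends[of e] ends_distinct[of e] by (metis card_2_iff)

lemma tail_in_V: "e \<in> E \<Longrightarrow> tail e \<in> V" and head_in_V: "e \<in> E \<Longrightarrow> head e \<in> V"
  using edge_ends[of e] edge_subset[of e] by blast+

text \<open>The potential is the indicator of the component of \<open>head b\<close> in
  \<open>B - {b}\<close>: acyclicity puts \<open>tail b\<close> outside, and every other edge of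
  \<open>B\<close> stays within one component. Hence displacements along the edges of a forest can
  be prescribed freely.\<close>

lemma forest_potential:
  assumes B: "B \<subseteq> E" "acyclic_edges B" "b \<in> B"
  shows "\<exists>\<phi> :: 'v \<Rightarrow> 'a::field. \<forall>b'\<in>B. \<phi> (head b') - \<phi> (tail b') = (if b' = b then 1 else 0)"
proof -
  define C where "C = B - {b}"
  have bE: "b \<in> E"
    using B by auto
  define R where "R = (edge_rel C)\<^sup>*"
  have "B = insert {tail b, head b} C" "{tail b, head b} \<notin> C"
    using B(3) edge_ends[OF bE] by (auto simp: C_def)
  then have nc: "(tail b, head b) \<notin> R"
    using acyclic_edges_insert_iff[of C "tail b" "head b"] B(2) ends_distinct[OF bE]
      acyclic_edges_subset[of B C] by (auto simp: R_def)
  define \<phi> where "\<phi> v = (if (head b, v) \<in> R then 1 else 0 :: 'a)" for v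
  have "\<phi> (head b') - \<phi> (tail b') = (if b' = b then 1 else 0)" if b': "b' \<in> B" for b'
  proof (cases "b' = b")
    case True
    have "(head b, tail b) \<notin> R"
      using nc edge_rel_rtrancl_sym[of "head b" "tail b" C] by (auto simp: R_def)
    then show ?thesis
      using True by (simp add: \<phi>_def) (simp add: R_def)
  next
    case False
    then have "{tail b', head b'} \<in> C"
      using b' B(1) edge_ends[of b'] by (auto simp: C_def)
    then have "(tail b', head b') \<in> edge_rel C" "(head b', tail b') \<in> edge_rel C"
      by (auto simp: insert_commute)
    then have "(head b, head b') \<in> R \<longleftrightarrow> (head b, tail b') \<in> R"
      unfolding R_def by (meson rtrancl.rtrancl_into_rtrancl)
    then show ?thesis
      using False by (simp add: \<phi>_def)
  qed
  then show ?thesis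
    by blast
qed

definition collapsed :: "('v \<Rightarrow> 'p) \<Rightarrow> 'v set set" where
  "collapsed p = {e \<in> E. p (tail e) = p (head e)}"

text \<open>Vectors instead of projective points, so that configurations can be joined by polynomial
  curves. A nonzero wedge makes the two ends distinct points, which then determine the line.\<close>

definition generic_config :: "nat \<Rightarrow> ('v \<Rightarrow> nat \<Rightarrow> 'a::field) \<Rightarrow> bool" where
  "generic_config d x \<longleftrightarrow> (\<forall>v\<in>V. x v \<in> coordinate_space d \<and> x v \<noteq> 0) \<and>
     (\<forall>e\<in>E. \<exists>i j. wedge (x (tail e)) (x (head e)) i j \<noteq> 0)"

definition config_picture :: "('v \<Rightarrow> nat \<Rightarrow> 'a::field) \<Rightarrow> ('v, 'a) picture" where
  "config_picture x = vec_picture V E x (\<lambda>e. x (tail e)) (\<lambda>e. x (head e))"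

lemma config_picture_in_picture_space:
  assumes "generic_config d x"
  shows "config_picture x \<in> picture_space d V E"
  unfolding config_picture_def
proof (rule vec_picture_in_picture_space)
  fix e v assume ev: "e \<in> E" "v \<in> e"
  then have "v = tail e \<or> v = head e"
    using edge_ends[of e] by blast
  then show "v \<in> V \<and> x v \<in> vec.span {x (tail e), x (head e)}"
    using ev edge_subset by (auto intro: vec.span_base)
qed (use assms tail_in_V head_in_V in \<open>auto simp: generic_config_def\<close>)

lemma generic_picture_has_config:
  assumes P: "P \<in> picture_space d V E" "collapsed (fst P) = {}"
  obtains x where "generic_config d x" "P = config_picture x"
proof -
  obtain p l where Ppl: "P = (p, l)"
    by (cases P)
  have p: "p \<in> V \<rightarrow>\<^sub>E proj_points d" and l: "l \<in> E \<rightarrow>\<^sub>E proj_lines d"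
    and inc: "\<And>e v. e \<in> E \<Longrightarrow> v \<in> e \<Longrightarrow> p v \<subseteq> l e"
    using P(1) unfolding Ppl picture_space_def ambient_space_def by auto
  have "\<forall>v\<in>V. \<exists>a. p v = vec.span {a} \<and> a \<in> coordinate_space d \<and> a \<noteq> 0"
  proof
    fix v assume "v \<in> V"
    then have "p v \<in> proj_points d"
      using p by auto
    then obtain a i where "p v = vec.span {a}" "a \<in> coordinate_space d" "a i \<noteq> 0"
      by (rule proj_point_representative)
    then show "\<exists>a. p v = vec.span {a} \<and> a \<in> coordinate_space d \<and> a \<noteq> 0"
      by auto
  qed
  then obtain x where x: "\<And>v. v \<in> V \<Longrightarrow> p v = vec.span {x v}"
      "\<And>v. v \<in> V \<Longrightarrow> x v \<in> coordinate_space d" "\<And>v. v \<in> V \<Longrightarrow> x v \<noteq> 0"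
    by (auto dest!: bchoice)
  have wedge: "\<exists>i j. wedge (x (tail e)) (x (head e)) i j \<noteq> 0" if e: "e \<in> E" for e
  proof -
    have "p (tail e) \<noteq> p (head e)"
      using P(2) e by (auto simp: collapsed_def Ppl)
    then show ?thesis
      using x(1) span_single_eq_iff_wedge[OF x(3)[OF tail_in_V[OF e]] x(3)[OF head_in_V[OF e]]]
        tail_in_V[OF e] head_in_V[OF e] by metis
  qed
  have line: "l e = vec.span {x (tail e), x (head e)}" if e: "e \<in> E" for e
  proof -
    have "l e \<in> proj_lines d"
      using l e by auto
    then obtain a b i j where ab: "l e = vec.span {a, b}"
      by (rule proj_line_representative)
    have mem: "x v \<in> l e" if "v \<in> e" for v
    proof -
      have "v \<in> V"
        using edge_subset[OF e] that by blast
      then have "x v \<in> p v"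
        by (simp add: x(1) vec.span_base)
      then show ?thesis
        using inc[OF e that] by blast
    qed
    have "tail e \<in> e" "head e \<in> e"
      using edge_ends[OF e] by blast+
    then have "x (tail e) \<in> l e" "x (head e) \<in> l e"
      by (auto intro: mem)
    then show ?thesis
      using wedge[OF e] span_pair_eqI unfolding ab by blast
  qed
  have "P = config_picture x"
    unfolding Ppl config_picture_def vec_picture_def
    using p l x(1) line by (auto simp: fun_eq_iff restrict_def PiE_def extensional_def)
  then show ?thesis
    using that[of x] x wedge by (auto simp: generic_config_def)
qed

text \<open>All vertices are placed at distinct points of one line. The facts about coordinates 0
  and 1 are what later keeps the auxiliary polynomial \<open>g\<close> in
  \<open>picture_space_reducible\<close> from vanishing on the whole picture space.\<close>

lemma generic_picture_exists:
  assumes inf: "infinite (UNIV :: 'a::field set)" and d: "0 < d"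
  obtains x :: "'v \<Rightarrow> nat \<Rightarrow> 'a::field" where "generic_config d x" "\<And>v. v \<in> V \<Longrightarrow> x v 0 = 1"
    "\<And>e. e \<in> E \<Longrightarrow> x (tail e) 1 \<noteq> x (head e) 1"
proof -
  obtain g :: "'v \<Rightarrow> 'a" where g: "inj_on g V"
    using finite_V inf by (metis finite_imp_inj_to_nat_seg infinite_countable_subset comp_inj_on
        inj_on_subset subset_UNIV)
  define x where "x v i = (if i = 0 then 1 else if i = 1 then g v else 0)" for v and i :: nat
  have ne: "x (tail e) 1 \<noteq> x (head e) 1" if "e \<in> E" for e
    using inj_on_eq_iff[OF g tail_in_V[OF that] head_in_V[OF that]] ends_distinct[OF that]
    by (simp add: x_def)
  have "x v \<noteq> 0" for v
    by (auto simp: x_def fun_eq_iff)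
  moreover have "wedge (x (tail e)) (x (head e)) 0 1 \<noteq> 0" if "e \<in> E" for e
    using ne[OF that] by (auto simp: wedge_def x_def)
  ultimately have "generic_config d x"
    using d by (auto simp: generic_config_def coordinate_space_def x_def)
  then show ?thesis
    using that[of x] ne by (auto simp: x_def)
qed

text \<open>The straight segment of vertex vectors from \<open>x\<close> to \<open>y\<close> works:
  \<open>T1\<close> and \<open>T2\<close> are the parameters at which the separating polynomials
  vanish, \<open>T3\<close> and \<open>T4\<close> those at which the configuration stops being
  generic. All are finite, as the end at t = 0 or the end at t = 1 shows.\<close>

lemma generic_pictures_irreducible:
  assumes inf: "infinite (UNIV :: 'a::field set)"
    and Z: "zariski_closed d V E Z1" "zariski_closed d V E Z2"
    and x: "generic_config d x" "config_picture x \<notin> Z1"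
    and y: "generic_config d y" "config_picture y \<notin> Z2"
  shows "\<exists>z :: 'v \<Rightarrow> nat \<Rightarrow> 'a::field. generic_config d z \<and> config_picture z \<notin> Z1 \<and> config_picture z \<notin> Z2"
proof -
  have ambient: "config_picture z \<in> ambient_space d V E" if "generic_config d z" for z :: "'v \<Rightarrow> nat \<Rightarrow> 'a"
    using config_picture_in_picture_space[OF that] picture_space_subset_ambient by auto
  obtain f where f: "multihomogeneous d V E f" "\<not> vanishes_at V E f (config_picture x)"
      "\<And>Q. Q \<in> Z1 \<Longrightarrow> vanishes_at V E f Q"
    using zariski_closed_separation[OF Z(1) ambient[OF x(1)] x(2)] by blast
  obtain g where g: "multihomogeneous d V E g" "\<not> vanishes_at V E g (config_picture y)"
      "\<And>Q. Q \<in> Z2 \<Longrightarrow> vanishes_at V E g Q"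
    using zariski_closed_separation[OF Z(2) ambient[OF y(1)] y(2)] by blast
  define \<alpha> where "\<alpha> v i = [:x v i, y v i - x v i:]" for v i
  define z where "z t v i = poly (\<alpha> v i) t" for t v i
  define X where "X = vec_coords \<alpha> (\<lambda>e. \<alpha> (tail e)) (\<lambda>e. \<alpha> (head e))"
  have X: "(\<lambda>c. poly (X c) t) = vec_coords (z t) (\<lambda>e. z t (tail e)) (\<lambda>e. z t (head e))" for t
    unfolding X_def poly_vec_coords z_def ..
  have z0: "z 0 = x" and z1: "z 1 = y"
    by (auto simp: z_def \<alpha>_def fun_eq_iff)
  have hc: "homogeneous_coordinates V E (config_picture (z t)) (\<lambda>c. poly (X c) t)" for t
    unfolding X config_picture_def by (rule homogeneous_coordinates_vec_picture)
  define T1 where "T1 = {t. mpoly_eval (\<lambda>c. poly (X c) t) f = 0}"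
  define T2 where "T2 = {t. mpoly_eval (\<lambda>c. poly (X c) t) g = 0}"
  define T3 where "T3 = (\<Union>v\<in>V. {t. (\<lambda>i. poly (\<alpha> v i) t) = 0})"
  define T4 where "T4 = (\<Union>e\<in>E. {t. \<forall>i j. wedge (\<lambda>i. poly (\<alpha> (tail e) i) t)
      (\<lambda>i. poly (\<alpha> (head e) i) t) i j = 0})"
  have "finite T1"
    unfolding T1_def
    by (rule finite_zeros_on_curve[OF finite_V finite_E f(1) ambient[OF x(1)] hc[of 0, unfolded z0] f(2)])
  moreover have "finite T2"
    unfolding T2_def
    by (rule finite_zeros_on_curve[OF finite_V finite_E g(1) ambient[OF y(1)] hc[of 1, unfolded z1] g(2)])
  moreover have "finite T3"
    unfolding T3_def
  proof (intro finite_UN_I finite_V finite_zero_on_curve)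
    fix v assume "v \<in> V"
    then show "(\<lambda>i. poly (\<alpha> v i) 0) \<noteq> 0"
      using x(1) by (simp add: \<alpha>_def generic_config_def)
  qed
  moreover have "finite T4"
    unfolding T4_def
  proof (intro finite_UN_I finite_E)
    fix e assume e: "e \<in> E"
    then obtain i j where "wedge (x (tail e)) (x (head e)) i j \<noteq> 0"
      using x(1) by (auto simp: generic_config_def)
    then show "finite {t. \<forall>i j. wedge (\<lambda>i. poly (\<alpha> (tail e) i) t) (\<lambda>i. poly (\<alpha> (head e) i) t) i j = 0}"
      by (intro finite_degenerate_on_curve[of _ 0]) (simp add: \<alpha>_def)
  qed
  ultimately obtain t where t: "t \<notin> T1 \<union> T2 \<union> T3 \<union> T4"
    using ex_new_if_finite[OF inf, of "T1 \<union> T2 \<union> T3 \<union> T4"] by auto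
  have "generic_config d (z t)"
    unfolding generic_config_def
  proof (intro conjI ballI)
    fix v assume v: "v \<in> V"
    show "z t v \<in> coordinate_space d"
      using x(1) y(1) v by (auto simp: z_def \<alpha>_def generic_config_def coordinate_space_def)
    show "z t v \<noteq> 0"
      using t v unfolding T3_def z_def by blast
  next
    fix e assume "e \<in> E"
    then show "\<exists>i j. wedge (z t (tail e)) (z t (head e)) i j \<noteq> 0"
      using t unfolding T4_def z_def by blast
  qed
  moreover have "config_picture (z t) \<notin> Z1"
    using f(3)[of "config_picture (z t)"] hc[of t] t unfolding vanishes_at_def T1_def by blast
  moreover have "config_picture (z t) \<notin> Z2"
    using g(3)[of "config_picture (z t)"] hc[of t] t unfolding vanishes_at_def T2_def by blast
  ultimately show ?thesis
    by blast
qed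

end

section \<open>Moving a picture so that fewer edges are collapsed\<close>

context oriented_graph
begin

lemma nontrivial_motion_exists:
  fixes u :: "'v set \<Rightarrow> nat \<Rightarrow> 'a::field" and i0 :: "'v \<Rightarrow> nat" and j0 :: "'v set \<Rightarrow> nat"
  assumes A: "A \<subseteq> E" "d * nullity acyclic_edges A < card A" and d: "0 < d"
    and i0: "\<And>v. v \<in> V \<Longrightarrow> i0 v \<le> d" "\<And>e. e \<in> A \<Longrightarrow> i0 (head e) = i0 (tail e)"
    and u: "\<And>e. e \<in> A \<Longrightarrow> u e \<in> coordinate_space d" "\<And>e. e \<in> A \<Longrightarrow> u e (i0 (tail e)) = 0"
      "\<And>e. e \<in> A \<Longrightarrow> u e (j0 e) \<noteq> 0" "\<And>e. e \<in> A \<Longrightarrow> j0 e \<le> d"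
  obtains x :: "'v \<Rightarrow> nat \<Rightarrow> 'a" where "\<And>v. x v \<in> coordinate_space d" "\<And>v. x v (i0 v) = 0"
    "\<And>e. e \<in> A \<Longrightarrow> \<exists>c. x (head e) = x (tail e) + vscale c (u e)"
    "\<exists>e\<in>A. x (head e) \<noteq> x (tail e)"
proof -
  have finA: "finite A" and cardA: "\<And>e. e \<in> A \<Longrightarrow> card e = 2"
    using A(1) finite_E finite_subset card_edge by auto
  obtain B where B: "B \<subseteq> A" "acyclic_edges B" "card B = matroid_rank acyclic_edges A"
    by (rule matroid_rank_attained[of A acyclic_edges, OF finA acyclic_edges_empty])
  have finB: "finite B"
    using B(1) finA finite_subset by auto
  have card: "card A = card B + nullity acyclic_edges A"
    using card_eq_matroid_rank_plus_nullity[of A acyclic_edges, OF finA acyclic_edges_empty] B(3)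
    by simp
  have "\<forall>b\<in>B. \<exists>\<phi> :: 'v \<Rightarrow> 'a. \<forall>b'\<in>B. \<phi> (head b') - \<phi> (tail b') = (if b' = b then 1 else 0)"
    using forest_potential[of B] B A by blast
  then obtain \<phi> :: "'v set \<Rightarrow> 'v \<Rightarrow> 'a" where \<phi>: "\<And>b b'. b \<in> B \<Longrightarrow> b' \<in> B
      \<Longrightarrow> \<phi> b (head b') - \<phi> b (tail b') = (if b' = b then 1 else 0)"
    by (auto dest!: bchoice)
  define I where "I = (SIGMA b:B. {..d} - {i0 (tail b)})"
  define K where "K = (SIGMA e:A. {..d} - {i0 (tail e), j0 e})"
  have "card ({..d} - {i0 (tail b)}) = d" if "b \<in> B" for b
    using i0(1)[of "tail b"] tail_in_V[of b] that B(1) A(1) by (auto simp: card_Diff_subset)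
  then have cardI: "card I = card B * d"
    unfolding I_def using finB by simp
  have "card ({..d} - {i0 (tail e), j0 e}) = d - 1" if "e \<in> A" for e
  proof -
    have "i0 (tail e) \<noteq> j0 e"
      using u(2,3)[OF that] by metis
    then show ?thesis
      using i0(1)[of "tail e"] tail_in_V[of e] u(4)[OF that] that A(1)
      by (auto simp: card_Diff_subset)
  qed
  then have cardK: "card K = card A * (d - 1)"
    unfolding K_def using finA by simp
  obtain d' where d': "d = Suc d'"
    using d by (cases d) auto
  \<comment> \<open>With \<open>card B\<close> the rank of \<open>A\<close>, this is a rearrangement
    of the assumption on the nullity.\<close>
  have cKI: "card K < card I"
    using A(2) card unfolding cardI cardK d' by (simp add: algebra_simps)
  have "finite I" "finite K"
    using finA finB by (auto simp: I_def K_def)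
  define N where "N i v j = (if snd i = j \<and> j \<noteq> i0 v then \<phi> (fst i) v else 0)" for i v j
  define M where "M i k = u (fst k) (j0 (fst k)) * (N i (head (fst k)) (snd k) - N i (tail (fst k)) (snd k))
      - u (fst k) (snd k) * (N i (head (fst k)) (j0 (fst k)) - N i (tail (fst k)) (j0 (fst k)))" for i k
  obtain z where z: "\<exists>i\<in>I. z i \<noteq> 0" "\<And>k. k \<in> K \<Longrightarrow> (\<Sum>i\<in>I. z i * M i k) = 0"
    using underdetermined_system_nontrivial_solution[OF \<open>finite K\<close> \<open>finite I\<close> cKI, of M] by blast
  define x where "x v j = (\<Sum>i\<in>I. z i * N i v j)" for v j
  define \<Delta> where "\<Delta> e j = x (head e) j - x (tail e) j" for e j
  have x_coord: "x v \<in> coordinate_space d" for v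
    by (auto simp: coordinate_space_def x_def N_def I_def intro!: sum.neutral)
  have x_i0: "x v (i0 v) = 0" for v
    by (auto simp: x_def N_def intro!: sum.neutral)
  have eq: "u e (j0 e) * \<Delta> e j = u e j * \<Delta> e (j0 e)" if "e \<in> A" "j \<le> d" "j \<noteq> i0 (tail e)" for e j
  proof (cases "j = j0 e")
    case False
    have "(\<Sum>i\<in>I. z i * M i (e, j)) = u e (j0 e) * \<Delta> e j - u e j * \<Delta> e (j0 e)"
      unfolding \<Delta>_def x_def M_def
      by (simp add: sum_subtractf sum_distrib_left right_diff_distrib mult_ac)
    then show ?thesis
      using z(2)[of "(e, j)"] that False by (auto simp: K_def)
  qed simp
  have \<Delta>: "\<Delta> e j = \<Delta> e (j0 e) / u e (j0 e) * u e j" if e: "e \<in> A" for e j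
  proof (cases "j \<le> d \<and> j \<noteq> i0 (tail e)")
    case True
    then show ?thesis
      using eq[OF e, of j] u(3)[OF e] by (simp add: field_simps)
  next
    case False
    then show ?thesis
      using x_i0[of "tail e"] x_i0[of "head e"] i0(2)[OF e] u(2)[OF e]
        x_coord[of "tail e"] x_coord[of "head e"] u(1)[OF e]
      by (auto simp: \<Delta>_def coordinate_space_def)
  qed
  have motion: "\<exists>c. x (head e) = x (tail e) + vscale c (u e)" if e: "e \<in> A" for e
  proof
    show "x (head e) = x (tail e) + vscale (\<Delta> e (j0 e) / u e (j0 e)) (u e)"
    proof
      fix j
      show "x (head e) j = (x (tail e) + vscale (\<Delta> e (j0 e) / u e (j0 e)) (u e)) j"
        using \<Delta>[OF e, of j] by (simp add: vscale_def \<Delta>_def[of e j] algebra_simps)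
    qed
  qed
  obtain b j where bj: "(b, j) \<in> I" "z (b, j) \<noteq> 0"
    using z(1) by auto
  have b: "b \<in> B" "j \<noteq> i0 (tail b)" "b \<in> A"
    using bj B(1) by (auto simp: I_def)
  \<comment> \<open>The potentials are dual to the forest edges, so the displacement of
    \<open>b\<close> returns the unknown \<open>z (b, j)\<close>: a nonzero solution really
    separates two ends.\<close>
  have "\<Delta> b j = (\<Sum>i\<in>I. z i * (N i (head b) j - N i (tail b) j))"
    by (simp add: \<Delta>_def x_def sum_subtractf right_diff_distrib)
  also have "\<dots> = (\<Sum>i\<in>I. if i = (b, j) then z i else 0)"
  proof (rule sum.cong)
    fix i assume "i \<in> I"
    then obtain b' j' where i: "i = (b', j')" "b' \<in> B"
      by (auto simp: I_def)
    show "z i * (N i (head b) j - N i (tail b) j) = (if i = (b, j) then z i else 0)"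
      using \<phi>[OF i(2) b(1)] b(2) i0(2)[OF b(3)] by (cases "b' = b") (auto simp: N_def i(1))
  qed simp
  also have "\<dots> = z (b, j)"
    using bj(1) \<open>finite I\<close> by simp
  finally have "\<Delta> b j \<noteq> 0"
    using bj by simp
  then have "x (head b) \<noteq> x (tail b)"
    by (auto simp: \<Delta>_def)
  then show ?thesis
    using that[of x] x_coord x_i0 motion b(3) by blast
qed

text \<open>Along \<open>x0 + t * x1\<close> the line at a collapsed edge keeps its direction
  \<open>u e\<close>, and every other line is spanned by the moving ends. Outside a finite set of
  parameters no further edge collapses, while a collapsed edge displaced by \<open>x1\<close> opens
  up.\<close>

lemma picture_uncollapse:
  fixes P :: "('v, 'a::field) picture"
  assumes d: "0 < d" and P: "P \<in> picture_space d V E"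
    and A: "d * nullity acyclic_edges (collapsed (fst P)) < card (collapsed (fst P))"
  obtains X :: "'v coord \<Rightarrow> 'a poly" and T where "finite T"
    "homogeneous_coordinates V E P (\<lambda>c. poly (X c) 0)"
    "\<And>t. t \<notin> T \<Longrightarrow> \<exists>Q\<in>picture_space d V E. homogeneous_coordinates V E Q (\<lambda>c. poly (X c) t)
      \<and> collapsed (fst Q) \<subset> collapsed (fst P)"
proof -
  obtain p l where Ppl: "P = (p, l)"
    by (cases P)
  have p: "p \<in> V \<rightarrow>\<^sub>E proj_points d" and l: "l \<in> E \<rightarrow>\<^sub>E proj_lines d"
    and inc: "\<And>e v. e \<in> E \<Longrightarrow> v \<in> e \<Longrightarrow> p v \<subseteq> l e"
    using P(1) unfolding Ppl picture_space_def ambient_space_def by auto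
  define A where "A = collapsed p"
  have AE: "A \<subseteq> E" and pA: "\<And>e. e \<in> A \<Longrightarrow> p (tail e) = p (head e)"
    and pnA: "\<And>e. e \<in> E \<Longrightarrow> e \<notin> A \<Longrightarrow> p (tail e) \<noteq> p (head e)"
    by (auto simp: A_def collapsed_def)
  \<comment> \<open>The representative and its nonzero coordinate are chosen for the projective
    point and not for the vertex, so that the ends of a collapsed edge get the same vector and the
    same frozen coordinate.\<close>
  have "\<forall>L\<in>(proj_points d :: (nat \<Rightarrow> 'a) set set). \<exists>a. \<exists>i. L = vec.span {a}
      \<and> a \<in> coordinate_space d \<and> a i \<noteq> 0 \<and> i \<le> d"
    by (meson proj_point_representative)
  from bchoice[OF this] obtain a :: "(nat \<Rightarrow> 'a) set \<Rightarrow> nat \<Rightarrow> 'a"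
    where "\<forall>L\<in>proj_points d. \<exists>i. L = vec.span {a L}
      \<and> a L \<in> coordinate_space d \<and> a L i \<noteq> 0 \<and> i \<le> d" ..
  from bchoice[OF this] obtain k where ak: "\<forall>L\<in>proj_points d. L = vec.span {a L}
      \<and> a L \<in> coordinate_space d \<and> a L (k L) \<noteq> 0 \<and> k L \<le> d" ..
  define x0 where "x0 v = a (p v)" for v
  define i0 where "i0 v = k (p v)" for v
  have x0: "p v = vec.span {x0 v}" "x0 v \<in> coordinate_space d" "x0 v (i0 v) \<noteq> 0" "i0 v \<le> d"
    if "v \<in> V" for v
    using bspec[OF ak, of "p v"] p that unfolding x0_def i0_def by auto
  have x0_ne: "x0 v \<noteq> 0" if "v \<in> V" for v
    using x0(3)[OF that] by auto
  have x0_mem: "x0 v \<in> l e" if "e \<in> E" "v \<in> e" for e v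
  proof -
    have "v \<in> V"
      using edge_subset[OF that(1)] that(2) by blast
    then have "x0 v \<in> p v"
      by (simp add: x0(1) vec.span_base)
    then show ?thesis
      using inc[OF that] by blast
  qed
  have ends: "tail e \<in> e" "head e \<in> e" if "e \<in> E" for e
    using edge_ends[OF that] by blast+
  have "\<exists>w j. l e = vec.span {x0 (tail e), w} \<and> w \<in> coordinate_space d \<and> w (i0 (tail e)) = 0
      \<and> w j \<noteq> 0 \<and> j \<le> d" if e: "e \<in> A" for e
  proof -
    have eE: "e \<in> E"
      using e AE by auto
    have "l e \<in> proj_lines d"
      using l eE by auto
    from proj_line_through_point[OF this x0_mem[OF eE ends(1)[OF eE]] x0(3)[OF tail_in_V[OF eE]]]
    show ?thesis by metis
  qed
  then have "\<forall>e\<in>A. \<exists>w. \<exists>j. l e = vec.span {x0 (tail e), w} \<and> w \<in> coordinate_space d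
      \<and> w (i0 (tail e)) = 0 \<and> w j \<noteq> 0 \<and> j \<le> d"
    by blast
  from bchoice[OF this] obtain u where "\<forall>e\<in>A. \<exists>j. l e = vec.span {x0 (tail e), u e}
      \<and> u e \<in> coordinate_space d \<and> u e (i0 (tail e)) = 0 \<and> u e j \<noteq> 0 \<and> j \<le> d" ..
  from bchoice[OF this] obtain j0 where "\<forall>e\<in>A. l e = vec.span {x0 (tail e), u e}
      \<and> u e \<in> coordinate_space d \<and> u e (i0 (tail e)) = 0 \<and> u e (j0 e) \<noteq> 0 \<and> j0 e \<le> d" ..
  then have u: "\<And>e. e \<in> A \<Longrightarrow> l e = vec.span {x0 (tail e), u e}"
      "\<And>e. e \<in> A \<Longrightarrow> u e \<in> coordinate_space d" "\<And>e. e \<in> A \<Longrightarrow> u e (i0 (tail e)) = 0"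
      "\<And>e. e \<in> A \<Longrightarrow> u e (j0 e) \<noteq> 0" "\<And>e. e \<in> A \<Longrightarrow> j0 e \<le> d"
    by blast+
  have i0A: "i0 (head e) = i0 (tail e)" and x0A: "x0 (head e) = x0 (tail e)" if "e \<in> A" for e
    using pA[OF that] by (auto simp: i0_def x0_def)
  have cardA: "d * nullity acyclic_edges A < card A"
    using A by (simp add: A_def Ppl)
  obtain x1 where x1: "\<And>v. x1 v \<in> coordinate_space d" "\<And>v. x1 v (i0 v) = 0"
    "\<And>e. e \<in> A \<Longrightarrow> \<exists>c. x1 (head e) = x1 (tail e) + vscale c (u e)"
    "\<exists>e\<in>A. x1 (head e) \<noteq> x1 (tail e)"
    using nontrivial_motion_exists[of A d i0 u j0, OF AE cardA d x0(4) i0A u(2-5)] by blast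
  define \<alpha> where "\<alpha> v i = [:x0 v i, x1 v i:]" for v i
  \<comment> \<open>The second generator of the line. At a collapsed edge the head coincides with
    the tail at t = 0, so the direction of the line takes its place.\<close>
  define \<gamma> where "\<gamma> e i = (if e \<in> A then [:u e i:] else \<alpha> (head e) i)" for e i
  define x where "x t v i = poly (\<alpha> v i) t" for t v i
  define g where "g t e i = poly (\<gamma> e i) t" for t e i
  define X where "X = vec_coords \<alpha> (\<lambda>e. \<alpha> (tail e)) \<gamma>"
  have X: "(\<lambda>c. poly (X c) t) = vec_coords (x t) (\<lambda>e. x t (tail e)) (g t)" for t
    unfolding X_def poly_vec_coords x_def g_def ..
  have x_eq: "x t v = x0 v + vscale t (x1 v)" for t v
    by (auto simp: x_def \<alpha>_def vscale_def fun_eq_iff)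
  have gA: "g t e = u e" if "e \<in> A" for t e
    using that by (auto simp: g_def \<gamma>_def fun_eq_iff)
  have gnA: "g t e = x t (head e)" if "e \<notin> A" for t e
    using that by (auto simp: g_def \<gamma>_def x_def fun_eq_iff)
  have x_zero: "x 0 = x0"
    by (auto simp: x_eq vscale_def fun_eq_iff)
  have wedge0: "\<exists>i j. wedge (x 0 (tail e)) (g 0 e) i j \<noteq> 0" and line0: "l e = vec.span {x0 (tail e), g 0 e}"
    if e: "e \<in> E" for e
  proof -
    have le: "l e \<in> proj_lines d"
      using l e by auto
    show "\<exists>i j. wedge (x 0 (tail e)) (g 0 e) i j \<noteq> 0"
    proof (cases "e \<in> A")
      case True
      have "vec.dim (vec.span {x0 (tail e), u e}) = 2"
        using le unfolding u(1)[OF True] by (simp add: proj_lines_def)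
      then show ?thesis
        unfolding dim_span_pair_iff gA[OF True] x_zero .
    next
      case False
      have "vec.span {x0 (tail e)} \<noteq> vec.span {x0 (head e)}"
        using pnA[OF e False] unfolding x0(1)[OF tail_in_V[OF e]] x0(1)[OF head_in_V[OF e]] .
      then show ?thesis
        unfolding gnA[OF False] x_zero
        using span_single_eq_iff_wedge[OF x0_ne[OF tail_in_V[OF e]] x0_ne[OF head_in_V[OF e]]] by blast
    qed
    show "l e = vec.span {x0 (tail e), g 0 e}"
    proof (cases "e \<in> A")
      case True
      then show ?thesis
        using u(1) gA by simp
    next
      case False
      obtain a b i j where ab: "l e = vec.span {a, b}"
        by (rule proj_line_representative[OF le])
      obtain i j where "wedge (x0 (tail e)) (x0 (head e)) i j \<noteq> 0"
        using \<open>\<exists>i j. wedge (x 0 (tail e)) (g 0 e) i j \<noteq> 0\<close> unfolding gnA[OF False] x_zero by blast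
      then show ?thesis
        using x0_mem[OF e ends(1)[OF e]] x0_mem[OF e ends(2)[OF e]] span_pair_eqI
        unfolding ab gnA[OF False] x_zero by blast
    qed
  qed
  \<comment> \<open>Excluded are t = 0, where nothing has moved, and the parameters at which a line
    degenerates; for an edge outside \<open>A\<close> these are exactly the parameters at which it
    would collapse.\<close>
  define T where "T = insert 0 (\<Union>e\<in>E. {t. \<forall>i j. wedge (\<lambda>i. poly (\<alpha> (tail e) i) t)
      (\<lambda>i. poly (\<gamma> e i) t) i j = 0})"
  show ?thesis
  proof (rule that[of T X])
    show "finite T"
      unfolding T_def finite_insert
    proof (intro finite_UN_I finite_E)
      fix e assume "e \<in> E"
      then obtain i j where "wedge (x 0 (tail e)) (g 0 e) i j \<noteq> 0"
        using wedge0 by blast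
      then show "finite {t. \<forall>i j. wedge (\<lambda>i. poly (\<alpha> (tail e) i) t) (\<lambda>i. poly (\<gamma> e i) t) i j = 0}"
        unfolding x_def g_def by (rule finite_degenerate_on_curve)
    qed
    show "homogeneous_coordinates V E P (\<lambda>c. poly (X c) 0)"
      unfolding X x_zero by (rule homogeneous_coordinates_vec_coords) (use x0(1) line0 Ppl in auto)
  next
    fix t assume t: "t \<notin> T"
    define Q where "Q = vec_picture V E (x t) (\<lambda>e. x t (tail e)) (g t)"
    have x_coord: "x t v \<in> coordinate_space d" if "v \<in> V" for v
      using x0(2)[OF that] x1(1)[of v] by (simp add: x_eq coordinate_space_def vscale_def)
    \<comment> \<open>No parameter has to be excluded for this: coordinate \<open>i0 v\<close> keeps
      its nonzero initial value.\<close>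
    have x_ne: "x t v \<noteq> 0" if "v \<in> V" for v
    proof -
      have "x t v (i0 v) \<noteq> 0"
        using x0(3)[OF that] x1(2)[of v] by (simp add: x_eq vscale_def)
      then show ?thesis by auto
    qed
    have wedge: "\<exists>i j. wedge (x t (tail e)) (g t e) i j \<noteq> 0" if "e \<in> E" for e
      using t that unfolding T_def x_def g_def by blast
    have move: "\<exists>c. x t (head e) = vscale 1 (x t (tail e)) + vscale c (g t e) \<and>
        (x1 (head e) \<noteq> x1 (tail e) \<longrightarrow> c \<noteq> 0)" if e: "e \<in> A" for e
    proof -
      obtain c where c: "x1 (head e) = x1 (tail e) + vscale c (u e)"
        using x1(3)[OF e] by blast
      have "x t (head e) = vscale 1 (x t (tail e)) + vscale (t * c) (g t e)"
        unfolding x_eq gA[OF e] x0A[OF e] c by (simp add: vscale_def fun_eq_iff algebra_simps)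
      moreover have "t * c \<noteq> 0" if "x1 (head e) \<noteq> x1 (tail e)"
        using that t c by (auto simp: T_def vscale_def fun_eq_iff)
      ultimately show ?thesis
        by blast
    qed
    have "Q \<in> picture_space d V E"
      unfolding Q_def
    proof (rule vec_picture_in_picture_space)
      fix e assume e: "e \<in> E"
      show "x t (tail e) \<in> coordinate_space d"
        using x_coord tail_in_V[OF e] by blast
      show "g t e \<in> coordinate_space d"
        using x_coord head_in_V[OF e] gA u(2) gnA by (cases "e \<in> A") simp_all
      fix v assume v: "v \<in> e"
      have "x t (head e) \<in> vec.span {x t (tail e), g t e}"
      proof (cases "e \<in> A")
        case True
        then show ?thesis
          unfolding span_pair_iff using move by blast
      next
        case False
        then show ?thesis
          unfolding gnA[OF False] by (intro vec.span_base) simp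
      qed
      moreover have "x t (tail e) \<in> vec.span {x t (tail e), g t e}"
        by (intro vec.span_base) simp
      moreover have "v = tail e \<or> v = head e"
        using edge_ends[OF e] v by blast
      ultimately show "v \<in> V \<and> x t v \<in> vec.span {x t (tail e), g t e}"
        using edge_subset[OF e] v by blast
    qed (use x_coord x_ne wedge in blast)+
    moreover have "homogeneous_coordinates V E Q (\<lambda>c. poly (X c) t)"
      unfolding X Q_def by (rule homogeneous_coordinates_vec_picture)
    moreover have Qp: "fst Q (tail e) = fst Q (head e) \<longleftrightarrow> (\<forall>i j. wedge (x t (tail e)) (x t (head e)) i j = 0)"
      if e: "e \<in> E" for e
      using span_single_eq_iff_wedge[OF x_ne[OF tail_in_V[OF e]] x_ne[OF head_in_V[OF e]]]
        tail_in_V[OF e] head_in_V[OF e] by (simp add: Q_def vec_picture_def)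
    have "collapsed (fst Q) \<subseteq> A"
    proof
      fix e assume "e \<in> collapsed (fst Q)"
      then have e: "e \<in> E" "\<forall>i j. wedge (x t (tail e)) (x t (head e)) i j = 0"
        using Qp by (auto simp: collapsed_def)
      then show "e \<in> A"
        using wedge[OF e(1)] gnA by metis
    qed
    moreover have "\<exists>e\<in>A. e \<notin> collapsed (fst Q)"
    proof -
      obtain e where e: "e \<in> A" "x1 (head e) \<noteq> x1 (tail e)"
        using x1(4) by blast
      have eE: "e \<in> E"
        using e AE by auto
      obtain c where c: "c \<noteq> 0" "x t (head e) = vscale 1 (x t (tail e)) + vscale c (g t e)"
        using move[OF e(1)] e(2) by blast
      obtain i j where w: "wedge (x t (tail e)) (g t e) i j \<noteq> 0"
        using wedge[OF eE] by blast
      have "wedge (x t (tail e)) (x t (head e)) i j = c * wedge (x t (tail e)) (g t e) i j"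
        unfolding c(2) by (simp add: wedge_def vscale_def algebra_simps)
      then have "wedge (x t (tail e)) (x t (head e)) i j \<noteq> 0"
        using c(1) w by simp
      then show ?thesis
        using Qp[OF eE] e(1) by (auto simp: collapsed_def)
    qed
    ultimately show "\<exists>Q\<in>picture_space d V E. homogeneous_coordinates V E Q (\<lambda>c. poly (X c) t)
      \<and> collapsed (fst Q) \<subset> collapsed (fst P)"
      by (auto simp: A_def Ppl)
  qed
qed

lemma picture_space_subset_if_generic:
  fixes Z :: "('v, 'a::field) picture set"
  assumes inf: "infinite (UNIV :: 'a set)" and d: "0 < d"
    and E: "\<And>A. A \<subseteq> E \<Longrightarrow> A \<noteq> {} \<Longrightarrow> d * nullity acyclic_edges A < card A"
    and Z: "zariski_closed d V E Z" "\<And>x. generic_config d x \<Longrightarrow> config_picture x \<in> Z"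
  shows "picture_space d V E \<subseteq> Z"
proof
  fix P :: "('v, 'a) picture" assume "P \<in> picture_space d V E"
  then show "P \<in> Z"
  proof (induction "card (collapsed (fst P))" arbitrary: P rule: less_induct)
    case less
    show ?case
    proof (cases "collapsed (fst P) = {}")
      case True
      then show ?thesis
        using generic_picture_has_config[OF less.prems] Z(2) by metis
    next
      case False
      have sub: "collapsed p \<subseteq> E" for p :: "'v \<Rightarrow> (nat \<Rightarrow> 'a) set"
        by (auto simp: collapsed_def)
      show ?thesis
      proof (rule picture_uncollapse[OF d less.prems E[OF sub False]])
        fix X :: "'v coord \<Rightarrow> 'a poly" and T
        assume T: "finite T" and X: "homogeneous_coordinates V E P (\<lambda>c. poly (X c) 0)"
          and step: "\<And>t. t \<notin> T \<Longrightarrow> \<exists>Q\<in>picture_space d V E.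
            homogeneous_coordinates V E Q (\<lambda>c. poly (X c) t) \<and> collapsed (fst Q) \<subset> collapsed (fst P)"
        show "P \<in> Z"
        proof (rule zariski_closed_curve_limit[OF inf finite_V finite_E Z(1) _ X T])
          show "P \<in> ambient_space d V E"
            using less.prems picture_space_subset_ambient by blast
          fix t assume "t \<notin> T"
          then obtain Q where Q: "Q \<in> picture_space d V E"
              "homogeneous_coordinates V E Q (\<lambda>c. poly (X c) t)"
              "collapsed (fst Q) \<subset> collapsed (fst P)"
            using step by blast
          have "card (collapsed (fst Q)) < card (collapsed (fst P))"
            using Q(3) finite_subset[OF sub finite_E] by (rule psubset_card_mono[rotated])
          then have "Q \<in> Z"
            using less.hyps Q(1) by blast
          then show "\<exists>Q\<in>Z. homogeneous_coordinates V E Q (\<lambda>c. poly (X c) t)"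
            using Q(2) by blast
        qed
      qed
    qed
  qed
qed

text \<open>By density, two closed sets that do not contain the picture space each miss some generic
  picture; then they miss a common one.\<close>

lemma picture_space_irreducible:
  assumes inf: "infinite (UNIV :: 'a::field set)" and d: "0 < d"
    and E: "\<And>A. A \<subseteq> E \<Longrightarrow> A \<noteq> {} \<Longrightarrow> d * nullity acyclic_edges A < card A"
  shows "zariski_irreducible d V E (picture_space d V E :: ('v, 'a) picture set)"
  unfolding zariski_irreducible_def
proof (intro conjI allI impI)
  obtain x :: "'v \<Rightarrow> nat \<Rightarrow> 'a" where "generic_config d x"
    by (rule generic_picture_exists[OF inf d])
  then show "(picture_space d V E :: ('v, 'a) picture set) \<noteq> {}"
    using config_picture_in_picture_space by blast
next
  fix Z1 Z2 :: "('v, 'a) picture set"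
  assume Z: "zariski_closed d V E Z1 \<and> zariski_closed d V E Z2 \<and> picture_space d V E \<subseteq> Z1 \<union> Z2"
  show "picture_space d V E \<subseteq> Z1 \<or> picture_space d V E \<subseteq> Z2"
  proof (rule ccontr)
    assume nsub: "\<not> ?thesis"
    obtain x where x: "generic_config d x" "config_picture x \<notin> Z1"
      using picture_space_subset_if_generic[OF inf d E, of Z1] Z nsub by blast
    obtain y where y: "generic_config d y" "config_picture y \<notin> Z2"
      using picture_space_subset_if_generic[OF inf d E, of Z2] Z nsub by blast
    obtain z where "generic_config d z" "config_picture z \<notin> Z1" "config_picture z \<notin> Z2"
      using generic_pictures_irreducible[OF inf _ _ x y] Z by blast
    then show False
      using Z config_picture_in_picture_space by blast
  qed
qed

end

section \<open>Homogeneous forms\<close>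

definition exponents :: "'i set \<Rightarrow> nat \<Rightarrow> ('i \<Rightarrow> nat) set" where
  "exponents Q n = {\<mu> \<in> Q \<rightarrow>\<^sub>E {..n}. sum \<mu> Q = n}"

text \<open>A function and not a formal polynomial: for counting it matters only that it lies in the
  span of the monomials of degree \<open>n\<close>.\<close>

definition is_form :: "'i set \<Rightarrow> nat \<Rightarrow> (('i \<Rightarrow> 'a::field) \<Rightarrow> 'a) \<Rightarrow> bool" where
  "is_form Q n g \<longleftrightarrow> (\<exists>h. \<forall>z. g z = (\<Sum>\<mu>\<in>exponents Q n. h \<mu> * (\<Prod>i\<in>Q. z i ^ \<mu> i)))"

lemma finite_exponents: "finite Q \<Longrightarrow> finite (exponents Q n)"
  unfolding exponents_def by (rule finite_subset[of _ "Q \<rightarrow>\<^sub>E {..n}"]) (auto intro: finite_PiE)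

text \<open>The exponent of one variable is determined by the others, whence
  \<open>card Q - 1\<close>. This saving of one decides the case of equality in the later
  count.\<close>

lemma card_exponents_le:
  assumes "finite Q" "Q \<noteq> {}"
  shows "card (exponents Q n) \<le> (n + 1) ^ (card Q - 1)"
proof -
  obtain q where q: "q \<in> Q"
    using assms by auto
  define Q' where "Q' = Q - {q}"
  have Q': "finite Q'" "card Q' = card Q - 1"
    using assms q by (auto simp: Q'_def)
  have "inj_on (\<lambda>\<mu>. restrict \<mu> Q') (exponents Q n)"
  proof (rule inj_onI)
    fix \<mu> \<nu> assume \<mu>: "\<mu> \<in> exponents Q n" and \<nu>: "\<nu> \<in> exponents Q n"
      and eq: "restrict \<mu> Q' = restrict \<nu> Q'"
    have eq': "\<mu> i = \<nu> i" if "i \<in> Q'" for i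
      using fun_cong[OF eq, of i] that by simp
    have "sum \<mu> Q = \<mu> q + sum \<mu> Q'" "sum \<nu> Q = \<nu> q + sum \<nu> Q'"
      unfolding Q'_def using assms q by (auto intro: sum.remove)
    moreover have "sum \<mu> Q' = sum \<nu> Q'"
      using eq' by (rule sum.cong[OF refl])
    ultimately have "\<mu> q = \<nu> q"
      using \<mu> \<nu> by (simp add: exponents_def)
    then show "\<mu> = \<nu>"
      using \<mu> \<nu> eq' by (intro PiE_ext[of \<mu> Q "\<lambda>_. {..n}" \<nu>]) (auto simp: exponents_def Q'_def)
  qed
  moreover have "(\<lambda>\<mu>. restrict \<mu> Q') ` exponents Q n \<subseteq> Q' \<rightarrow>\<^sub>E {..n}"
  proof (intro image_subsetI)
    fix \<mu> assume "\<mu> \<in> exponents Q n"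
    then have "\<mu> \<in> Q \<rightarrow>\<^sub>E {..n}"
      by (simp add: exponents_def)
    then show "restrict \<mu> Q' \<in> Q' \<rightarrow>\<^sub>E {..n}"
      unfolding restrict_PiE_iff Q'_def by (blast dest: PiE_mem)
  qed
  ultimately have "card (exponents Q n) \<le> card (Q' \<rightarrow>\<^sub>E {..n})"
    using Q'(1) by (intro card_inj_on_le) (auto intro: finite_PiE)
  then show ?thesis
    using Q' by (simp add: card_funcsetE)
qed

lemma is_form_one: "is_form Q 0 (\<lambda>z. 1)" if "finite Q"
proof -
  have "exponents Q 0 = {\<lambda>i\<in>Q. 0}"
    by (auto simp: exponents_def PiE_def extensional_def Pi_def fun_eq_iff)
  then show ?thesis
    unfolding is_form_def by (intro exI[of _ "\<lambda>_. 1"]) simp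
qed

lemma is_form_add: "is_form Q n g \<Longrightarrow> is_form Q n g' \<Longrightarrow> is_form Q n (\<lambda>z. g z + g' z)"
  unfolding is_form_def
proof (elim exE)
  fix h h' assume "\<forall>z. g z = (\<Sum>\<mu>\<in>exponents Q n. h \<mu> * (\<Prod>i\<in>Q. z i ^ \<mu> i))"
    "\<forall>z. g' z = (\<Sum>\<mu>\<in>exponents Q n. h' \<mu> * (\<Prod>i\<in>Q. z i ^ \<mu> i))"
  then show "\<exists>h. \<forall>z. g z + g' z = (\<Sum>\<mu>\<in>exponents Q n. h \<mu> * (\<Prod>i\<in>Q. z i ^ \<mu> i))"
    by (intro exI[of _ "\<lambda>\<mu>. h \<mu> + h' \<mu>"]) (simp add: distrib_right sum.distrib)
qed

lemma is_form_zero: "is_form Q n (\<lambda>z. 0)"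
  unfolding is_form_def by (intro exI[of _ "\<lambda>_. 0"]) simp

lemma is_form_scale: "is_form Q n g \<Longrightarrow> is_form Q n (\<lambda>z. c * g z)"
  unfolding is_form_def
proof (elim exE)
  fix h assume "\<forall>z. g z = (\<Sum>\<mu>\<in>exponents Q n. h \<mu> * (\<Prod>i\<in>Q. z i ^ \<mu> i))"
  then show "\<exists>h. \<forall>z. c * g z = (\<Sum>\<mu>\<in>exponents Q n. h \<mu> * (\<Prod>i\<in>Q. z i ^ \<mu> i))"
    by (intro exI[of _ "\<lambda>\<mu>. c * h \<mu>"]) (simp add: sum_distrib_left mult_ac)
qed

lemma is_form_mult_variable:
  assumes Q: "finite Q" "q \<in> Q" and g: "is_form Q n g"
  shows "is_form Q (Suc n) (\<lambda>z. z q * g z)"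
proof -
  obtain h where h: "\<And>z. g z = (\<Sum>\<mu>\<in>exponents Q n. h \<mu> * (\<Prod>i\<in>Q. z i ^ \<mu> i))"
    using g by (auto simp: is_form_def)
  define s where "s \<mu> = \<mu>(q := Suc (\<mu> q))" for \<mu> :: "_ \<Rightarrow> nat"
  define p where "p \<mu> = \<mu>(q := \<mu> q - 1)" for \<mu> :: "_ \<Rightarrow> nat"
  have ps: "p (s \<mu>) = \<mu>" for \<mu>
    by (auto simp: p_def s_def)
  then have inj: "inj_on s S" for S
    by (metis inj_onI)
  have sum_s: "sum (s \<mu>) Q = Suc (sum \<mu> Q)" for \<mu>
  proof -
    have "sum (s \<mu>) (Q - {q}) = sum \<mu> (Q - {q})"
      by (rule sum.cong) (auto simp: s_def)
    then show ?thesis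
      using sum.remove[OF Q, of "s \<mu>"] sum.remove[OF Q, of \<mu>] by (simp add: s_def)
  qed
  have "s \<mu> \<in> exponents Q (Suc n)" if "\<mu> \<in> exponents Q n" for \<mu>
    using that sum_s[of \<mu>] Q(2) unfolding exponents_def s_def
    by (auto simp: PiE_def extensional_def Pi_def le_Suc_eq)
  then have sub: "s ` exponents Q n \<subseteq> exponents Q (Suc n)"
    by auto
  have prod_s: "(\<Prod>i\<in>Q. z i ^ s \<mu> i) = z q * (\<Prod>i\<in>Q. z i ^ \<mu> i)" for z \<mu>
  proof -
    have "(\<Prod>i\<in>Q - {q}. z i ^ s \<mu> i) = (\<Prod>i\<in>Q - {q}. z i ^ \<mu> i)"
      by (rule prod.cong) (auto simp: s_def)
    then show ?thesis
      using prod.remove[OF Q, of "\<lambda>i. z i ^ s \<mu> i"] prod.remove[OF Q, of "\<lambda>i. z i ^ \<mu> i"]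
      by (simp add: s_def mult_ac)
  qed
  define h' where "h' \<nu> = (if \<nu> \<in> s ` exponents Q n then h (p \<nu>) else 0)" for \<nu>
  have "z q * g z = (\<Sum>\<nu>\<in>exponents Q (Suc n). h' \<nu> * (\<Prod>i\<in>Q. z i ^ \<nu> i))" for z
  proof -
    have "(\<Sum>\<nu>\<in>exponents Q (Suc n). h' \<nu> * (\<Prod>i\<in>Q. z i ^ \<nu> i))
        = (\<Sum>\<nu>\<in>s ` exponents Q n. h (p \<nu>) * (\<Prod>i\<in>Q. z i ^ \<nu> i))"
      by (rule sum.mono_neutral_cong_right) (use sub finite_exponents[OF Q(1)] in \<open>auto simp: h'_def\<close>)
    also have "\<dots> = (\<Sum>\<mu>\<in>exponents Q n. h \<mu> * (z q * (\<Prod>i\<in>Q. z i ^ \<mu> i)))"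
      by (subst sum.reindex[OF inj]) (simp add: ps prod_s)
    also have "\<dots> = z q * g z"
      by (simp add: h sum_distrib_left mult_ac)
    finally show ?thesis by simp
  qed
  then show ?thesis
    unfolding is_form_def by blast
qed

lemma is_form_mult_linear:
  assumes Q: "finite Q" and g: "is_form Q n g"
  shows "is_form Q (Suc n) (\<lambda>z. (\<Sum>i\<in>Q. l i * z i) * g z)"
proof -
  have "is_form Q (Suc n) (\<lambda>z. \<Sum>i\<in>S. l i * (z i * g z))" if "S \<subseteq> Q" for S
    using finite_subset[OF that Q] that
  proof (induction S rule: finite_induct)
    case (insert i S)
    then show ?case
      using is_form_add[OF is_form_scale[OF is_form_mult_variable[OF Q _ g]] insert.IH, of i "l i"] by simp
  qed (simp add: is_form_zero)
  from this[of Q] show ?thesis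
    by (simp add: sum_distrib_right mult.assoc)
qed

lemma is_form_prod_linear:
  fixes l :: "'p \<Rightarrow> 'i \<Rightarrow> 'a::field"
  assumes Q: "finite Q" and C: "finite C"
  shows "is_form Q (\<Sum>p\<in>C. k p) (\<lambda>z. \<Prod>p\<in>C. (\<Sum>i\<in>Q. l p i * z i) ^ k p)"
  using C
proof (induction C rule: finite_induct)
  case (insert p C)
  have "is_form Q (m + (\<Sum>p\<in>C. k p))
      (\<lambda>z. (\<Sum>i\<in>Q. l p i * z i) ^ m * (\<Prod>p\<in>C. (\<Sum>i\<in>Q. l p i * z i) ^ k p))" for m
  proof (induction m)
    case (Suc m)
    from is_form_mult_linear[OF Q this, of "l p"] show ?case
      by (simp add: mult.assoc)
  qed (use insert.IH in simp)
  then show ?case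
    using insert.hyps by simp
qed (simp add: is_form_one[OF Q])

text \<open>More forms than monomials: a dependency between the coefficient vectors is one between
  the forms.\<close>

lemma forms_dependent:
  fixes g :: "'k \<Rightarrow> ('i \<Rightarrow> 'a::field) \<Rightarrow> 'a"
  assumes "finite Q" "finite K" "\<And>\<kappa>. \<kappa> \<in> K \<Longrightarrow> is_form Q n (g \<kappa>)" "card (exponents Q n) < card K"
  obtains c where "\<exists>\<kappa>\<in>K. c \<kappa> \<noteq> 0" "\<And>z. (\<Sum>\<kappa>\<in>K. c \<kappa> * g \<kappa> z) = 0"
proof -
  have "\<forall>\<kappa>\<in>K. \<exists>h. \<forall>z. g \<kappa> z = (\<Sum>\<mu>\<in>exponents Q n. h \<mu> * (\<Prod>i\<in>Q. z i ^ \<mu> i))"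
    using assms(3) by (simp add: is_form_def)
  from bchoice[OF this] obtain h where
    h: "\<forall>\<kappa>\<in>K. \<forall>z. g \<kappa> z = (\<Sum>\<mu>\<in>exponents Q n. h \<kappa> \<mu> * (\<Prod>i\<in>Q. z i ^ \<mu> i))" ..
  obtain c where c: "\<exists>\<kappa>\<in>K. c \<kappa> \<noteq> 0" "\<And>\<mu>. \<mu> \<in> exponents Q n \<Longrightarrow> (\<Sum>\<kappa>\<in>K. c \<kappa> * h \<kappa> \<mu>) = 0"
    using underdetermined_system_nontrivial_solution[OF finite_exponents[OF assms(1)] assms(2,4), of h]
    by blast
  have "(\<Sum>\<kappa>\<in>K. c \<kappa> * g \<kappa> z) = 0" for z
  proof -
    have "(\<Sum>\<kappa>\<in>K. c \<kappa> * g \<kappa> z)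
        = (\<Sum>\<kappa>\<in>K. \<Sum>\<mu>\<in>exponents Q n. c \<kappa> * h \<kappa> \<mu> * (\<Prod>i\<in>Q. z i ^ \<mu> i))"
      using h by (intro sum.cong refl) (simp add: sum_distrib_left mult.assoc)
    also have "\<dots> = (\<Sum>\<mu>\<in>exponents Q n. (\<Sum>\<kappa>\<in>K. c \<kappa> * h \<kappa> \<mu>) * (\<Prod>i\<in>Q. z i ^ \<mu> i))"
      unfolding sum_distrib_right by (rule sum.swap)
    also have "\<dots> = 0"
      using c(2) by simp
    finally show ?thesis .
  qed
  then show ?thesis
    using that c(1) by blast
qed


section \<open>Multihomogeneous polynomials\<close>

lemma homogeneous_in_mult:
  assumes "homogeneous_in X f" "homogeneous_in X g"
  shows "homogeneous_in X (f * g)"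
proof -
  obtain n n' where n: "\<forall>m\<in>Poly_Mapping.keys f. (\<Sum>c\<in>X. Poly_Mapping.lookup m c) = n"
    "\<forall>m\<in>Poly_Mapping.keys g. (\<Sum>c\<in>X. Poly_Mapping.lookup m c) = n'"
    using assms by (auto simp: homogeneous_in_def)
  have "(\<Sum>c\<in>X. Poly_Mapping.lookup m c) = n + n'" if "m \<in> Poly_Mapping.keys (f * g)" for m
  proof -
    have "m \<in> {a + b |a b. a \<in> Poly_Mapping.keys f \<and> b \<in> Poly_Mapping.keys g}"
      using that keys_mult by blast
    then show ?thesis
      using n by (auto simp: lookup_add sum.distrib)
  qed
  then show ?thesis
    by (auto simp: homogeneous_in_def)
qed

lemma multihomogeneous_mult:
  assumes f: "multihomogeneous d V E f" and g: "multihomogeneous d V E g"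
  shows "multihomogeneous d V E (f * g)"
proof -
  have "Poly_Mapping.keys m \<subseteq> (\<Union>v\<in>V. point_coords d v) \<union> (\<Union>e\<in>E. line_coords d e)"
    if m: "m \<in> Poly_Mapping.keys (f * g)" for m
  proof -
    have "m \<in> {a + b |a b. a \<in> Poly_Mapping.keys f \<and> b \<in> Poly_Mapping.keys g}"
      using m keys_mult by blast
    then obtain a b where ab: "m = a + b" "a \<in> Poly_Mapping.keys f" "b \<in> Poly_Mapping.keys g"
      by auto
    have "Poly_Mapping.keys m \<subseteq> Poly_Mapping.keys a \<union> Poly_Mapping.keys b"
      unfolding ab(1) by (rule keys_add)
    also have "\<dots> \<subseteq> (\<Union>v\<in>V. point_coords d v) \<union> (\<Union>e\<in>E. line_coords d e)"
      using f g ab(2,3) unfolding multihomogeneous_def by (intro Un_least) simp_all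
    finally show ?thesis .
  qed
  moreover have "homogeneous_in (point_coords d v) (f * g)" if "v \<in> V" for v
    using f g that by (intro homogeneous_in_mult) (simp_all add: multihomogeneous_def)
  moreover have "homogeneous_in (line_coords d e) (f * g)" if "e \<in> E" for e
    using f g that by (intro homogeneous_in_mult) (simp_all add: multihomogeneous_def)
  ultimately show ?thesis
    unfolding multihomogeneous_def by blast
qed

lemma multihomogeneous_one: "multihomogeneous d V E (1 :: ('v coord, 'a::comm_ring_1) mpoly)"
  by (auto simp: multihomogeneous_def homogeneous_in_def)

lemma multihomogeneous_prod:
  fixes f :: "'i \<Rightarrow> ('v coord, 'a::comm_ring_1) mpoly"
  shows "(\<And>i. i \<in> I \<Longrightarrow> multihomogeneous d V E (f i)) \<Longrightarrow> multihomogeneous d V E (\<Prod>i\<in>I. f i)"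
  by (induction I rule: infinite_finite_induct) (auto simp: multihomogeneous_one multihomogeneous_mult)

definition point_var :: "'v \<Rightarrow> nat \<Rightarrow> 'v coord \<Rightarrow>\<^sub>0 nat" where
  "point_var v i = Poly_Mapping.single (Point_Coord v i) 1"

text \<open>This and \<open>first_minor\<close> single out pictures to be set aside: a vertex
  outside the affine chart of coordinate 0, or two vertices of the chart that agree in affine
  coordinate 1.\<close>

definition first_coord :: "'v \<Rightarrow> ('v coord, 'a::comm_ring_1) mpoly" where
  "first_coord v = Poly_Mapping.single (point_var v 0) 1"

definition first_minor :: "'v \<Rightarrow> 'v \<Rightarrow> ('v coord, 'a::comm_ring_1) mpoly" where
  "first_minor v w = Poly_Mapping.single (point_var v 0 + point_var w 1) 1
     + Poly_Mapping.single (point_var v 1 + point_var w 0) (- 1)"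

lemma monomial_eval_single: "monomial_eval x (Poly_Mapping.single c k) = x c ^ k"
  by (simp add: monomial_eval_superset[of "{c}"])

lemma mpoly_eval_first_coord: "mpoly_eval x (first_coord v) = x (Point_Coord v 0)"
  by (simp add: first_coord_def point_var_def mpoly_eval_single monomial_eval_single)

lemma mpoly_eval_first_minor:
  "mpoly_eval x (first_minor v w)
    = x (Point_Coord v 0) * x (Point_Coord w 1) - x (Point_Coord v 1) * x (Point_Coord w 0)"
  by (simp add: first_minor_def point_var_def mpoly_eval_add mpoly_eval_single monomial_eval_add
      monomial_eval_single)

lemma sum_lookup_point_var:
  assumes "finite X"
  shows "(\<Sum>c\<in>X. Poly_Mapping.lookup (point_var v i) c) = (if Point_Coord v i \<in> X then 1 else 0)"
proof -
  have "(\<Sum>c\<in>X. Poly_Mapping.lookup (point_var v i) c) = (\<Sum>c\<in>X. if c = Point_Coord v i then 1 else 0)"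
    by (rule sum.cong) (auto simp: point_var_def lookup_single when_def)
  then show ?thesis
    using assms by simp
qed

lemma multihomogeneous_first_coord:
  assumes "v \<in> V"
  shows "multihomogeneous d V E (first_coord v :: ('v coord, 'a::comm_ring_1) mpoly)"
proof -
  have keys: "Poly_Mapping.keys (first_coord v :: ('v coord, 'a) mpoly) \<subseteq> {point_var v 0}"
    by (simp add: first_coord_def)
  moreover have "Poly_Mapping.keys (point_var v 0) \<subseteq> point_coords d v"
    by (auto simp: point_var_def point_coords_def)
  ultimately show ?thesis
    using assms unfolding multihomogeneous_def homogeneous_in_def by blast
qed

lemma multihomogeneous_first_minor:
  assumes "v \<in> V" "w \<in> V" "0 < d"
  shows "multihomogeneous d V E (first_minor v w :: ('v coord, 'a::comm_ring_1) mpoly)"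
proof -
  let ?m1 = "point_var v 0 + point_var w 1" and ?m2 = "point_var v 1 + point_var w 0"
  have "Poly_Mapping.keys (first_minor v w :: ('v coord, 'a) mpoly)
      \<subseteq> Poly_Mapping.keys (Poly_Mapping.single ?m1 (1 :: 'a))
        \<union> Poly_Mapping.keys (Poly_Mapping.single ?m2 (- 1 :: 'a))"
    unfolding first_minor_def by (rule keys_add)
  also have "\<dots> \<subseteq> {?m1, ?m2}"
    by simp
  finally have keys: "Poly_Mapping.keys (first_minor v w :: ('v coord, 'a) mpoly) \<subseteq> {?m1, ?m2}" .
  have kp: "Poly_Mapping.keys (point_var u i) \<subseteq> (\<Union>v\<in>V. point_coords d v)" if "u \<in> V" "i \<le> 1" for u i
    using that assms(3) by (auto simp: point_var_def point_coords_def)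
  have "Poly_Mapping.keys (point_var u i + point_var u' i') \<subseteq> (\<Union>v\<in>V. point_coords d v)"
    if "u \<in> V" "i \<le> 1" "u' \<in> V" "i' \<le> 1" for u u' i i'
    by (rule order_trans[OF keys_add Un_least[OF kp[OF that(1,2)] kp[OF that(3,4)]]])
  then have km: "Poly_Mapping.keys m \<subseteq> (\<Union>v\<in>V. point_coords d v)" if "m \<in> {?m1, ?m2}" for m
    using assms(1,2) that by force
  have hom: "homogeneous_in X (first_minor v w :: ('v coord, 'a) mpoly)"
    if X: "X = point_coords d u \<or> X = line_coords d e" for X u e
  proof -
    have "finite X"
      using X finite_point_coords finite_line_coords by auto
    then have eq: "(\<Sum>c\<in>X. Poly_Mapping.lookup ?m1 c) = (\<Sum>c\<in>X. Poly_Mapping.lookup ?m2 c)"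
      using X assms(3)
      by (auto simp: lookup_add sum.distrib sum_lookup_point_var point_coords_def line_coords_def)
    show ?thesis
      unfolding homogeneous_in_def
    proof (intro exI ballI)
      fix m assume "m \<in> Poly_Mapping.keys (first_minor v w :: ('v coord, 'a) mpoly)"
      then have "m = ?m1 \<or> m = ?m2"
        using keys by auto
      then show "(\<Sum>c\<in>X. Poly_Mapping.lookup m c) = (\<Sum>c\<in>X. Poly_Mapping.lookup ?m1 c)"
        using eq by metis
    qed
  qed
  show ?thesis
    unfolding multihomogeneous_def
  proof (intro conjI ballI)
    fix m assume "m \<in> Poly_Mapping.keys (first_minor v w :: ('v coord, 'a) mpoly)"
    then show "Poly_Mapping.keys m \<subseteq> (\<Union>v\<in>V. point_coords d v) \<union> (\<Union>e\<in>E. line_coords d e)"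
      using km keys by (intro le_supI1) (rule km, rule subsetD)
  qed (use hom in blast)+
qed

section \<open>Polynomials in the slopes\<close>

text \<open>\<open>\<kappa>\<close> holds the free exponents of coordinates 2 to d, and coordinate 1
  homogenizes: it takes what is missing to degree \<open>(d - 1) * n\<close>. The truncated
  subtraction is exact when each of the d - 1 free exponents is at most \<open>n\<close>.\<close>

definition slope_exponent :: "nat \<Rightarrow> nat \<Rightarrow> ('v set \<times> nat \<Rightarrow> nat) \<Rightarrow> 'v set \<times> nat \<Rightarrow> nat" where
  "slope_exponent d n \<kappa> p
    = (if snd p = 1 then (d - 1) * n - (\<Sum>j=2..d. \<kappa> (fst p, j)) else \<kappa> p)"

text \<open>If two points of a line have coordinate 0 equal to 1, the Pluecker coordinates (0, j)
  are the entries of their displacement. So these coordinates give the direction of the line in the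
  affine chart, up to a factor.\<close>

definition slope_monomial ::
  "'v set set \<Rightarrow> nat \<Rightarrow> nat \<Rightarrow> ('v set \<times> nat \<Rightarrow> nat) \<Rightarrow> 'v coord \<Rightarrow>\<^sub>0 nat"
where
  "slope_monomial A d n \<kappa> = (\<Sum>p\<in>A \<times> {1..d}.
     Poly_Mapping.single (Line_Coord (fst p) 0 (snd p)) (slope_exponent d n \<kappa> p))"

definition slope_polynomial ::
  "'v set set \<Rightarrow> nat \<Rightarrow> nat \<Rightarrow> (('v set \<times> nat \<Rightarrow> nat) \<Rightarrow> 'a::comm_ring_1) \<Rightarrow> ('v coord, 'a) mpoly"
where
  "slope_polynomial A d n c
    = (\<Sum>\<kappa>\<in>A \<times> {2..d} \<rightarrow>\<^sub>E {..n}. Poly_Mapping.single (slope_monomial A d n \<kappa>) (c \<kappa>))"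

lemma sum_slope_exponent:
  assumes "0 < d" "\<And>j. j \<in> {2..d} \<Longrightarrow> \<kappa> (e, j) \<le> n"
  shows "(\<Sum>j=1..d. slope_exponent d n \<kappa> (e, j)) = (d - 1) * n"
proof -
  have "{1..d} = insert 1 {2..d}"
    using assms(1) by auto
  then have "(\<Sum>j=1..d. slope_exponent d n \<kappa> (e, j))
      = (d - 1) * n - (\<Sum>j=2..d. \<kappa> (e, j)) + (\<Sum>j=2..d. slope_exponent d n \<kappa> (e, j))"
    by (simp add: slope_exponent_def)
  also have "(\<Sum>j=2..d. slope_exponent d n \<kappa> (e, j)) = (\<Sum>j=2..d. \<kappa> (e, j))"
    by (rule sum.cong) (auto simp: slope_exponent_def)
  also have "(\<Sum>j=2..d. \<kappa> (e, j)) \<le> (d - 1) * n"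
    using sum_bounded_above[of "{2..d}" "\<lambda>j. \<kappa> (e, j)" n] assms(2) by simp
  then have "(d - 1) * n - (\<Sum>j=2..d. \<kappa> (e, j)) + (\<Sum>j=2..d. \<kappa> (e, j)) = (d - 1) * n"
    by simp
  finally show ?thesis .
qed

lemma monomial_eval_zero [simp]: "monomial_eval x 0 = 1"
  by (simp add: monomial_eval_def)

lemma monomial_eval_sum: "monomial_eval x (\<Sum>i\<in>I. m i) = (\<Prod>i\<in>I. monomial_eval x (m i))"
  by (induction I rule: infinite_finite_induct) (auto simp: monomial_eval_add)

lemma mpoly_eval_slope_polynomial:
  "mpoly_eval x (slope_polynomial A d n c) = (\<Sum>\<kappa>\<in>A \<times> {2..d} \<rightarrow>\<^sub>E {..n}.
     c \<kappa> * (\<Prod>p\<in>A \<times> {1..d}. x (Line_Coord (fst p) 0 (snd p)) ^ slope_exponent d n \<kappa> p))"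
  by (simp add: slope_polynomial_def slope_monomial_def mpoly_eval_sum mpoly_eval_single
      monomial_eval_sum monomial_eval_single)

lemma sum_lookup_sum_single:
  assumes "finite X" "finite C"
  shows "(\<Sum>c\<in>X. Poly_Mapping.lookup (\<Sum>p\<in>C. Poly_Mapping.single (g p) (k p)) c)
    = (\<Sum>p\<in>C. if g p \<in> X then k p else (0 :: nat))"
proof -
  have "(\<Sum>c\<in>X. Poly_Mapping.lookup (\<Sum>p\<in>C. Poly_Mapping.single (g p) (k p)) c)
      = (\<Sum>p\<in>C. \<Sum>c\<in>X. Poly_Mapping.lookup (Poly_Mapping.single (g p) (k p)) c)"
    unfolding lookup_sum by (rule sum.swap)
  also have "\<dots> = (\<Sum>p\<in>C. \<Sum>c\<in>X. if c = g p then k p else 0)"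
    by (intro sum.cong refl) (auto simp: lookup_single when_def)
  also have "\<dots> = (\<Sum>p\<in>C. if g p \<in> X then k p else 0)"
    using assms(1) by simp
  finally show ?thesis .
qed

lemma multihomogeneous_slope_polynomial:
  fixes c :: "('v set \<times> nat \<Rightarrow> nat) \<Rightarrow> 'a::comm_ring_1"
  assumes d: "0 < d" and A: "finite A" "A \<subseteq> E"
  shows "multihomogeneous d V E (slope_polynomial A d n c)"
proof -
  let ?K = "A \<times> {2..d} \<rightarrow>\<^sub>E {..n}"
  have keys: "\<exists>\<kappa>\<in>?K. m = slope_monomial A d n \<kappa>"
    if "m \<in> Poly_Mapping.keys (slope_polynomial A d n c)" for m
  proof -
    have "m \<in> (\<Union>\<kappa>\<in>?K. Poly_Mapping.keys (Poly_Mapping.single (slope_monomial A d n \<kappa>) (c \<kappa>)))"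
      using subsetD[OF keys_sum] that unfolding slope_polynomial_def .
    then show ?thesis
      by (auto split: if_splits)
  qed
  have lookup_point: "(\<Sum>c\<in>point_coords d v. Poly_Mapping.lookup (slope_monomial A d n \<kappa>) c) = 0" for v \<kappa>
    unfolding slope_monomial_def
    using A(1) by (subst sum_lookup_sum_single[OF finite_point_coords]) (auto simp: point_coords_def)
  have lookup_line: "(\<Sum>c\<in>line_coords d e. Poly_Mapping.lookup (slope_monomial A d n \<kappa>) c)
      = (if e \<in> A then (d - 1) * n else 0)" if \<kappa>: "\<kappa> \<in> ?K" for e \<kappa>
  proof -
    have "(\<Sum>c\<in>line_coords d e. Poly_Mapping.lookup (slope_monomial A d n \<kappa>) c)
        = (\<Sum>p\<in>A \<times> {1..d}. if fst p = e then slope_exponent d n \<kappa> p else 0)"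
      unfolding slope_monomial_def using A(1)
      by (subst sum_lookup_sum_single[OF finite_line_coords])
        (auto simp: line_coords_def intro!: sum.cong)
    also have "\<dots> = (\<Sum>e'\<in>A. \<Sum>j=1..d. if e' = e then slope_exponent d n \<kappa> (e', j) else 0)"
      unfolding sum.cartesian_product
    proof (intro sum.cong refl)
      fix p :: "'v set \<times> nat"
      show "(if fst p = e then slope_exponent d n \<kappa> p else 0)
          = (case p of (e', j) \<Rightarrow> if e' = e then slope_exponent d n \<kappa> (e', j) else 0)"
        by (cases p) simp
    qed
    also have "\<dots> = (\<Sum>e'\<in>A. if e' = e then (\<Sum>j=1..d. slope_exponent d n \<kappa> (e', j)) else 0)"
      by (intro sum.cong) auto
    also have "\<dots> = (if e \<in> A then (\<Sum>j=1..d. slope_exponent d n \<kappa> (e, j)) else 0)"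
      using A(1) by simp
    also have "\<dots> = (if e \<in> A then (d - 1) * n else 0)"
    proof -
      have "\<kappa> (e, j) \<le> n" if "e \<in> A" "j \<in> {2..d}" for j
        using PiE_mem[OF \<kappa>, of "(e, j)"] that by simp
      then show ?thesis
        using sum_slope_exponent[OF d, of \<kappa> e n] by (cases "e \<in> A") simp_all
    qed
    finally show ?thesis .
  qed
  have "Poly_Mapping.keys (slope_monomial A d n \<kappa>) \<subseteq> (\<Union>e\<in>E. line_coords d e)" for \<kappa>
  proof -
    have "Poly_Mapping.keys (slope_monomial A d n \<kappa>) \<subseteq> (\<Union>p\<in>A \<times> {1..d}. {Line_Coord (fst p) 0 (snd p)})"
      unfolding slope_monomial_def by (rule order_trans[OF keys_sum]) (auto split: if_splits)
    also have "\<dots> \<subseteq> (\<Union>e\<in>E. line_coords d e)"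
      using A(2) by (force simp: line_coords_def)
    finally show ?thesis .
  qed
  then have "Poly_Mapping.keys m \<subseteq> (\<Union>v\<in>V. point_coords d v) \<union> (\<Union>e\<in>E. line_coords d e)"
    if "m \<in> Poly_Mapping.keys (slope_polynomial A d n c)" for m
    using keys[OF that] by (intro le_supI2) auto
  moreover have "homogeneous_in (point_coords d v) (slope_polynomial A d n c)" for v
    unfolding homogeneous_in_def
  proof (intro exI ballI)
    fix m assume "m \<in> Poly_Mapping.keys (slope_polynomial A d n c)"
    then obtain \<kappa> where "m = slope_monomial A d n \<kappa>"
      using keys by blast
    then show "(\<Sum>c\<in>point_coords d v. Poly_Mapping.lookup m c) = 0"
      by (simp only: lookup_point)
  qed
  moreover have "homogeneous_in (line_coords d e) (slope_polynomial A d n c)" for e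
    unfolding homogeneous_in_def
  proof (intro exI ballI)
    fix m assume "m \<in> Poly_Mapping.keys (slope_polynomial A d n c)"
    then obtain \<kappa> where "\<kappa> \<in> ?K" "m = slope_monomial A d n \<kappa>"
      using keys by blast
    then show "(\<Sum>c\<in>line_coords d e. Poly_Mapping.lookup m c) = (if e \<in> A then (d - 1) * n else 0)"
      by (simp only: lookup_line)
  qed
  ultimately show ?thesis
    unfolding multihomogeneous_def by simp
qed

section \<open>Relations between slopes and reducibility\<close>

context oriented_graph
begin

text \<open>The displacements along a walk telescope. The coefficients \<open>W\<close> do not
  depend on \<open>y\<close>, so they serve all coordinates at once.\<close>

lemma difference_along_path:
  assumes "B \<subseteq> E" "(u, v) \<in> (edge_rel B)\<^sup>*"
  shows "\<exists>W. \<forall>y :: 'v \<Rightarrow> 'a::field. y v - y u = (\<Sum>b\<in>B. W b * (y (head b) - y (tail b)))"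
  using assms(2)
proof induction
  case base
  show ?case by (intro exI[of _ "\<lambda>_. 0"]) simp
next
  case (step v w)
  then obtain W where W: "\<And>y :: 'v \<Rightarrow> 'a. y v - y u = (\<Sum>b\<in>B. W b * (y (head b) - y (tail b)))"
    by auto
  define b0 where "b0 = {v, w}"
  have b0: "b0 \<in> B" "b0 \<in> E"
    using step.hyps(2) assms(1) by (auto simp: b0_def)
  \<comment> \<open>The sign records whether the step from \<open>v\<close> to \<open>w\<close> runs
    along or against the orientation.\<close>
  define s :: 'a where "s = (if tail b0 = v then 1 else - 1)"
  have "(tail b0 = v \<and> head b0 = w) \<or> (tail b0 = w \<and> head b0 = v \<and> tail b0 \<noteq> v)"
    using edge_ends[OF b0(2)] ends_distinct[OF b0(2)] by (auto simp: b0_def doubleton_eq_iff)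
  then have s: "y w - y v = s * (y (head b0) - y (tail b0))" for y :: "'v \<Rightarrow> 'a"
    by (auto simp: s_def)
  have finB: "finite B"
    using assms(1) finite_E finite_subset by auto
  define W' where "W' b = W b + (if b = b0 then s else 0)" for b
  have "y w - y u = (\<Sum>b\<in>B. W' b * (y (head b) - y (tail b)))" for y :: "'v \<Rightarrow> 'a"
  proof -
    have "(\<Sum>b\<in>B. W' b * (y (head b) - y (tail b))) = (\<Sum>b\<in>B. W b * (y (head b) - y (tail b)))
        + (\<Sum>b\<in>B. if b = b0 then s * (y (head b) - y (tail b)) else 0)"
      unfolding sum.distrib[symmetric] W'_def by (intro sum.cong) (auto simp: distrib_right)
    also have "\<dots> = (y v - y u) + (y w - y v)"
      using finB b0 W[of y] s[of y] by simp
    finally show ?thesis by simp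
  qed
  then show ?case
    by blast
qed

text \<open>There are \<open>(n + 1) ^ k\<close> slope monomials, with
  \<open>k = card A * (d - 1)\<close>. On displacements each becomes a form of degree
  \<open>k * n\<close> in the \<open>card Q = d * r(A)\<close> forest displacements, and
  \<open>card Q \<le> k\<close> is the hypothesis rearranged. For a suitable \<open>n\<close> they
  outnumber the monomials of that degree and so become dependent.\<close>

lemma vanishing_slope_polynomial_exists:
  assumes A: "A \<subseteq> E" "A \<noteq> {}" "card A \<le> d * nullity acyclic_edges A"
  obtains n and c :: "('v set \<times> nat \<Rightarrow> nat) \<Rightarrow> 'a::field"
  where "\<exists>\<kappa>\<in>A \<times> {2..d} \<rightarrow>\<^sub>E {..n}. c \<kappa> \<noteq> 0"
    "\<And>y :: 'v \<Rightarrow> nat \<Rightarrow> 'a. (\<Sum>\<kappa>\<in>A \<times> {2..d} \<rightarrow>\<^sub>E {..n}. c \<kappa> * (\<Prod>p\<in>A \<times> {1..d}.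
      (y (head (fst p)) (snd p) - y (tail (fst p)) (snd p)) ^ slope_exponent d n \<kappa> p)) = 0"
proof -
  have finA: "finite A" and cardA: "\<And>e. e \<in> A \<Longrightarrow> card e = 2"
    using A(1) finite_E finite_subset card_edge by auto
  obtain B where B: "B \<subseteq> A" "acyclic_edges B" "card B = matroid_rank acyclic_edges A"
    "\<And>u v. (u, v) \<in> (edge_rel A)\<^sup>* \<Longrightarrow> (u, v) \<in> (edge_rel B)\<^sup>*"
    using spanning_forest_exists[of A, OF finA cardA] by blast
  have finB: "finite B"
    using B(1) finA finite_subset by auto
  have card: "card A = card B + nullity acyclic_edges A"
    using card_eq_matroid_rank_plus_nullity[of A acyclic_edges, OF finA acyclic_edges_empty] B(3)
    by simp
  have cA: "0 < card A"
    using A(2) finA by (simp add: card_gt_0_iff)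
  obtain d' where d': "d = Suc d'"
    using A(3) cA by (cases d) auto
  obtain e0 where "e0 \<in> A"
    using A(2) by auto
  then have "card {e0} \<le> matroid_rank acyclic_edges A"
    using finA cardA by (intro card_le_matroid_rank acyclic_edges_singleton) auto
  then have cB: "0 < card B"
    using B(3) by simp
  have "\<exists>W. \<forall>y :: 'v \<Rightarrow> 'a. y (head e) - y (tail e) = (\<Sum>b\<in>B. W b * (y (head b) - y (tail b)))"
    if e: "e \<in> A" for e
  proof (rule difference_along_path)
    show "B \<subseteq> E"
      using B(1) A(1) by auto
    have "{tail e, head e} \<in> A"
      using edge_ends[of e] e A(1) by auto
    then show "(tail e, head e) \<in> (edge_rel B)\<^sup>*"
      by (intro B(4)) auto
  qed
  then have "\<forall>e\<in>A. \<exists>W. \<forall>y :: 'v \<Rightarrow> 'a. y (head e) - y (tail e)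
      = (\<Sum>b\<in>B. W b * (y (head b) - y (tail b)))"
    by blast
  from bchoice[OF this] obtain W where W: "\<forall>e\<in>A. \<forall>y :: 'v \<Rightarrow> 'a. y (head e) - y (tail e)
      = (\<Sum>b\<in>B. W e b * (y (head b) - y (tail b)))" ..
  define Q where "Q = B \<times> {1..d}"
  \<comment> \<open>The displacement of an edge in one coordinate is a linear form in the forest
    displacements of the same coordinate; coordinates do not mix.\<close>
  define l where "l p q = (if snd q = snd p then W (fst p) (fst q) else 0)"
    for p q :: "'v set \<times> nat"
  define k where "k = card A * (d - 1)"
  \<comment> \<open>Chosen so that \<open>(k * n + 1) ^ (card Q - 1) \<le> (k * (n + 1)) ^ (card Q -
    1) = n * (n + 1) ^ (card Q - 1)\<close>, which is less than \<open>(n + 1) ^ card Q\<close> and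
    hence less than the number of slope monomials.\<close>
  define n where "n = k ^ (card Q - 1)"
  define K where "K = (A \<times> {2..d} \<rightarrow>\<^sub>E {..n} :: ('v set \<times> nat \<Rightarrow> nat) set)"
  define g where "g \<kappa> z = (\<Prod>p\<in>A \<times> {1..d}. (\<Sum>q\<in>Q. l p q * z q) ^ slope_exponent d n \<kappa> p)"
    for \<kappa> and z :: "'v set \<times> nat \<Rightarrow> 'a"
  have finQ: "finite Q" and Qne: "Q \<noteq> {}" and cardQ: "card Q = card B * d"
    using finB cB d' by (auto simp: Q_def card_gt_0_iff)
  have finK: "finite K" and cardK: "card K = (n + 1) ^ k"
    using finA by (auto simp: K_def k_def intro!: finite_PiE simp: card_funcsetE card_cartesian_product)
  have Qk: "card Q \<le> k" and k1: "1 \<le> k"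
  proof -
    show "card Q \<le> k"
      using A(3) card unfolding cardQ k_def d' by (simp add: algebra_simps)
    then show "1 \<le> k"
      using cardQ cB d' by (cases k) auto
  qed
  have form: "is_form Q (k * n) (g \<kappa>)" if \<kappa>: "\<kappa> \<in> K" for \<kappa>
  proof -
    have "(\<Sum>p\<in>A \<times> {1..d}. slope_exponent d n \<kappa> p) = (\<Sum>e\<in>A. \<Sum>j=1..d. slope_exponent d n \<kappa> (e, j))"
      by (simp add: sum.cartesian_product)
    also have "\<dots> = (\<Sum>e\<in>A. (d - 1) * n)"
    proof (intro sum.cong refl sum_slope_exponent)
      fix e j assume "e \<in> A" "j \<in> {2..d}"
      then show "\<kappa> (e, j) \<le> n"
        using PiE_mem[OF \<kappa>[unfolded K_def], of "(e, j)"] by simp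
    qed (use d' in simp)
    also have "\<dots> = k * n"
      by (simp add: k_def)
    finally show ?thesis
      using is_form_prod_linear[OF finQ, of "A \<times> {1..d}" "slope_exponent d n \<kappa>" l] finA
      by (simp add: g_def[abs_def])
  qed
  have "card (exponents Q (k * n)) \<le> (k * n + 1) ^ (card Q - 1)"
    by (rule card_exponents_le[OF finQ Qne])
  also have "\<dots> \<le> (k * (n + 1)) ^ (card Q - 1)"
    using k1 by (intro power_mono) auto
  also have "\<dots> = n * (n + 1) ^ (card Q - 1)"
    by (simp only: power_mult_distrib n_def[symmetric])
  also have "\<dots> < (n + 1) * (n + 1) ^ (card Q - 1)"
    by simp
  also have "\<dots> = (n + 1) ^ card Q"
    using finQ Qne by (metis card_gt_0_iff power_eq_if less_not_refl)
  also have "\<dots> \<le> card K"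
    unfolding cardK using Qk by (intro power_increasing) auto
  finally have "card (exponents Q (k * n)) < card K" .
  with form obtain c where c: "\<exists>\<kappa>\<in>K. c \<kappa> \<noteq> 0" "\<And>z. (\<Sum>\<kappa>\<in>K. c \<kappa> * g \<kappa> z) = 0"
    using forms_dependent[OF finQ finK, of "k * n" g] by blast
  have "(\<Sum>\<kappa>\<in>K. c \<kappa> * (\<Prod>p\<in>A \<times> {1..d}.
      (y (head (fst p)) (snd p) - y (tail (fst p)) (snd p)) ^ slope_exponent d n \<kappa> p)) = 0"
    for y :: "'v \<Rightarrow> nat \<Rightarrow> 'a"
  proof -
    define z where "z q = y (head (fst q)) (snd q) - y (tail (fst q)) (snd q)" for q :: "'v set \<times> nat"
    have "y (head (fst p)) (snd p) - y (tail (fst p)) (snd p) = (\<Sum>q\<in>Q. l p q * z q)"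
      if p: "p \<in> A \<times> {1..d}" for p
    proof -
      have "(\<Sum>q\<in>Q. l p q * z q) = (\<Sum>b\<in>B. \<Sum>j=1..d. l p (b, j) * z (b, j))"
        by (simp add: Q_def sum.cartesian_product)
      also have "\<dots> = (\<Sum>b\<in>B. \<Sum>j=1..d. if j = snd p then W (fst p) b * z (b, j) else 0)"
        by (intro sum.cong) (auto simp: l_def)
      also have "\<dots> = (\<Sum>b\<in>B. W (fst p) b * z (b, snd p))"
        using p by auto
      also have "\<dots> = y (head (fst p)) (snd p) - y (tail (fst p)) (snd p)"
      proof -
        have "fst p \<in> A"
          using p by auto
        from W[rule_format, OF this, of "\<lambda>v. y v (snd p)"] show ?thesis
          by (simp add: z_def)
      qed
      finally show ?thesis ..
    qed
    then have "(\<Prod>p\<in>A \<times> {1..d}.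
      (y (head (fst p)) (snd p) - y (tail (fst p)) (snd p)) ^ slope_exponent d n \<kappa> p) = g \<kappa> z" for \<kappa>
      unfolding g_def by (intro prod.cong) auto
    then show ?thesis
      using c(2) by simp
  qed
  then show ?thesis
    using that[of n c] c(1) unfolding K_def by blast
qed

text \<open>The zero sets of \<open>f\<close> and \<open>g\<close> cover the picture space, and
  neither contains it. \<open>f\<close> is the relation between slopes; \<open>g\<close> vanishes
  where a vertex leaves the affine chart of coordinate 0 or an edge of \<open>A\<close> has no
  displacement in coordinate 1.\<close>

lemma picture_space_reducible:
  assumes inf: "infinite (UNIV :: 'a::field set)"
    and A: "A \<subseteq> E" "A \<noteq> {}" "card A \<le> d * nullity acyclic_edges A"
  shows "\<not> zariski_irreducible d V E (picture_space d V E :: ('v, 'a) picture set)"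
proof
  assume irr: "zariski_irreducible d V E (picture_space d V E :: ('v, 'a) picture set)"
  have finA: "finite A"
    using A(1) finite_E finite_subset by auto
  have d: "0 < d"
    using A(2,3) finA by (cases d) auto
  obtain n and c :: "('v set \<times> nat \<Rightarrow> nat) \<Rightarrow> 'a" where c: "\<exists>\<kappa>\<in>A \<times> {2..d} \<rightarrow>\<^sub>E {..n}. c \<kappa> \<noteq> 0"
    and vanish: "\<And>y :: 'v \<Rightarrow> nat \<Rightarrow> 'a. (\<Sum>\<kappa>\<in>A \<times> {2..d} \<rightarrow>\<^sub>E {..n}. c \<kappa> * (\<Prod>p\<in>A \<times> {1..d}.
      (y (head (fst p)) (snd p) - y (tail (fst p)) (snd p)) ^ slope_exponent d n \<kappa> p)) = 0"
    using vanishing_slope_polynomial_exists[OF A, where 'a='a] by blast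
  define f where "f = slope_polynomial A d n c"
  define g :: "('v coord, 'a) mpoly"
    where "g = (\<Prod>v\<in>V. first_coord v) * (\<Prod>e\<in>A. first_minor (tail e) (head e))"
  have f: "multihomogeneous d V E f"
    unfolding f_def by (rule multihomogeneous_slope_polynomial[OF d finA A(1)])
  have g: "multihomogeneous d V E g"
    unfolding g_def using A(1) tail_in_V head_in_V d
    by (intro multihomogeneous_mult multihomogeneous_prod multihomogeneous_first_coord
        multihomogeneous_first_minor) auto
  have eval_g: "mpoly_eval x g = (\<Prod>v\<in>V. x (Point_Coord v 0)) * (\<Prod>e\<in>A.
      x (Point_Coord (tail e) 0) * x (Point_Coord (head e) 1)
      - x (Point_Coord (tail e) 1) * x (Point_Coord (head e) 0))" for x
    by (simp add: g_def mpoly_eval_mult mpoly_eval_prod finite_V finA mpoly_eval_first_coord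
        mpoly_eval_first_minor)
  define Z where "Z h = {P \<in> ambient_space d V E. vanishes_at V E h P}" for h :: "('v coord, 'a) mpoly"
  have closed: "zariski_closed d V E (Z h)" if "multihomogeneous d V E h" for h
    unfolding zariski_closed_def Z_def using that by (intro exI[of _ "{h}"]) simp
  have "picture_space d V E \<subseteq> Z f \<union> Z g"
  proof
    fix P :: "('v, 'a) picture" assume P: "P \<in> picture_space d V E"
    have Pa: "P \<in> ambient_space d V E"
      using P picture_space_subset_ambient by blast
    have "vanishes_at V E f P" if nv: "\<not> vanishes_at V E g P"
    proof -
      obtain x where x: "homogeneous_coordinates V E P x" and gx: "mpoly_eval x g \<noteq> 0"
        using nv by (auto simp: vanishes_at_def)
      define y where "y v j = x (Point_Coord v j) / x (Point_Coord v 0)" for v j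
      have x0: "x (Point_Coord v 0) \<noteq> 0" if "v \<in> V" for v
        using gx that finite_V by (auto simp: eval_g)
      \<comment> \<open>In the affine coordinates \<open>y\<close>, the direction of the line is the
        displacement of its ends up to a factor, provided that the ends are distinct. The factor of
        \<open>g\<close> at \<open>e\<close>, being nonzero, guarantees this.\<close>
      have "\<exists>s. \<forall>j. x (Line_Coord e 0 j) = s * (y (head e) j - y (tail e) j)" if e: "e \<in> A" for e
      proof -
        have eE: "e \<in> E"
          using e A(1) by auto
        obtain a where a: "fst P (tail e) = vec.span {a}" "\<And>i. x (Point_Coord (tail e) i) = a i"
          using x tail_in_V[OF eE] by (auto simp: homogeneous_coordinates_def)
        obtain b where b: "fst P (head e) = vec.span {b}" "\<And>i. x (Point_Coord (head e) i) = b i"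
          using x head_in_V[OF eE] by (auto simp: homogeneous_coordinates_def)
        obtain u w where uw: "snd P e = vec.span {u, w}" "\<And>i j. x (Line_Coord e i j) = wedge u w i j"
          using x eE by (auto simp: homogeneous_coordinates_def wedge_def)
        have inc: "fst P v \<subseteq> snd P e" if "v \<in> e" for v
          using P eE that by (simp add: picture_space_def case_prod_unfold)
        have "tail e \<in> e" "head e \<in> e"
          using edge_ends[OF eE] by blast+
        then have "a \<in> vec.span {u, w}" "b \<in> vec.span {u, w}"
          using inc[of "tail e"] inc[of "head e"] vec.span_base[of a "{a}"] vec.span_base[of b "{b}"]
          unfolding a(1) b(1) uw(1) by auto
        then obtain r s r' s' where rs: "a = vscale r u + vscale s w" "b = vscale r' u + vscale s' w"
          unfolding span_pair_iff by blast
        define D where "D = r * s' - s * r'"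
        have D: "wedge a b i j = D * wedge u w i j" for i j
          unfolding rs wedge_combination D_def ..
        have "wedge a b 0 1 \<noteq> 0"
          using gx e finA unfolding eval_g wedge_def by (auto simp: a(2) b(2))
        then have "D \<noteq> 0"
          using D by auto
        moreover have "a 0 \<noteq> 0" "b 0 \<noteq> 0"
          using x0[OF tail_in_V[OF eE]] x0[OF head_in_V[OF eE]] by (simp_all add: a(2) b(2))
        ultimately have "x (Line_Coord e 0 j) = a 0 * b 0 / D * (y (head e) j - y (tail e) j)" for j
          using D[of 0 j] unfolding uw(2) y_def a(2) b(2)
          by (simp add: wedge_def[of a b] field_simps)
        then show ?thesis
          by blast
      qed
      then obtain s where s: "\<And>e j. e \<in> A \<Longrightarrow> x (Line_Coord e 0 j) = s e * (y (head e) j - y (tail e) j)"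
        by metis
      \<comment> \<open>All monomials of \<open>f\<close> have degree \<open>(d - 1) * n\<close> at
        each edge of \<open>A\<close>, so the factors \<open>s e\<close> combine to one factor that
        is the same for every \<open>\<kappa>\<close>.\<close>
      define S where "S = (\<Prod>e\<in>A. s e ^ ((d - 1) * n))"
      have "(\<Prod>p\<in>A \<times> {1..d}. x (Line_Coord (fst p) 0 (snd p)) ^ slope_exponent d n \<kappa> p)
          = S * (\<Prod>p\<in>A \<times> {1..d}.
            (y (head (fst p)) (snd p) - y (tail (fst p)) (snd p)) ^ slope_exponent d n \<kappa> p)"
        if \<kappa>: "\<kappa> \<in> A \<times> {2..d} \<rightarrow>\<^sub>E {..n}" for \<kappa>
      proof -
        have "(\<Prod>p\<in>A \<times> {1..d}. x (Line_Coord (fst p) 0 (snd p)) ^ slope_exponent d n \<kappa> p)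
            = (\<Prod>p\<in>A \<times> {1..d}. s (fst p) ^ slope_exponent d n \<kappa> p
              * (y (head (fst p)) (snd p) - y (tail (fst p)) (snd p)) ^ slope_exponent d n \<kappa> p)"
          by (rule prod.cong) (auto simp: s power_mult_distrib)
        also have "\<dots> = (\<Prod>p\<in>A \<times> {1..d}. s (fst p) ^ slope_exponent d n \<kappa> p) * (\<Prod>p\<in>A \<times> {1..d}.
            (y (head (fst p)) (snd p) - y (tail (fst p)) (snd p)) ^ slope_exponent d n \<kappa> p)"
          by (rule prod.distrib)
        also have "(\<Prod>p\<in>A \<times> {1..d}. s (fst p) ^ slope_exponent d n \<kappa> p)
            = (\<Prod>e\<in>A. \<Prod>j=1..d. s e ^ slope_exponent d n \<kappa> (e, j))"
          unfolding prod.cartesian_product by (intro prod.cong) auto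
        also have "\<dots> = S"
          unfolding S_def
        proof (intro prod.cong refl)
          fix e assume e: "e \<in> A"
          have "\<kappa> (e, j) \<le> n" if "j \<in> {2..d}" for j
            using PiE_mem[OF \<kappa>, of "(e, j)"] e that by simp
          then show "(\<Prod>j=1..d. s e ^ slope_exponent d n \<kappa> (e, j)) = s e ^ ((d - 1) * n)"
            using sum_slope_exponent[OF d, of \<kappa> e n] by (simp add: power_sum[symmetric])
        qed
        finally show ?thesis .
      qed
      then have "mpoly_eval x f = S * (\<Sum>\<kappa>\<in>A \<times> {2..d} \<rightarrow>\<^sub>E {..n}. c \<kappa> * (\<Prod>p\<in>A \<times> {1..d}.
          (y (head (fst p)) (snd p) - y (tail (fst p)) (snd p)) ^ slope_exponent d n \<kappa> p))"
        unfolding f_def mpoly_eval_slope_polynomial sum_distrib_left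
        by (intro sum.cong) (simp_all add: mult_ac)
      then show ?thesis
        using vanish[of y] vanishes_at_iff[OF finite_V finite_E f Pa x] by simp
    qed
    then show "P \<in> Z f \<union> Z g"
      using Pa by (auto simp: Z_def)
  qed
  then have "picture_space d V E \<subseteq> Z f \<or> picture_space d V E \<subseteq> Z g"
    using irr closed[OF f] closed[OF g] by (simp add: zariski_irreducible_def)
  then show False
  proof
    assume sub: "picture_space d V E \<subseteq> Z g"
    show False
    proof (rule generic_picture_exists[OF inf d])
      fix x :: "'v \<Rightarrow> nat \<Rightarrow> 'a"
      assume x: "generic_config d x" "\<And>v. v \<in> V \<Longrightarrow> x v 0 = 1"
        and ne: "\<And>e. e \<in> E \<Longrightarrow> x (tail e) 1 \<noteq> x (head e) 1"
      have "vanishes_at V E g (config_picture x)"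
        using sub config_picture_in_picture_space[OF x(1)] by (auto simp: Z_def)
      then have "mpoly_eval (vec_coords x (\<lambda>e. x (tail e)) (\<lambda>e. x (head e))) g = 0"
        using homogeneous_coordinates_vec_picture unfolding vanishes_at_def config_picture_def by blast
      then obtain e where e: "e \<in> A" "x (tail e) 0 * x (head e) 1 - x (tail e) 1 * x (head e) 0 = 0"
        using x(2) finite_V finA by (auto simp: eval_g)
      then have "e \<in> E"
        using A(1) by auto
      then show False
        using e(2) ne[of e] x(2)[OF tail_in_V[of e]] x(2)[OF head_in_V[of e]] by simp
    qed
  next
    assume sub: "picture_space d V E \<subseteq> Z f"
    have "(\<Sum>\<kappa>\<in>A \<times> {2..d} \<rightarrow>\<^sub>E {..n}. c \<kappa> * (\<Prod>p\<in>A \<times> {2..d}. s p ^ \<kappa> p)) = 0" for s :: "'v set \<times> nat \<Rightarrow> 'a"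
    proof -
      \<comment> \<open>All vertices at the origin of the affine chart, the edges having arbitrary slopes.\<close>
      define o0 :: "nat \<Rightarrow> 'a" where "o0 i = (if i = 0 then 1 else 0)" for i
      define w where "w e j = (if j = 1 then 1 else if 2 \<le> j \<and> j \<le> d then s (e, j) else 0)" for e j
      define P where "P = vec_picture V E (\<lambda>_. o0) (\<lambda>_. o0) w"
      have wedge: "wedge o0 (w e) 0 j = w e j" if "1 \<le> j" for e j
        using that by (simp add: wedge_def o0_def)
      have o0: "o0 \<in> coordinate_space d" "o0 \<noteq> 0"
        by (auto simp: o0_def coordinate_space_def fun_eq_iff)
      have "P \<in> picture_space d V E"
        unfolding P_def
      proof (rule vec_picture_in_picture_space)
        show "w e \<in> coordinate_space d" for e
          using d by (auto simp: w_def coordinate_space_def)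
        have "wedge o0 (w e) 0 1 \<noteq> 0" for e
          using wedge[of 1 e] by (simp add: w_def)
        then show "\<exists>i j. wedge o0 (w e) i j \<noteq> 0" for e
          by blast
        show "v \<in> V \<and> o0 \<in> vec.span {o0, w e}" if "e \<in> E" "v \<in> e" for e v
          using edge_subset[OF that(1)] that(2) by (auto intro: vec.span_base)
      qed (simp_all add: o0)
      then have "vanishes_at V E f P"
        using sub by (auto simp: Z_def)
      then have "mpoly_eval (vec_coords (\<lambda>_. o0) (\<lambda>_. o0) w) f = 0"
        using homogeneous_coordinates_vec_picture unfolding vanishes_at_def P_def by blast
      \<comment> \<open>As \<open>w e 1 = 1\<close>, the homogenizing power disappears, and
        \<open>f\<close> turns into the polynomial with coefficients \<open>c\<close> in the
        arbitrary values \<open>s\<close>.\<close>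
      moreover have "(\<Prod>p\<in>A \<times> {1..d}. vec_coords (\<lambda>_. o0) (\<lambda>_. o0) w (Line_Coord (fst p) 0 (snd p))
          ^ slope_exponent d n \<kappa> p) = (\<Prod>p\<in>A \<times> {2..d}. s p ^ \<kappa> p)" for \<kappa>
      proof (rule prod.mono_neutral_cong_right)
        show "finite (A \<times> {1..d})"
          using finA by simp
      qed (auto simp: wedge w_def slope_exponent_def)
      ultimately show ?thesis
        by (simp add: f_def mpoly_eval_slope_polynomial)
    qed
    then have "c \<kappa> = 0" if "\<kappa> \<in> A \<times> {2..d} \<rightarrow>\<^sub>E {..n}" for \<kappa>
      using coefficients_zero_if_polynomial_function_zero[OF inf _ _ that] finA by simp
    then show False
      using c by blast
  qed
qed

end


section \<open>The minimum constraint dimension\<close>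

text \<open>Clears the denominator. At nullity 0 both sides are false, the right one because
  \<open>A\<close> is nonempty, so the infinite ratio needs no separate treatment later.\<close>

lemma ceiling_ratio_le_iff:
  assumes "finite A" "A \<noteq> {}"
  shows "ceiling_ratio A \<le> enat d \<longleftrightarrow> card A \<le> d * nullity acyclic_edges A"
proof (cases "nullity acyclic_edges A = 0")
  case True
  then show ?thesis
    using assms by (simp add: ceiling_ratio_def card_gt_0_iff)
next
  case False
  then have "ceiling_ratio A \<le> enat d \<longleftrightarrow> real (card A) / real (nullity acyclic_edges A) \<le> real d"
    by (simp add: ceiling_ratio_def nat_le_iff ceiling_le_iff)
  also have "\<dots> \<longleftrightarrow> real (card A) \<le> real (d * nullity acyclic_edges A)"
    using False by (simp add: divide_le_eq)
  also have "\<dots> \<longleftrightarrow> card A \<le> d * nullity acyclic_edges A"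
    by (rule of_nat_le_iff)
  finally show ?thesis .
qed

theorem proposition3p1:
  fixes V :: "'v set" and E :: "'v set set"
  assumes "finite_simple_graph V E"
    and "connected_graph V E"
    and "\<not> acyclic_edges E"
  shows "mcd TYPE('a::alg_closed_field) V E =
      (MIN A\<in>{A. A \<noteq> {} \<and> flat acyclic_edges E A \<and> indecomposable acyclic_edges A}.
        ceiling_ratio A) \<and>
    {A. A \<noteq> {} \<and> flat acyclic_edges E A \<and> indecomposable acyclic_edges A} =
      {induced_edges E W |W. W \<subseteq> V \<and> two_connected_graph W (induced_edges E W)
        \<and> induced_edges E W \<noteq> {}}"
proof
  define F where "F = {A. A \<noteq> {} \<and> flat acyclic_edges E A \<and> indecomposable acyclic_edges A}"
  have E: "finite V" "\<And>e. e \<in> E \<Longrightarrow> e \<subseteq> V" "\<And>e. e \<in> E \<Longrightarrow> card e = 2"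
    using assms(1) by (auto simp: finite_simple_graph_def)
  have "\<forall>e\<in>E. \<exists>u. \<exists>v. e = {u, v} \<and> u \<noteq> v"
    using E(3) by (auto simp: card_2_iff)
  from bchoice[OF this] obtain t where "\<forall>e\<in>E. \<exists>v. e = {t e, v} \<and> t e \<noteq> v" ..
  from bchoice[OF this] obtain h where th: "\<forall>e\<in>E. e = {t e, h e} \<and> t e \<noteq> h e" ..
  interpret oriented_graph V E t h
    by unfold_locales (use E th in auto)
  have F_sub: "A \<subseteq> E" "A \<noteq> {}" "finite A" if "A \<in> F" for A
    using that finite_E finite_subset by (auto simp: F_def flat_def)
  have F_of: "\<exists>B\<in>F. card B \<le> d * nullity acyclic_edges B"
    if "A \<subseteq> E" "A \<noteq> {}" "card A \<le> d * nullity acyclic_edges A" for A d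
    by (rule overconstrained_indecomposable_flat[OF finite_E E(3) that]) (auto simp: F_def)
  \<comment> \<open>The left side is the condition under the infimum in \<open>mcd\<close>. On the
    right, positivity of \<open>d\<close> is automatic, since no nonempty set satisfies the
    inequality for d = 0.\<close>
  have reducible_iff: "0 < d \<and> \<not> zariski_irreducible d V E (picture_space d V E :: ('v, 'a) picture set)
      \<longleftrightarrow> (\<exists>A\<in>F. ceiling_ratio A \<le> enat d)" for d
  proof
    assume "0 < d \<and> \<not> zariski_irreducible d V E (picture_space d V E :: ('v, 'a) picture set)"
    then obtain A where "A \<subseteq> E" "A \<noteq> {}" "card A \<le> d * nullity acyclic_edges A"
      using picture_space_irreducible[OF infinite_UNIV_alg_closed] by (meson not_le)
    then show "\<exists>A\<in>F. ceiling_ratio A \<le> enat d"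
      using F_of ceiling_ratio_le_iff F_sub by metis
  next
    assume "\<exists>A\<in>F. ceiling_ratio A \<le> enat d"
    then obtain A where A: "A \<in> F" "card A \<le> d * nullity acyclic_edges A"
      using ceiling_ratio_le_iff F_sub by metis
    then have "0 < d"
      using F_sub[OF A(1)] by (cases d) auto
    then show "0 < d \<and> \<not> zariski_irreducible d V E (picture_space d V E :: ('v, 'a) picture set)"
      using picture_space_reducible[OF infinite_UNIV_alg_closed F_sub(1,2)[OF A(1)] A(2)] by simp
  qed
  have "finite F"
    using finite_subset[of F "Pow E"] finite_E F_sub(1) by auto
  \<comment> \<open>The minimum must range over a nonempty set. As \<open>E\<close> contains a
    cycle, its nullity is positive, so \<open>E\<close> satisfies the inequality for
    \<open>d = card E\<close>, and an indecomposable flat can be extracted from it.\<close>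
  moreover have "F \<noteq> {}"
  proof -
    have "E \<noteq> {}"
      using assms(3) acyclic_edges_empty by auto
    obtain B where B: "B \<subseteq> E" "acyclic_edges B" "card B = matroid_rank acyclic_edges E"
      by (rule matroid_rank_attained[of E acyclic_edges, OF finite_E acyclic_edges_empty])
    then have "B \<subset> E"
      using assms(3) by auto
    then have "card B < card E"
      by (rule psubset_card_mono[OF finite_E])
    then have "card E \<le> card E * nullity acyclic_edges E"
      using B(3) by (simp add: nullity_def)
    then show ?thesis
      using F_of[OF order_refl \<open>E \<noteq> {}\<close>, of "card E"] by auto
  qed
  ultimately have Min: "Min (ceiling_ratio ` F) \<in> ceiling_ratio ` F"
    "\<And>A. A \<in> F \<Longrightarrow> Min (ceiling_ratio ` F) \<le> ceiling_ratio A"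
    by (auto intro!: Min_in Min_le)
  have "mcd TYPE('a) V E = Inf {enat d |d. \<exists>A\<in>F. ceiling_ratio A \<le> enat d}"
    unfolding mcd_def reducible_iff ..
  also have "\<dots> = Min (ceiling_ratio ` F)"
  proof (rule antisym)
    show "Min (ceiling_ratio ` F) \<le> Inf {enat d |d. \<exists>A\<in>F. ceiling_ratio A \<le> enat d}"
      using Min(2) by (auto intro!: Inf_greatest intro: order_trans)
    obtain A where A: "A \<in> F" "Min (ceiling_ratio ` F) = ceiling_ratio A"
      using Min(1) by auto
    show "Inf {enat d |d. \<exists>A\<in>F. ceiling_ratio A \<le> enat d} \<le> Min (ceiling_ratio ` F)"
    proof (cases "ceiling_ratio A")
      case (enat d)
      have "\<exists>A\<in>F. ceiling_ratio A \<le> enat d"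
        using A(1) enat by (intro bexI[of _ A]) simp_all
      then show ?thesis
        unfolding A(2) enat by (intro Inf_lower) blast
    qed (simp add: A(2))
  qed
  finally show "mcd TYPE('a) V E = (MIN A\<in>{A. A \<noteq> {} \<and> flat acyclic_edges E A
      \<and> indecomposable acyclic_edges A}. ceiling_ratio A)"
    unfolding F_def .
qed (rule indecomposable_flats_eq_two_connected[OF assms(1)])

end
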